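(* Let $H$ be a separable Hilbert space with inner product $(\cdot\mid\cdot)$. Let $f\colon\underline I\to\mathbf R$ be a continuous convex function of $n$ variables defined on a cube $\underline I=I_1\times\cdots\times I_n$ of real intervals, and let $t\mapsto a_t\in B(H)$ be a unital column field on a locally compact Hausdorff space $T$ with a Radon measure $\nu$. If $t\mapsto\underline x_t=(x_{1t},\dots,x_{nt})$ is a bounded weak*-measurable field on $T$ of abelian $n$-tuples of self-adjoint operators on $H$ in the domain of $f$, then $$f\bigl((y_1\xi\mid\xi),\dots,(y_n\xi\mid\xi)\bigr)\le\left(\int_T a_t^*f(\underline x_t)a_t\,d\nu(t)\,\xi\;\Big|\;\xi\right)$$ for any unit vector $\xi\in H$, where the $n$-tuple $\underline y$ is defined by setting $$\underline y=(y_1,\dots,y_n)=\int_T a_t^*\underline x_t a_t\,d\nu(t),\qquad\text{i.e. } y_i=\int_T a_t^*x_{it}a_t\,d\nu(t),\quad i=1,\dots,n.$$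
   Context: **Abelian tuples and functional calculus.** An $n$-tuple $\underline x=(x_1,\dots,x_n)$ of operators is abelian if $x_1,\dots,x_n$ mutually commute. An abelian $n$-tuple of self-adjoint operators in $B(H)$ is in the domain of a real continuous function $f$ on $\underline I=I_1\times\cdots\times I_n$ if the spectrum $\sigma(x_i)\subseteq I_i$ for $i=1,\dots,n$. In that case $f(\underline x)=\int f(\lambda_1,\dots,\lambda_n)\,dE(\lambda_1,\dots,\lambda_n)$, where $E$ is the joint spectral measure on $\mathbf R^n$ determined by $E(S_1\times\cdots\times S_n)=E_1(S_1)\cdots E_n(S_n)$ for Borel sets $S_i\subseteq\mathbf R$, with $E_i$ the spectral measure of $x_i$. **Fields and integrals.** A field $(a_t)_{t\in T}$ of operators in $B(H)$ is weak*-measurable if for each vector $\xi\in H$ the function $t\mapsto a_t\xi$ is weakly (equivalently strongly) $\nu$-measurable; a field of $n$-tuples is weak*-measurable if each component is. Here $B(H)$ is regarded as the multiplier algebra of the $C^*$-algebra of compact operators on $H$, whose bounded functionals $\psi$ are given by $\psi(a)=\mathrm{Tr}(\rho a)$ with $\rho$ of trace class, and these are evaluated on $B(H)$ by the same formula; states correspond to positive $\rho$ of trace one. A weak*-measurable field is integrable if $t\mapsto|\psi(a_t)|$ is integrable for every such state $\psi$ and $\int_T|\psi(a_t)|\,d\nu(t)\le K$ for all such states and some constant $K$. For an integrable field, $\int_T a_t\,d\nu(t)$ denotes the unique element of $B(H)$ such that $\psi\left(\int_T a_t\,d\nu(t)\right)=\int_T\psi(a_t)\,d\nu(t)$ for all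 such functionals $\psi$. A field $(a_t)_{t\in T}$ is a unital column field if it is weak*-measurable and $\int_T a_t^*a_t\,d\nu(t)=1$.
   Formalization: If the cube is not closed, the field a_t* f(x_t) a_t is assumed integrable, since otherwise the right-hand integral may not exist (e.g. H=C, I=(0,∞), f(s)=1/s, T=(0,1), a_t=1, x_t=t); for a closed cube nothing is added. *)

theory Defs
  imports "HOL-Analysis.Analysis"
begin

section \<open>Complex Hilbert spaces\<close>

text \<open>
  A complex Hilbert space is a real Hilbert space carrying a complex scalar multiplication
  and a sesquilinear inner product, linear in the first argument, whose real part is the
  underlying real inner product; norm and topology are those of \<^class>\<open>real_inner\<close>.
\<close>

class complex_hilbert = real_inner + complete_space +
  fixes scaleC :: "complex \<Rightarrow> 'a \<Rightarrow> 'a" (infixr "*\<^sub>C" 75)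
    and cinner :: "'a \<Rightarrow> 'a \<Rightarrow> complex"
  assumes scaleC_add_right: "c *\<^sub>C (x + y) = c *\<^sub>C x + c *\<^sub>C y"
    and scaleC_add_left: "(c + d) *\<^sub>C x = c *\<^sub>C x + d *\<^sub>C x"
    and scaleC_scaleC: "c *\<^sub>C d *\<^sub>C x = (c * d) *\<^sub>C x"
    and scaleC_of_real: "complex_of_real r *\<^sub>C x = r *\<^sub>R x"
    and cinner_add_left: "cinner (x + y) z = cinner x z + cinner y z"
    and cinner_scaleC_left: "cinner (c *\<^sub>C x) y = c * cinner x y"
    and cinner_commute: "cinner x y = cnj (cinner y x)"
    and Re_cinner: "Re (cinner x y) = x \<bullet> y"

instantiation complex :: complex_hilbert
begin

definition scaleC_complex :: "complex \<Rightarrow> complex \<Rightarrow> complex"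
  where "scaleC_complex c x = c * x"

definition cinner_complex :: "complex \<Rightarrow> complex \<Rightarrow> complex"
  where "cinner_complex x y = x * cnj y"

instance
  by standard
    (auto simp: scaleC_complex_def cinner_complex_def algebra_simps inner_complex_def
      scaleR_conv_of_real)

end


section \<open>Bounded operators\<close>

definition bounded_clinear :: "('h::complex_hilbert \<Rightarrow> 'h) \<Rightarrow> bool"
  where "bounded_clinear a \<longleftrightarrow>
    bounded_linear a \<and> (\<forall>c \<xi>. a (c *\<^sub>C \<xi>) = c *\<^sub>C a \<xi>)"

definition cadjoint :: "('h::complex_hilbert \<Rightarrow> 'h) \<Rightarrow> 'h \<Rightarrow> 'h"
  where "cadjoint a = (THE b. \<forall>\<xi> \<eta>. cinner (a \<xi>) \<eta> = cinner \<xi> (b \<eta>))"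

definition selfadjoint_op :: "('h::complex_hilbert \<Rightarrow> 'h) \<Rightarrow> bool"
  where "selfadjoint_op a \<longleftrightarrow> bounded_clinear a \<and> cadjoint a = a"

definition positive_op :: "('h::complex_hilbert \<Rightarrow> 'h) \<Rightarrow> bool"
  where "positive_op a \<longleftrightarrow> bounded_clinear a \<and> (\<forall>\<xi>. cinner (a \<xi>) \<xi> \<in> \<real>\<^sub>\<ge>\<^sub>0)"

definition projection_op :: "('h::complex_hilbert \<Rightarrow> 'h) \<Rightarrow> bool"
  where "projection_op p \<longleftrightarrow> selfadjoint_op p \<and> p \<circ> p = p"

definition op_spectrum :: "('h::complex_hilbert \<Rightarrow> 'h) \<Rightarrow> complex set"
  where "op_spectrum a = {z. \<not> (\<exists>b. bounded_clinear b \<and>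
    b \<circ> (\<lambda>\<xi>. a \<xi> - z *\<^sub>C \<xi>) = id \<and> (\<lambda>\<xi>. a \<xi> - z *\<^sub>C \<xi>) \<circ> b = id)}"

definition abelian_tuple :: "('n \<Rightarrow> 'h::complex_hilbert \<Rightarrow> 'h) \<Rightarrow> bool"
  where "abelian_tuple x \<longleftrightarrow> (\<forall>i j. x i \<circ> x j = x j \<circ> x i)"


section \<open>Spectral measures and functional calculus\<close>

text \<open>
  Projection-valued measures on the Borel sets of a topological space.  The last clause
  fixes the irrelevant values outside the Borel sets, so that a projection-valued measure
  is determined as a function by its values on Borel sets.
\<close>

definition pvm :: "('a::topological_space set \<Rightarrow> 'h::complex_hilbert \<Rightarrow> 'h) \<Rightarrow> bool"
  where "pvm E \<longleftrightarrow>
    (\<forall>S\<in>sets borel. projection_op (E S)) \<and>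
    E {} = (\<lambda>_. 0) \<and> E UNIV = id \<and>
    (\<forall>S\<in>sets borel. \<forall>S'\<in>sets borel. E (S \<inter> S') = E S \<circ> E S') \<and>
    (\<forall>A::nat \<Rightarrow> 'a set. range A \<subseteq> sets borel \<longrightarrow> disjoint_family A \<longrightarrow>
      (\<forall>\<xi>. (\<lambda>k. E (A k) \<xi>) sums E (\<Union>k. A k) \<xi>)) \<and>
    (\<forall>S. S \<notin> sets borel \<longrightarrow> E S = (\<lambda>_. 0))"

definition pvm_measure ::
    "('a::topological_space set \<Rightarrow> 'h::complex_hilbert \<Rightarrow> 'h) \<Rightarrow> 'h \<Rightarrow> 'a measure"
  where "pvm_measure E \<xi> =
    measure_of UNIV (sets borel) (\<lambda>S. ennreal (Re (cinner (E S \<xi>) \<xi>)))"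

text \<open>
  \<open>has_pvm_integral E S f b\<close> says that the operator \<open>b\<close> is the integral of the real function
  \<open>f\<close> over the set \<open>S\<close> with respect to \<open>E\<close>.  By polarization the diagonal
  values \<open>cinner (b \<xi>) \<xi>\<close> determine \<open>b\<close>.
\<close>

definition has_pvm_integral ::
    "('a::topological_space set \<Rightarrow> 'h::complex_hilbert \<Rightarrow> 'h) \<Rightarrow> 'a set \<Rightarrow> ('a \<Rightarrow> real) \<Rightarrow>
      ('h \<Rightarrow> 'h) \<Rightarrow> bool"
  where "has_pvm_integral E S f b \<longleftrightarrow> bounded_clinear b \<and>
    (\<forall>\<xi>. set_integrable (pvm_measure E \<xi>) S f \<and>
      cinner (b \<xi>) \<xi> = complex_of_real (LINT l:S|pvm_measure E \<xi>. f l))"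

definition spectral_measure :: "('h::complex_hilbert \<Rightarrow> 'h) \<Rightarrow> real set \<Rightarrow> 'h \<Rightarrow> 'h"
  where "spectral_measure x = (THE E. pvm E \<and> has_pvm_integral E UNIV (\<lambda>l. l) x)"

text \<open>
  The index type of a tuple carries no order, so the product of the (commuting) operators
  \<open>E\<^sub>i(S\<^sub>i)\<close> is required to be the value on the box for every enumeration of the indices.
\<close>

definition joint_spectral_measure ::
    "('n::finite \<Rightarrow> 'h::complex_hilbert \<Rightarrow> 'h) \<Rightarrow> (real^'n) set \<Rightarrow> 'h \<Rightarrow> 'h"
  where "joint_spectral_measure x = (THE E. pvm E \<and>
    (\<forall>S. (\<forall>i. S i \<in> sets borel) \<longrightarrow>
      (\<forall>is. distinct is \<longrightarrow> set is = UNIV \<longrightarrow>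
        E {l. \<forall>i. l $ i \<in> S i} = foldr (\<lambda>i b. spectral_measure (x i) (S i) \<circ> b) is id)))"

text \<open>
  \<open>f(x)\<close> for a function \<open>f\<close> given on the set \<open>I\<close>; values of \<open>f\<close> outside \<open>I\<close> are not used.
\<close>

definition functional_calculus ::
    "(real^'n) set \<Rightarrow> (real^'n \<Rightarrow> real) \<Rightarrow> ('n::finite \<Rightarrow> 'h::complex_hilbert \<Rightarrow> 'h) \<Rightarrow> 'h \<Rightarrow> 'h"
  where "functional_calculus I f x = (THE b. has_pvm_integral (joint_spectral_measure x) I f b)"


section \<open>Trace class operators\<close>

definition orthonormal_basis :: "'h::complex_hilbert set \<Rightarrow> bool"
  where "orthonormal_basis B \<longleftrightarrow>
    (\<forall>e\<in>B. norm e = 1) \<and> (\<forall>e\<in>B. \<forall>e'\<in>B. e \<noteq> e' \<longrightarrow> cinner e e' = 0) \<and>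
    (\<forall>\<xi>. (\<forall>e\<in>B. cinner \<xi> e = 0) \<longrightarrow> \<xi> = 0)"

text \<open>
  Neither the trace class nor the trace depends on the orthonormal basis chosen here.
\<close>

definition some_onb :: "'h::complex_hilbert set"
  where "some_onb = (SOME B. orthonormal_basis B)"

text \<open>In the next definition \<open>p\<close> is the absolute value of \<open>\<rho>\<close>.\<close>

definition trace_class :: "('h::complex_hilbert \<Rightarrow> 'h) \<Rightarrow> bool"
  where "trace_class \<rho> \<longleftrightarrow> bounded_clinear \<rho> \<and>
    (\<exists>p. positive_op p \<and> p \<circ> p = cadjoint \<rho> \<circ> \<rho> \<and>
      (\<lambda>e. cinner (p e) e) summable_on some_onb)"

definition op_trace :: "('h::complex_hilbert \<Rightarrow> 'h) \<Rightarrow> complex"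
  where "op_trace a = (\<Sum>\<^sub>\<infinity>e\<in>some_onb. cinner (a e) e)"

definition density_op :: "('h::complex_hilbert \<Rightarrow> 'h) \<Rightarrow> bool"
  where "density_op \<rho> \<longleftrightarrow> trace_class \<rho> \<and> positive_op \<rho> \<and> op_trace \<rho> = 1"


section \<open>Fields of operators\<close>

definition radon_measure :: "'t::topological_space measure \<Rightarrow> bool"
  where "radon_measure \<nu> \<longleftrightarrow> sets \<nu> = sets borel \<and>
    (\<forall>K. compact K \<longrightarrow> emeasure \<nu> K < \<infinity>) \<and>
    (\<forall>A\<in>sets borel. emeasure \<nu> A = (INF U\<in>{U. open U \<and> A \<subseteq> U}. emeasure \<nu> U)) \<and>
    (\<forall>U. open U \<longrightarrow> emeasure \<nu> U = (SUP K\<in>{K. compact K \<and> K \<subseteq> U}. emeasure \<nu> K))"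

text \<open>
  A function is \<open>\<nu>\<close>-measurable if it is measurable with respect to the completion of the
  Borel measure \<open>\<nu>\<close>; integrals of such functions are taken against the completion.
  As \<open>B(H)\<close> is the multiplier algebra of the compact operators, integrals of operator
  fields are evaluated on the functionals \<open>\<lambda>a. op_trace (\<rho> \<circ> a)\<close> with \<open>\<rho>\<close> of trace class.
\<close>

definition weak_star_measurable ::
    "'t measure \<Rightarrow> ('t \<Rightarrow> 'h::complex_hilbert \<Rightarrow> 'h) \<Rightarrow> bool"
  where "weak_star_measurable \<nu> a \<longleftrightarrow> (\<forall>t. bounded_clinear (a t)) \<and>
    (\<forall>\<xi> \<eta>. (\<lambda>t. cinner (a t \<xi>) \<eta>) \<in> borel_measurable (completion \<nu>))"

definition op_integrable ::
    "'t measure \<Rightarrow> ('t \<Rightarrow> 'h::complex_hilbert \<Rightarrow> 'h) \<Rightarrow> bool"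
  where "op_integrable \<nu> a \<longleftrightarrow> weak_star_measurable \<nu> a \<and>
    (\<exists>K. \<forall>\<rho>. density_op \<rho> \<longrightarrow>
      integrable (completion \<nu>) (\<lambda>t. cmod (op_trace (\<rho> \<circ> a t))) \<and>
      (LINT t|completion \<nu>. cmod (op_trace (\<rho> \<circ> a t))) \<le> K)"

text \<open>
  Only integrable fields have an integral.  The first clause is needed because the Bochner
  integral of a non-integrable scalar function is \<open>0\<close>.
\<close>

definition op_integral ::
    "'t measure \<Rightarrow> ('t \<Rightarrow> 'h::complex_hilbert \<Rightarrow> 'h) \<Rightarrow> 'h \<Rightarrow> 'h"
  where "op_integral \<nu> a = (THE b. op_integrable \<nu> a \<and> bounded_clinear b \<and>
    (\<forall>\<rho>. trace_class \<rho> \<longrightarrow>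
      op_trace (\<rho> \<circ> b) = (LINT t|completion \<nu>. op_trace (\<rho> \<circ> a t))))"

definition unital_column_field ::
    "'t measure \<Rightarrow> ('t \<Rightarrow> 'h::complex_hilbert \<Rightarrow> 'h) \<Rightarrow> bool"
  where "unital_column_field \<nu> a \<longleftrightarrow> weak_star_measurable \<nu> a \<and>
    op_integrable \<nu> (\<lambda>t. cadjoint (a t) \<circ> a t) \<and>
    op_integral \<nu> (\<lambda>t. cadjoint (a t) \<circ> a t) = id"

end

theory Submission
  imports Defs "HOL-Probability.Probability" "HOL-Computational_Algebra.Polynomial"
begin

text \<open>
  A commuting tuple \<open>x\<close> of self-adjoint operators has a joint spectral measure: the Bernstein
  weights of the \<open>x\<^sub>i\<close> are positive operators, so their diagonal values are probability measures on
  a grid, and weak limits of these have the moments of \<open>x\<close>; indicators of orthants are pointwise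
  limits of polynomials, and Dynkin's argument yields the spectral projections. Hence
  \<open>f(x)\<close> is the integral of \<open>f\<close>, and \<open>f(x) \<ge> \<alpha> + \<Sum>\<^sub>i v\<^sub>i x\<^sub>i\<close> whenever \<open>f \<ge> \<alpha> + v \<bullet> l\<close> on the cube.
  Integrals of operator fields are evaluated on vector states, for which trace class operators
  are factored through Hilbert--Schmidt operators. The vector \<open>c = ((y\<^sub>i \<xi> | \<xi>))\<^sub>i\<close> is a mean of points
  of the cube with respect to the weight \<open>(norm (a\<^sub>t \<xi>))\<^sup>2\<close>, so it lies in the cube, and the closed
  epigraph of \<open>f\<close> provides an affine minorant of \<open>f\<close> with value at least \<open>f c - e\<close> at \<open>c\<close>.
  Integrating it proves the inequality.
\<close>

section \<open>Complex Hilbert spaces\<close>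

text \<open>Square roots of positive operators are obtained from the spectral theorem, so the
  positivity of products of commuting positive operators, on which the spectral theorem rests, has
  to come from an elementary source. The approximation of indicators by polynomials is uniform in
  the operator: the polynomials depend only on a bound \<open>C\<close> of the quadratic forms. One
  sequence therefore both determines a spectral measure and shows its measurability in
  \<open>t\<close>, where no pointwise construction would say anything about \<open>t\<close>. The
  cube need not be closed. Each single tuple still lives on a compact box inside it, because the
  bounds of a numerical range lie in the spectrum. But these boxes may approach a missing face as
  \<open>t\<close> varies, where \<open>f\<close> may blow up; hence the alternative in the
  hypothesis on the right-hand side. At a point of the boundary a continuous convex function may
  have no supporting affine function at all, as minus the square root at 0 shows; hence the loss of
  \<open>e\<close>.\<close>

lemma cinner_zero_left [simp]: "cinner 0 (y::'h::complex_hilbert) = 0"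
  using cinner_add_left[of 0 0 y] by simp

lemma cinner_minus_left [simp]: "cinner (- x) (y::'h::complex_hilbert) = - cinner x y"
  using cinner_add_left[of x "- x" y] by (simp add: eq_neg_iff_add_eq_0 add.commute)

lemma cinner_diff_left: "cinner (x - z) (y::'h::complex_hilbert) = cinner x y - cinner z y"
  using cinner_add_left[of x "- z" y] by simp

lemma cinner_add_right: "cinner (x::'h::complex_hilbert) (y + z) = cinner x y + cinner x z"
  by (metis cinner_add_left cinner_commute complex_cnj_add)

lemma cinner_scaleC_right: "cinner (x::'h::complex_hilbert) (c *\<^sub>C y) = cnj c * cinner x y"
  by (metis cinner_scaleC_left cinner_commute complex_cnj_mult)

lemma cinner_zero_right [simp]: "cinner (x::'h::complex_hilbert) 0 = 0"
  using cinner_add_right[of x 0 0] by simp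

lemma cinner_minus_right [simp]: "cinner (x::'h::complex_hilbert) (- y) = - cinner x y"
  using cinner_add_right[of x y "- y"] by (simp add: eq_neg_iff_add_eq_0 add.commute)

lemma cinner_diff_right: "cinner (x::'h::complex_hilbert) (y - z) = cinner x y - cinner x z"
  using cinner_add_right[of x y "- z"] by simp

lemma cinner_scaleR_left: "cinner (r *\<^sub>R x) (y::'h::complex_hilbert) = of_real r * cinner x y"
  by (metis cinner_scaleC_left scaleC_of_real)

lemma cinner_scaleR_right: "cinner (x::'h::complex_hilbert) (r *\<^sub>R y) = of_real r * cinner x y"
  by (metis cinner_scaleC_right scaleC_of_real complex_cnj_complex_of_real)

lemma cinner_sum_left: "cinner (\<Sum>i\<in>A. f i) (y::'h::complex_hilbert) = (\<Sum>i\<in>A. cinner (f i) y)"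
  by (induction A rule: infinite_finite_induct) (auto simp: cinner_add_left)

lemma cinner_sum_right: "cinner (y::'h::complex_hilbert) (\<Sum>i\<in>A. f i) = (\<Sum>i\<in>A. cinner y (f i))"
  by (induction A rule: infinite_finite_induct) (auto simp: cinner_add_right)

lemmas cinner_algebra =
  cinner_add_left cinner_add_right cinner_diff_left cinner_diff_right
  cinner_scaleC_left cinner_scaleC_right cinner_scaleR_left cinner_scaleR_right

lemma cinner_self: "cinner (x::'h::complex_hilbert) x = of_real ((norm x)\<^sup>2)"
proof -
  have "Im (cinner x x) = 0"
    using arg_cong[OF cinner_commute[of x x], of Im] by simp
  then show ?thesis
    by (simp add: complex_eq_iff Re_cinner dot_square_norm)
qed

lemma norm_scaleC: "norm (c *\<^sub>C (x::'h::complex_hilbert)) = cmod c * norm x"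
proof -
  have "of_real ((norm (c *\<^sub>C x))\<^sup>2) = complex_of_real ((cmod c * norm x)\<^sup>2)"
    unfolding cinner_self[symmetric] cinner_scaleC_left cinner_scaleC_right
    by (simp add: cinner_self power_mult_distrib complex_norm_square[unfolded of_real_power, symmetric] mult_ac)
  then have "(norm (c *\<^sub>C x))\<^sup>2 = (cmod c * norm x)\<^sup>2"
    using of_real_eq_iff by blast
  then show ?thesis by (simp add: power2_eq_iff_nonneg)
qed

lemma scaleC_zero_right [simp]: "c *\<^sub>C (0::'h::complex_hilbert) = 0"
  using norm_scaleC[of c 0] by simp

lemma scaleC_one [simp]: "1 *\<^sub>C (x::'h::complex_hilbert) = x"
  using scaleC_of_real[of 1 x] by simp

lemma scaleC_minus_right: "c *\<^sub>C (- x) = - (c *\<^sub>C (x::'h::complex_hilbert))"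
  by (metis add_eq_0_iff scaleC_add_right scaleC_zero_right)

lemma scaleC_diff_right: "c *\<^sub>C (x - y) = c *\<^sub>C x - c *\<^sub>C (y::'h::complex_hilbert)"
  using scaleC_add_right[of c x "- y"] by (simp add: scaleC_minus_right)

lemma scaleC_scaleR: "c *\<^sub>C (r *\<^sub>R x) = r *\<^sub>R (c *\<^sub>C (x::'h::complex_hilbert))"
  by (metis mult.commute scaleC_of_real scaleC_scaleC)

text \<open>A unimodular factor turns the product into its modulus, and the real Cauchy-Schwarz
  inequality applies to the rotated vector.\<close>

lemma cmod_cinner_le: "cmod (cinner (x::'h::complex_hilbert) y) \<le> norm x * norm y"
proof (cases "cinner x y = 0")
  case False
  define c where "c = cnj (cinner x y) / cmod (cinner x y)"
  have c: "cmod c = 1" using False by (simp add: c_def norm_divide)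
  have "cinner (c *\<^sub>C x) y = of_real (cmod (cinner x y))"
    using False by (simp add: c_def cinner_scaleC_left divide_simps)
      (simp add: complex_norm_square[unfolded of_real_power, symmetric] power2_eq_square mult.commute)
  then have "cmod (cinner x y) = (c *\<^sub>C x) \<bullet> y"
    by (metis Re_cinner Re_complex_of_real)
  also have "\<dots> \<le> norm (c *\<^sub>C x) * norm y" by (rule norm_cauchy_schwarz)
  finally show ?thesis by (simp add: norm_scaleC c)
qed simp

lemma cinner_eqI: "(\<And>z. cinner x z = cinner y z) \<Longrightarrow> x = (y::'h::complex_hilbert)"
  using cinner_diff_left[of x y "x - y"] cinner_self[of "x - y"] by simp

lemma cinner_eqI_right: "(\<And>z. cinner z x = cinner z y) \<Longrightarrow> x = (y::'h::complex_hilbert)"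
  using cinner_diff_right[of "x - y" x y] cinner_self[of "x - y"] by simp

lemma bounded_bilinear_cinner: "bounded_bilinear (cinner :: 'h::complex_hilbert \<Rightarrow> 'h \<Rightarrow> complex)"
proof
  show "\<exists>K. \<forall>a b. norm (cinner (a::'h) b) \<le> norm a * norm b * K"
    by (intro exI[of _ 1]) (simp add: cmod_cinner_le)
qed (auto simp: cinner_algebra scaleR_conv_of_real)

lemmas tendsto_cinner [tendsto_intros] = bounded_bilinear.tendsto[OF bounded_bilinear_cinner]

lemma tendsto_scaleC [tendsto_intros]:
  assumes "(f \<longlongrightarrow> (l::'h::complex_hilbert)) F"
  shows "((\<lambda>x. c *\<^sub>C f x) \<longlongrightarrow> c *\<^sub>C l) F"
proof -
  have "bounded_linear (\<lambda>x::'h. c *\<^sub>C x)"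
    by (rule bounded_linear_intro[of _ "cmod c"])
      (auto simp: scaleC_add_right scaleC_scaleR norm_scaleC mult.commute)
  from bounded_linear.tendsto[OF this assms] show ?thesis .
qed

lemma inner_scaleC_ii: "(\<i> *\<^sub>C x) \<bullet> y = - Im (cinner x (y::'h::complex_hilbert))"
  by (simp add: Re_cinner[symmetric] cinner_algebra)

section \<open>Bounded complex-linear operators and their quadratic forms\<close>

lemma bounded_clinearD:
  assumes "bounded_clinear a"
  shows "bounded_linear a" "a (x + y) = a x + a y" "a (x - y) = a x - a y" "a (- x) = - a x"
    "a 0 = 0" "a (c *\<^sub>C x) = c *\<^sub>C a x" "a (r *\<^sub>R x) = r *\<^sub>R a x"
  using assms by (auto simp: bounded_clinear_def linear_simps bounded_linear.linear linear_cmul)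

lemma bounded_clinear_sum_arg:
  "bounded_clinear a \<Longrightarrow> a (\<Sum>i\<in>A. f i) = (\<Sum>i\<in>A. a (f i))"
  by (simp add: bounded_clinearD(1) bounded_linear.linear linear_sum)

lemma bounded_clinearI:
  fixes a :: "'h::complex_hilbert \<Rightarrow> 'h"
  assumes "\<And>x y. a (x + y) = a x + a y" "\<And>c x. a (c *\<^sub>C x) = c *\<^sub>C a x"
    "\<And>x. norm (a x) \<le> K * norm x"
  shows "bounded_clinear a"
  unfolding bounded_clinear_def
  using assms by (auto intro!: bounded_linear_intro[of a K] simp: mult.commute scaleC_of_real[symmetric])

lemma bounded_clinear_bound:
  assumes "bounded_clinear a"
  obtains K where "K > 0" "\<And>x. norm (a x) \<le> K * norm x"
  using bounded_linear.pos_bounded[OF bounded_clinearD(1)[OF assms]] by (metis mult.commute)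

lemma bounded_clinear_id [simp]: "bounded_clinear id" "bounded_clinear (\<lambda>x. x)"
  by (auto simp: bounded_clinear_def id_def)

lemma bounded_clinear_zero [simp]: "bounded_clinear (\<lambda>_. 0)"
  by (auto simp: bounded_clinear_def)

lemma bounded_clinear_comp [intro]:
  "bounded_clinear a \<Longrightarrow> bounded_clinear b \<Longrightarrow> bounded_clinear (a \<circ> b)"
  by (auto simp: bounded_clinear_def o_def intro: bounded_linear_compose)

lemma bounded_clinear_add:
  "bounded_clinear a \<Longrightarrow> bounded_clinear b \<Longrightarrow> bounded_clinear (\<lambda>x. a x + b x)"
  by (auto simp: bounded_clinear_def scaleC_add_right intro: bounded_linear_add)

lemma bounded_clinear_diff:
  "bounded_clinear a \<Longrightarrow> bounded_clinear b \<Longrightarrow> bounded_clinear (\<lambda>x. a x - b x)"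
  by (auto simp: bounded_clinear_def scaleC_diff_right intro: bounded_linear_sub)

lemma bounded_clinear_scaleR:
  "bounded_clinear a \<Longrightarrow> bounded_clinear (\<lambda>x. r *\<^sub>R a x)"
  by (auto simp: bounded_clinear_def scaleC_scaleR
      intro: bounded_linear_compose[OF bounded_linear_scaleR_right])

lemma bounded_clinear_sum:
  "(\<And>i. i \<in> A \<Longrightarrow> bounded_clinear (f i)) \<Longrightarrow> bounded_clinear (\<lambda>x.
      \<Sum>i\<in>A. f i x)"
  by (induction A rule: infinite_finite_induct) (auto intro: bounded_clinear_add)

text \<open>Complex scalars recover the whole form from its diagonal. For this reason diagonal
  values suffice below to identify operators, to define their integrals and to test
  measurability.\<close>

lemma cinner_polarization:
  assumes "bounded_clinear a"
  shows "4 * cinner (a x) y =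
    cinner (a (x + y)) (x + y) - cinner (a (x - y)) (x - y)
    + \<i> * cinner (a (x + \<i> *\<^sub>C y)) (x + \<i> *\<^sub>C y) - \<i> * cinner (a (x - \<i> *\<^sub>C y)) (x -
        \<i> *\<^sub>C y)"
  by (simp add: bounded_clinearD[OF assms] cinner_algebra algebra_simps)

lemma clinear_eqI:
  assumes "bounded_clinear a" "bounded_clinear b" "\<And>x. cinner (a x) x = cinner (b x) x"
  shows "a = b"
proof
  fix x show "a x = b x"
  proof (rule cinner_eqI)
    fix y
    have "4 * cinner (a x) y = 4 * cinner (b x) y"
      unfolding cinner_polarization[OF assms(1)] cinner_polarization[OF assms(2)] assms(3) ..
    then show "cinner (a x) y = cinner (b x) y" by simp
  qed
qed

text \<open>The vector \<open>g\<close> is the limit of \<open>q v\<^sub>k\<close> along a minimizing sequence of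
  \<open>\<lambda>v. (norm (q v))\<^sup>2 - 2 * \<phi> v\<close>.  With \<open>q\<close> the identity this is
  the Riesz representation theorem, in general it is Douglas' factorization lemma.\<close>

lemma riesz_factorization:
  fixes q :: "'a::real_vector \<Rightarrow> 'h::{real_inner,complete_space}" and \<phi> :: "'a \<Rightarrow> real"
  assumes q: "linear q" and \<phi>: "linear \<phi>" and C: "C \<ge> 0" and bound: "\<And>v. \<bar>\<phi> v\<bar> \<le>
      C * norm (q v)"
  obtains g where "g \<in> closure (range q)" "\<And>v. \<phi> v = q v \<bullet> g" "norm g \<le> C"
proof -
  define J where "J v = (norm (q v))\<^sup>2 - 2 * \<phi> v" for v
  note lin = linear_add[OF q] linear_cmul[OF q] linear_diff[OF q]
    linear_add[OF \<phi>] linear_cmul[OF \<phi>] linear_diff[OF \<phi>]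
  have Jlow: "- C\<^sup>2 \<le> J v" for v
  proof -
    have "0 \<le> (norm (q v) - C)\<^sup>2" by simp
    then show ?thesis using bound[of v] unfolding J_def power2_diff by (simp add: abs_le_iff mult_ac)
  qed
  have bdd: "bdd_below (range J)" using Jlow by (auto intro!: bdd_belowI)
  define d where "d = Inf (range J)"
  have d: "d \<le> J v" for v unfolding d_def using bdd by (auto intro: cInf_lower)
  have "\<exists>v. J v < d + 1 / real (Suc k)" for k
    using cInf_less_iff[OF _ bdd, of "d + 1 / real (Suc k)"] by (auto simp: d_def)
  then obtain v where v: "\<And>k. J (v k) < d + 1 / real (Suc k)" by metis
  \<comment> \<open>The parallelogram law at the midpoint of \<open>v k\<close> and
    \<open>v j\<close>: two near-minimizers of \<open>J\<close> have close images under
    \<open>q\<close>.\<close>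
  have dist: "(norm (q (v k) - q (v j)))\<^sup>2 \<le> 2 * (1 / real (Suc k) + 1 / real (Suc j))" for k j
  proof -
    have "(norm (q (v k) - q (v j)))\<^sup>2 = 2 * J (v k) + 2 * J (v j) - 4 * J ((1/2) *\<^sub>R (v k + v j))"
      unfolding J_def by (simp only: lin)
        (simp add: power2_norm_eq_inner algebra_simps inner_commute)
    then show ?thesis using v[of k] v[of j] d[of "(1/2) *\<^sub>R (v k + v j)"] by (smt (verit))
  qed
  have "Cauchy (\<lambda>k. q (v k))"
  proof (rule metric_CauchyI)
    fix e :: real assume e: "e > 0"
    obtain N where N: "4 / e\<^sup>2 < real N" using reals_Archimedean2 by blast
    have "dist (q (v k)) (q (v j)) < e" if "k \<ge> N" "j \<ge> N" for k j
    proof -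
      have N0: "real N > 0" using N e by (smt (verit) divide_pos_pos zero_less_power)
      have "1 / real (Suc k) < 1 / real N" "1 / real (Suc j) < 1 / real N"
        using that N0 by (auto intro!: divide_strict_left_mono)
      then have "2 * (1 / real (Suc k) + 1 / real (Suc j)) < 2 * (1 / real N + 1 / real N)"
        by (intro mult_strict_left_mono add_strict_mono) auto
      then have "(norm (q (v k) - q (v j)))\<^sup>2 < 2 * (1 / real N + 1 / real N)"
        using dist[of k j] by (rule le_less_trans[rotated])
      also have "\<dots> < e\<^sup>2" using N N0 e by (simp add: field_simps)
      finally show ?thesis using e by (simp add: dist_norm power_less_imp_less_base)
    qed
    then show "\<exists>N. \<forall>k\<ge>N. \<forall>j\<ge>N. dist (q (v k)) (q (v j)) < e" by blast
  qed
  then obtain g where g: "(\<lambda>k. q (v k)) \<longlonglongrightarrow> g" by (metis Cauchy_convergent_iff convergent_def)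
  have eps: "(\<lambda>k. 1 / real (Suc k)) \<longlonglongrightarrow> 0" using LIMSEQ_inverse_real_of_nat by (simp add:
      inverse_eq_divide)
  have eq: "\<phi> w = q w \<bullet> g" for w
  proof -
    \<comment> \<open>First variation: \<open>J\<close> at \<open>v k + s w\<close> is at least the
      infimum, and the error 1/(k+1) disappears in the limit.\<close>
    have quad: "0 \<le> 2 * s * (q w \<bullet> g - \<phi> w) + s\<^sup>2 * (norm (q w))\<^sup>2" for s
    proof -
      have "0 \<le> 1 / real (Suc k) + 2 * s * (q w \<bullet> q (v k) - \<phi> w) + s\<^sup>2 * (norm (q w))\<^sup>2" for k
      proof -
        have "J (v k + s *\<^sub>R w) = J (v k) + 2 * s * (q w \<bullet> q (v k) - \<phi> w) + s\<^sup>2 * (norm (q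
            w))\<^sup>2"
          unfolding J_def by (simp only: lin)
            (simp add: power2_norm_eq_inner algebra_simps inner_commute power2_eq_square[of s])
        then show ?thesis using d[of "v k + s *\<^sub>R w"] v[of k] by linarith
      qed
      moreover have "(\<lambda>k. 1 / real (Suc k) + 2 * s * (q w \<bullet> q (v k) - \<phi> w) + s\<^sup>2 * (norm (q
          w))\<^sup>2)
        \<longlonglongrightarrow> 0 + 2 * s * (q w \<bullet> g - \<phi> w) + s\<^sup>2 * (norm (q w))\<^sup>2"
        by (intro tendsto_intros g eps)
      ultimately show ?thesis by (metis (no_types, lifting) LIMSEQ_le_const add_0)
    qed
    define A where "A = q w \<bullet> g - \<phi> w"
    \<comment> \<open>The quadratic in \<open>s\<close> is evaluated near its minimum at
      \<open>s = - A / B\<close>. The summand 1 keeps the divisor positive when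
      \<open>q w = 0\<close>.\<close>
    define B where "B = (norm (q w))\<^sup>2 + 1"
    have B: "B > 0" unfolding B_def by (smt (verit) zero_le_power2)
    have "0 \<le> 2 * (- A / B) * A + (- A / B)\<^sup>2 * (norm (q w))\<^sup>2" using quad[of "- A / B"] unfolding A_def .
    also have "\<dots> \<le> 2 * (- A / B) * A + (- A / B)\<^sup>2 * B" unfolding B_def by (simp add: mult_left_mono)
    also have "\<dots> = - A\<^sup>2 / B" using B by (simp add: field_simps power2_eq_square)
    finally have "A\<^sup>2 \<le> 0" using B by (simp add: field_simps)
    then show ?thesis unfolding A_def by simp
  qed
  have "(norm g)\<^sup>2 \<le> C * norm g"
  proof (rule LIMSEQ_le)
    show "(\<lambda>k. q (v k) \<bullet> g) \<longlonglongrightarrow> (norm g)\<^sup>2"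
      unfolding power2_norm_eq_inner by (intro tendsto_intros g)
    show "(\<lambda>k. C * norm (q (v k))) \<longlonglongrightarrow> C * norm g" by (intro tendsto_intros g)
    show "\<exists>N. \<forall>n\<ge>N. q (v n) \<bullet> g \<le> C * norm (q (v n))"
      using eq bound by (metis abs_le_iff)
  qed
  then have "norm g \<le> C"
    using C by (cases "g = 0") (auto simp: power2_eq_square)
  moreover have "g \<in> closure (range q)"
    unfolding closure_sequential using g by (intro exI[of _ "\<lambda>k. q (v k)"]) auto
  ultimately show thesis using eq by (intro that[of g])
qed


text \<open>For fixed \<open>x\<close> the Riesz theorem represents the real part of the form. The
  imaginary part is the real part at \<open>\<i> y\<close>, so the same vector represents the
  complex form, and linearity in \<open>x\<close> follows from uniqueness.\<close>

lemma bounded_sesquilinear_operator: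
  fixes B :: "'h::complex_hilbert \<Rightarrow> 'h \<Rightarrow> complex"
  assumes add_left: "\<And>x y z. B (x + y) z = B x z + B y z"
    and add_right: "\<And>x y z. B x (y + z) = B x y + B x z"
    and scale_left: "\<And>c x y. B (c *\<^sub>C x) y = c * B x y"
    and scale_right: "\<And>c x y. B x (c *\<^sub>C y) = cnj c * B x y"
    and bound: "\<And>x y. cmod (B x y) \<le> K * norm x * norm y"
  obtains a where "bounded_clinear a" "\<And>x y. cinner (a x) y = B x y"
proof -
  have "\<exists>g. (\<forall>y. Re (B x y) = y \<bullet> g) \<and> norm g \<le> \<bar>K\<bar> * norm x" for x
  proof (rule riesz_factorization[of "\<lambda>y. y" "\<lambda>y. Re (B x y)" "\<bar>K\<bar> * norm x"])
    show "linear (\<lambda>y. Re (B x y))"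
      by (rule linearI) (auto simp: add_right scale_right scaleC_of_real[symmetric])
    show "\<bar>Re (B x y)\<bar> \<le> \<bar>K\<bar> * norm x * norm y" for y
    proof -
      have "\<bar>Re (B x y)\<bar> \<le> K * norm x * norm y" using abs_Re_le_cmod bound order_trans by blast
      also have "\<dots> \<le> \<bar>K\<bar> * norm x * norm y" by (intro mult_right_mono) auto
      finally show ?thesis .
    qed
  qed (auto simp: linear_iff)
  then obtain a where a: "\<And>x y. Re (B x y) = y \<bullet> a x" and na: "\<And>x. norm (a x) \<le> \<bar>K\<bar> * norm x"
    by metis
  have eq: "cinner (a x) y = B x y" for x y
  proof (rule complex_eqI)
    show "Re (cinner (a x) y) = Re (B x y)" by (simp add: a Re_cinner inner_commute)
    have "Im (B x y) = Re (B x (\<i> *\<^sub>C y))" by (simp add: scale_right)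
    also have "\<dots> = Re (cinner (a x) (\<i> *\<^sub>C y))" by (simp add: a Re_cinner inner_commute)
    finally show "Im (cinner (a x) y) = Im (B x y)" by (simp add: cinner_scaleC_right)
  qed
  have "bounded_clinear a"
    by (rule bounded_clinearI[OF _ _ na]; rule cinner_eqI)
      (simp_all add: eq add_left scale_left cinner_algebra)
  then show thesis by (rule that) (rule eq)
qed

section \<open>Adjoints, self-adjoint operators and weak limits\<close>

lemma cadjoint_exists:
  assumes "bounded_clinear (a :: 'h::complex_hilbert \<Rightarrow> 'h)"
  obtains b where "bounded_clinear b" "\<And>x y. cinner (a x) y = cinner x (b y)"
proof -
  obtain K where K: "\<And>x. norm (a x) \<le> K * norm x" using bounded_clinear_bound[OF assms] by metis
  have "cmod (cinner x (a y)) \<le> K * norm x * norm y" for x y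
  proof -
    have "cmod (cinner x (a y)) \<le> norm x * norm (a y)" by (rule cmod_cinner_le)
    also have "\<dots> \<le> norm x * (K * norm y)" by (intro mult_left_mono K) auto
    finally show ?thesis by (simp add: mult_ac)
  qed
  then obtain b where "bounded_clinear b" "\<And>x y. cinner (b x) y = cinner x (a y)"
    using bounded_sesquilinear_operator[of "\<lambda>x y. cinner x (a y)" K]
    by (auto simp: cinner_algebra bounded_clinearD[OF assms])
  then show thesis by (intro that[of b]) (metis cinner_commute)+
qed

lemma cadjoint_eqI:
  assumes "\<And>x y. cinner (a x) y = cinner x (b y)"
  shows "cadjoint a = (b :: 'h::complex_hilbert \<Rightarrow> 'h)"
  unfolding cadjoint_def
proof (rule the_equality)
  fix b' assume b': "\<forall>\<xi> \<eta>. cinner (a \<xi>) \<eta> = cinner \<xi> (b' \<eta>)"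
  show "b' = b" by (rule ext, rule cinner_eqI_right) (metis assms b')
qed (use assms in blast)

lemma
  assumes "bounded_clinear a"
  shows bounded_clinear_cadjoint: "bounded_clinear (cadjoint a)"
    and cinner_cadjoint_right: "cinner x (cadjoint a y) = cinner (a x) y"
    and cinner_cadjoint_left: "cinner (cadjoint a x) y = cinner x (a y)"
proof -
  obtain b where b: "bounded_clinear b" "\<And>x y. cinner (a x) y = cinner x (b y)"
    using cadjoint_exists[OF assms] by blast
  have eq: "cadjoint a = b" by (rule cadjoint_eqI[OF b(2)])
  show "bounded_clinear (cadjoint a)" "cinner x (cadjoint a y) = cinner (a x) y" using b eq by auto
  show "cinner (cadjoint a x) y = cinner x (a y)" using b(2) eq by (metis cinner_commute)
qed

lemma cadjoint_cadjoint: "bounded_clinear a \<Longrightarrow> cadjoint (cadjoint a) = a"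
  by (rule cadjoint_eqI) (simp add: cinner_cadjoint_left)

lemma cadjoint_comp:
  "bounded_clinear a \<Longrightarrow> bounded_clinear b \<Longrightarrow> cadjoint (a \<circ> b) = cadjoint b \<circ>
      cadjoint a"
  by (rule cadjoint_eqI) (simp add: cinner_cadjoint_right)

lemma selfadjoint_opD:
  assumes "selfadjoint_op a"
  shows "bounded_clinear a" "cinner (a x) y = cinner x (a y)"
    "cinner (a x) x = of_real (Re (cinner (a x) x))"
proof -
  show a: "bounded_clinear a" using assms by (simp add: selfadjoint_op_def)
  show *: "cinner (a x) y = cinner x (a y)" for x y
    using cinner_cadjoint_right[OF a] assms by (metis selfadjoint_op_def)
  have "cnj (cinner (a x) x) = cinner (a x) x" by (metis * cinner_commute)
  then show "cinner (a x) x = of_real (Re (cinner (a x) x))"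
    by (metis complex_cnj_cancel_iff Reals_cnj_iff of_real_Re)
qed

lemma selfadjoint_opI:
  "bounded_clinear a \<Longrightarrow> (\<And>x y. cinner (a x) y = cinner x (a y)) \<Longrightarrow> selfadjoint_op a"
  by (simp add: selfadjoint_op_def cadjoint_eqI)

text \<open>The adjoint has the conjugate quadratic form; a real form is its own conjugate, and
  polarization identifies the two operators.\<close>

lemma selfadjoint_opI_real:
  assumes a: "bounded_clinear a" and "\<And>x. cinner (a x) x \<in> \<real>"
  shows "selfadjoint_op a"
proof -
  have "cadjoint a = a"
  proof (rule clinear_eqI[OF bounded_clinear_cadjoint[OF a] a])
    fix x have "cinner (cadjoint a x) x = cnj (cinner (a x) x)"
      by (metis a cinner_cadjoint_left cinner_commute)
    then show "cinner (cadjoint a x) x = cinner (a x) x" using assms(2) Reals_cnj_iff by metis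
  qed
  then show ?thesis using a by (simp add: selfadjoint_op_def)
qed

lemma positive_op_iff:
  "positive_op a \<longleftrightarrow> selfadjoint_op a \<and> (\<forall>x. 0 \<le> Re (cinner (a x) x))"
proof
  assume "positive_op a"
  then show "selfadjoint_op a \<and> (\<forall>x. 0 \<le> Re (cinner (a x) x))"
    by (auto simp: positive_op_def nonneg_Reals_subset_Reals[THEN subsetD] complex_nonneg_Reals_iff
        intro!: selfadjoint_opI_real)
next
  assume "selfadjoint_op a \<and> (\<forall>x. 0 \<le> Re (cinner (a x) x))"
  then show "positive_op a"
    unfolding positive_op_def
    by (metis selfadjoint_opD(1,3) complex_nonneg_Reals_iff Im_complex_of_real)
qed

text \<open>The norm of a self-adjoint operator is controlled by its numerical range: the form is
  polarized at \<open>x + y\<close> and \<open>x - y\<close>, with \<open>y\<close> a multiple of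
  \<open>a x\<close>, and the parallelogram law bounds the result. Scalar integral estimates thereby
  become norm estimates.\<close>

lemma selfadjoint_op_norm_bound:
  assumes "selfadjoint_op a" "\<And>x. \<bar>Re (cinner (a x) x)\<bar> \<le> K * (norm x)\<^sup>2"
  shows "norm (a x) \<le> K * norm x"
proof (cases "a x = 0 \<or> x = 0")
  case True
  show ?thesis
  proof (cases "x = 0")
    case False
    have "0 \<le> K * (norm x)\<^sup>2" using assms(2)[of x] by linarith
    then show ?thesis using True False by (simp add: zero_le_mult_iff)
  qed (use bounded_clinearD[OF selfadjoint_opD(1)[OF assms(1)]] in simp)
next
  case False
  note a = bounded_clinearD[OF selfadjoint_opD(1)[OF assms(1)]]
  \<comment> \<open>The scaling by \<open>r\<close> gives \<open>y\<close> the norm of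
    \<open>x\<close>, for which the bound by the parallelogram law is sharp.\<close>
  define r where "r = norm (a x) / norm x"
  define y where "y = (1 / r) *\<^sub>R a x"
  have r: "r > 0" using False by (simp add: r_def)
  have "cinner (a (x + y)) (x + y) - cinner (a (x - y)) (x - y) = 2 * cinner (a x) y + 2 * cinner (a y) x"
    by (simp add: a cinner_algebra algebra_simps)
  moreover have "cinner (a y) x = cnj (cinner (a x) y)"
    by (metis assms(1) cinner_commute selfadjoint_opD(2))
  moreover have "cinner (a x) y = of_real ((norm (a x))\<^sup>2 / r)"
    by (simp add: y_def cinner_algebra cinner_self)
  ultimately have "cinner (a (x + y)) (x + y) - cinner (a (x - y)) (x - y) =
      of_real (4 * ((norm (a x))\<^sup>2 / r))"
    by simp
  from arg_cong[OF this, of Re] have "4 * ((norm (a x))\<^sup>2 / r) =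
      Re (cinner (a (x + y)) (x + y)) - Re (cinner (a (x - y)) (x - y))"
    by simp
  also have "\<dots> \<le> K * (norm (x + y))\<^sup>2 + K * (norm (x - y))\<^sup>2"
    using assms(2)[of "x + y"] assms(2)[of "x - y"] by linarith
  also have "\<dots> = K * (2 * (norm x)\<^sup>2 + 2 * (norm y)\<^sup>2)"
    by (simp add: power2_norm_eq_inner algebra_simps inner_commute)
  also have "norm y = norm x" using r False by (simp add: y_def r_def)
  finally have "(norm (a x))\<^sup>2 / r \<le> K * (norm x)\<^sup>2" by simp
  then have "norm (a x) * norm x \<le> K * norm x * norm x"
    using False by (simp add: r_def power2_eq_square)
  then show ?thesis using False by simp
qed

text \<open>Polarization spreads convergence from the diagonal to the whole form, and the uniform
  bound makes the limit form bounded, hence given by an operator.\<close>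

lemma weak_limit_operator:
  fixes a :: "nat \<Rightarrow> 'h::complex_hilbert \<Rightarrow> 'h"
  assumes a: "\<And>k. bounded_clinear (a k)" and conv: "\<And>x. convergent (\<lambda>k. cinner (a k x) x)"
    and bound: "\<And>k x. norm (a k x) \<le> K * norm x"
  obtains b where "bounded_clinear b" "\<And>x y. (\<lambda>k. cinner (a k x) y) \<longlonglongrightarrow> cinner (b x) y"
proof -
  define B where "B x y = lim (\<lambda>k. cinner (a k x) y)" for x y
  have B: "(\<lambda>k. cinner (a k x) y) \<longlonglongrightarrow> B x y" for x y
  proof -
    have "convergent (\<lambda>k. 1/4 * (4 * cinner (a k x) y))"
      unfolding cinner_polarization[OF a]
      by (intro convergent_mult convergent_add convergent_diff conv convergent_const)
    then show ?thesis unfolding B_def by (simp add: convergent_LIMSEQ_iff)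
  qed
  have unique: "B x y = l" if "(\<lambda>k. cinner (a k x) y) \<longlonglongrightarrow> l" for x y l
    using B LIMSEQ_unique that by blast
  have "cmod (B x y) \<le> K * norm x * norm y" for x y
  proof (rule LIMSEQ_le_const2[OF tendsto_norm[OF B]])
    have "cmod (cinner (a k x) y) \<le> K * norm x * norm y" for k
      using cmod_cinner_le[of "a k x" y] mult_right_mono[OF bound[of k x], of "norm y"] by simp
    then show "\<exists>N. \<forall>n\<ge>N. cmod (cinner (a n x) y) \<le> K * norm x * norm y" by blast
  qed
  moreover have "B (x + y) z = B x z + B y z" "B x (y + z) = B x y + B x z"
    "B (c *\<^sub>C x) y = c * B x y" "B x (c *\<^sub>C y) = cnj c * B x y" for c x y z
    by (rule unique; simp only: bounded_clinearD(2,6)[OF a] cinner_algebra; intro tendsto_intros B)+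
  ultimately obtain b where "bounded_clinear b" "\<And>x y. cinner (b x) y = B x y"
    using bounded_sesquilinear_operator[of B K] by metis
  then show thesis using B by (intro that[of b]) auto
qed

section \<open>Positive operators and the spectrum\<close>

lemma selfadjoint_op_inner: "selfadjoint_op a \<Longrightarrow> a x \<bullet> y = x \<bullet> a y"
  by (simp add: Re_cinner[symmetric] selfadjoint_opD(2))

text \<open>The Riesz--Nagy sequence: \<open>a = (\<Sum>j<k. (a\<^sub>j)\<^sup>2) + a\<^sub>k\<close>, where
  \<open>a\<^sub>k\<close> tends strongly to \<open>0\<close>.\<close>

primrec riesz_nagy :: "('h::complex_hilbert \<Rightarrow> 'h) \<Rightarrow> nat \<Rightarrow> 'h \<Rightarrow> 'h" where
  "riesz_nagy a 0 = a"
| "riesz_nagy a (Suc k) = (\<lambda>x. riesz_nagy a k x - riesz_nagy a k (riesz_nagy a k x))"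

text \<open>With the \<open>riesz_nagy\<close> sequence the form of \<open>b \<circ> a\<close> is
  the sum of the values of the form of \<open>b\<close> at the vectors \<open>A j x\<close>, which
  are nonnegative, plus a remainder tending to 0. Writing \<open>a\<close> as a square instead would
  be circular, since \<open>positive_op_sqrt\<close> is derived from the spectral theorem.\<close>

lemma positive_op_comp_commute:
  fixes a b :: "'h::complex_hilbert \<Rightarrow> 'h"
  assumes a: "positive_op a" and b: "positive_op b" and comm: "a \<circ> b = b \<circ> a"
    and a_le: "\<And>x. a x \<bullet> x \<le> x \<bullet> x"
  shows "positive_op (a \<circ> b)"
proof -
  define A where "A = riesz_nagy a"
  have A_Suc: "A (Suc k) x = A k x - A k (A k x)" for k x by (simp add: A_def)
  have sa: "selfadjoint_op a" "selfadjoint_op b" and pos: "0 \<le> a x \<bullet> x" "0 \<le> b x \<bullet> x" for x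
    using a b by (auto simp: positive_op_iff Re_cinner)
  note bl = bounded_clinearD[OF selfadjoint_opD(1)[OF sa(2)]]
  have A: "bounded_clinear (A k) \<and> (\<forall>x y. A k x \<bullet> y = x \<bullet> A k y) \<and> (\<forall>x. 0
      \<le> A k x \<bullet> x) \<and>
      (\<forall>x. A k x \<bullet> x \<le> x \<bullet> x) \<and> (\<forall>x. A k (b x) = b (A k x))" for k
  proof (induction k)
    case 0
    then show ?case using sa pos a_le comm
      by (auto simp: A_def selfadjoint_op_inner selfadjoint_opD(1) fun_eq_iff)
  next
    case (Suc k)
    then have bc: "bounded_clinear (A k)" and s: "\<And>x y. A k x \<bullet> y = x \<bullet> A k y"
      and p: "\<And>x. 0 \<le> A k x \<bullet> x" and l: "\<And>x. A k x \<bullet> x \<le> x \<bullet> x" and c: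
          "\<And>x. A k (b x) = b (A k x)"
      by auto
    \<comment> \<open>The identity A - A^2 = (1 - A) A (1 - A) + A (1 - A) A shows that the bounds 0
      and 1 are inherited.\<close>
    have "A (Suc k) x \<bullet> x = A k (x - A k x) \<bullet> (x - A k x) + (A k x \<bullet> A k x - A k (A k x)
        \<bullet> A k x)" for x
      using s[of "A k x" x] by (simp add: A_Suc bounded_clinearD[OF bc] inner_diff_left inner_diff_right)
    then have "0 \<le> A (Suc k) x \<bullet> x" for x
      using p[of "x - A k x"] l[of "A k x"] by simp
    moreover have "A (Suc k) x \<bullet> x \<le> x \<bullet> x" for x
      unfolding A_Suc inner_diff_left using l[of x] s[of "A k x" x] inner_ge_zero[of "A k x"] by linarith
    moreover have "A (Suc k) x \<bullet> y = x \<bullet> A (Suc k) y" for x y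
      by (simp add: A_Suc inner_diff_left inner_diff_right s)
    moreover have "bounded_clinear (A (Suc k))"
      using bounded_clinear_diff[OF bc bounded_clinear_comp[OF bc bc]] by (simp add: A_def o_def)
    moreover have "A (Suc k) (b x) = b (A (Suc k) x)" for x by (simp add: A_Suc c bl)
    ultimately show ?case by blast
  qed
  have split: "b (a x) \<bullet> x = (\<Sum>j<k. b (A j x) \<bullet> A j x) + b (A k x) \<bullet> x" for k x
  proof (induction k)
    case (Suc k)
    have "b (A k (A k x)) \<bullet> x = b (A k x) \<bullet> A k x" using A by metis
    then show ?case using Suc by (simp add: A_Suc bl inner_diff_left)
  qed (simp add: A_def)
  have norms: "a x \<bullet> x = (\<Sum>j<k. (norm (A j x))\<^sup>2) + A k x \<bullet> x" for k x
  proof (induction k)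
    case (Suc k)
    have "A k (A k x) \<bullet> x = (norm (A k x))\<^sup>2" using A by (simp add: power2_norm_eq_inner)
    then show ?case using Suc by (simp add: A_Suc inner_diff_left)
  qed (simp add: A_def)
  have "0 \<le> b (a x) \<bullet> x" for x
  proof -
    \<comment> \<open>All remainders are nonnegative, so the partial sums of the squares stay below
      the form of \<open>a\<close>; the summands tend to 0, which is strong convergence of the
      remainders.\<close>
    have "summable (\<lambda>j. (norm (A j x))\<^sup>2)"
    proof (rule bounded_imp_summable)
      show "(\<Sum>j\<le>k. (norm (A j x))\<^sup>2) \<le> a x \<bullet> x" for k
      proof -
        have "0 \<le> A (Suc k) x \<bullet> x" using A by blast
        then show ?thesis using norms[of x "Suc k"] unfolding lessThan_Suc_atMost by linarith
      qed
    qed simp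
    then have "(\<lambda>j. (norm (A j x))\<^sup>2) \<longlonglongrightarrow> 0" by (rule summable_LIMSEQ_zero)
    then have "(\<lambda>j. sqrt ((norm (A j x))\<^sup>2)) \<longlonglongrightarrow> sqrt 0" by (intro tendsto_real_sqrt)
    then have "(\<lambda>j. A j x) \<longlonglongrightarrow> 0" by (simp add: tendsto_norm_zero_iff)
    then have "(\<lambda>j. b (A j x) \<bullet> x) \<longlonglongrightarrow> b 0 \<bullet> x"
      by (intro tendsto_intros bounded_linear.tendsto[OF bl(1)])
    moreover have "b (A j x) \<bullet> x \<le> b (a x) \<bullet> x" for j
      using split[of x j] by (simp add: sum_nonneg pos)
    ultimately show ?thesis by (intro LIMSEQ_le_const2[of _ 0]) (auto simp: bl)
  qed
  moreover have "selfadjoint_op (a \<circ> b)"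
  proof (rule selfadjoint_opI)
    show "cinner ((a \<circ> b) x) y = cinner x ((a \<circ> b) y)" for x y
      using comm sa by (metis comp_apply selfadjoint_opD(2))
  qed (use sa in \<open>auto intro: selfadjoint_opD(1)\<close>)
  ultimately show ?thesis unfolding comm by (simp add: positive_op_iff Re_cinner)
qed

text \<open>This is a^2 \<le> C a, from the nonnegative value of the form at
  \<open>x - (1/C) a x\<close>, whose cubic term is bounded by means of \<open>C\<close>.\<close>

lemma positive_op_norm_square_le:
  assumes a: "positive_op a" and bound: "\<And>x. norm (a x) \<le> C * norm x" and C: "C > 0"
  shows "(norm (a x))\<^sup>2 \<le> C * (a x \<bullet> x)"
proof -
  have sa: "selfadjoint_op a" and pos: "0 \<le> a y \<bullet> y" for y using a by (auto simp: positive_op_iff Re_cinner)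
  note bl = bounded_clinearD[OF selfadjoint_opD(1)[OF sa]]
  define y where "y = x - (1/C) *\<^sub>R a x"
  have "a (a x) \<bullet> x = a x \<bullet> a x" "x \<bullet> a (a x) = a x \<bullet> a x"
    by (simp_all add: selfadjoint_op_inner[OF sa] inner_commute)
  then have "a y \<bullet> y = a x \<bullet> x - 2 / C * (norm (a x))\<^sup>2 + (1/C)\<^sup>2 * (a (a x) \<bullet> a x)"
    by (simp add: y_def bl inner_diff_left inner_diff_right power2_norm_eq_inner
        power2_eq_square[of "1/C"] inner_commute[of x "a x"] diff_divide_distrib add_divide_distrib)
  moreover have "a (a x) \<bullet> a x \<le> C * (norm (a x))\<^sup>2"
    using norm_cauchy_schwarz[of "a (a x)" "a x"] mult_right_mono[OF bound[of "a x"], of "norm (a x)"]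
    by (simp add: power2_eq_square)
  then have "(1/C)\<^sup>2 * (a (a x) \<bullet> a x) \<le> (1/C)\<^sup>2 * (C * (norm (a x))\<^sup>2)" by (intro
      mult_left_mono) auto
  moreover have "(1/C)\<^sup>2 * (C * (norm (a x))\<^sup>2) = 1 / C * (norm (a x))\<^sup>2"
    using C by (simp add: power2_eq_square)
  ultimately have "1 / C * (norm (a x))\<^sup>2 \<le> a x \<bullet> x" using pos[of y] by (simp add: algebra_simps)
  then show ?thesis using C by (simp add: field_simps)
qed

text \<open>The infimum of the numerical range lies in the spectrum.\<close>

lemma spectrum_lower_bound:
  fixes x :: "'h::complex_hilbert \<Rightarrow> 'h"
  assumes x: "selfadjoint_op x" and spec: "op_spectrum x \<subseteq> complex_of_real ` J"
    and nontrivial: "(u::'h) \<noteq> 0"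
  obtains m where "m \<in> J" "\<And>h. m * (norm h)\<^sup>2 \<le> x h \<bullet> h"
proof -
  note bl = bounded_clinearD[OF selfadjoint_opD(1)[OF x]]
  obtain K where K: "K > 0" "\<And>h. norm (x h) \<le> K * norm h"
    using bounded_clinear_bound[OF selfadjoint_opD(1)[OF x]] by metis
  define R where "R = (\<lambda>h. x h \<bullet> h) ` {h. norm h = 1}"
  have "- K \<le> x h \<bullet> h" if "norm h = 1" for h
    using Cauchy_Schwarz_ineq2[of "x h" h] K(2)[of h] that by (simp add: abs_le_iff)
  then have bdd: "bdd_below R" unfolding R_def by (auto intro!: bdd_belowI)
  \<comment> \<open>On the zero space there is no unit vector and the spectrum is empty; the vector
    \<open>u\<close> excludes this case.\<close>
  have ne: "R \<noteq> {}" unfolding R_def using nontrivial by (auto intro!: exI[of _ "sgn u"] simp: norm_sgn)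
  define m where "m = Inf R"
  have m1: "m \<le> x h \<bullet> h" if "norm h = 1" for h
    unfolding m_def using bdd that by (auto simp: R_def intro!: cInf_lower)
  have m: "m * (norm h)\<^sup>2 \<le> x h \<bullet> h" for h
  proof (cases "h = 0")
    case False
    have "m \<le> x (sgn h) \<bullet> sgn h" using False by (intro m1) (simp add: norm_sgn)
    also have "\<dots> = (x h \<bullet> h) / (norm h)\<^sup>2"
      by (simp add: sgn_div_norm bl power2_eq_square divide_inverse)
    finally show ?thesis using False by (simp add: field_simps)
  qed (simp add: bl)
  have "complex_of_real m \<in> op_spectrum x"
  proof (rule ccontr)
    assume "complex_of_real m \<notin> op_spectrum x"
    then obtain b where b: "bounded_clinear b" "b \<circ> (\<lambda>h. x h - m *\<^sub>R h) = id"
      by (auto simp: op_spectrum_def scaleC_of_real)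
    define A where "A h = x h - m *\<^sub>R h" for h
    have bA: "b (A h) = h" for h using b(2) by (simp add: A_def fun_eq_iff)
    obtain L where L: "L > 0" "\<And>h. norm (b h) \<le> L * norm h" using bounded_clinear_bound[OF b(1)] by metis
    have Ac: "bounded_clinear A"
      unfolding A_def by (intro bounded_clinear_diff selfadjoint_opD(1)[OF x] bounded_clinear_scaleR) auto
    have "positive_op A"
      unfolding positive_op_iff
    proof (intro conjI allI selfadjoint_opI Ac)
      show "cinner (A h) k = cinner h (A k)" for h k
        by (simp add: A_def cinner_algebra selfadjoint_opD(2)[OF x])
      show "0 \<le> Re (cinner (A h) h)" for h
        using m[of h] by (simp add: A_def Re_cinner inner_diff_left power2_norm_eq_inner)
    qed
    moreover obtain C where C: "C > 0" "\<And>h. norm (A h) \<le> C * norm h" using bounded_clinear_bound[OF Ac] by metis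
    ultimately have sq: "(norm (A h))\<^sup>2 \<le> C * (A h \<bullet> h)" for h
      using positive_op_norm_square_le[of A C h] by blast
    \<comment> \<open>An inverse of \<open>x - m\<close> bounded by \<open>L\<close> forces
      \<open>A h \<bullet> h\<close> to be at least \<open>1 / (L\<^sup>2 * C)\<close> on unit
      vectors, and the infimum \<open>m\<close> permits smaller values.\<close>
    have "Inf R < m + 1 / (L\<^sup>2 * C)" using L C by (simp add: m_def)
    then obtain h where h: "norm h = 1" "x h \<bullet> h < m + 1 / (L\<^sup>2 * C)"
      using cInf_less_iff[OF ne bdd] by (auto simp: R_def)
    have "1 \<le> L * norm (A h)" using L(2)[of "A h"] bA h(1) by simp
    then have "1 \<le> (L * norm (A h))\<^sup>2" by (simp add: one_le_power)
    also have "\<dots> \<le> L\<^sup>2 * (C * (A h \<bullet> h))" using sq[of h] by (simp add: power_mult_distrib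
        mult_left_mono)
    also have "A h \<bullet> h < 1 / (L\<^sup>2 * C)"
      using h by (simp add: A_def inner_diff_left dot_square_norm)
    then have "L\<^sup>2 * (C * (A h \<bullet> h)) < 1" using L C by (simp add: field_simps)
    finally show False by simp
  qed
  then have "m \<in> J" using spec by auto
  then show thesis by (rule that) (rule m)
qed

text \<open>The lower bound for \<open>-x\<close>, whose spectrum lies in the reflected set.\<close>

lemma spectrum_upper_bound:
  fixes x :: "'h::complex_hilbert \<Rightarrow> 'h"
  assumes x: "selfadjoint_op x" and spec: "op_spectrum x \<subseteq> complex_of_real ` J"
    and nontrivial: "(u::'h) \<noteq> 0"
  obtains M where "M \<in> J" "\<And>h. x h \<bullet> h \<le> M * (norm h)\<^sup>2"
proof -
  note bl = bounded_clinearD[OF selfadjoint_opD(1)[OF x]]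
  have bc: "bounded_clinear (\<lambda>h. - x h)"
    using bounded_clinear_diff[OF bounded_clinear_zero selfadjoint_opD(1)[OF x]] by simp
  have "op_spectrum (\<lambda>h. - x h) \<subseteq> complex_of_real ` (uminus ` J)"
  proof
    fix z assume z: "z \<in> op_spectrum (\<lambda>h. - x h)"
    have "- z \<in> op_spectrum x"
    proof (rule ccontr)
      assume "- z \<notin> op_spectrum x"
      then obtain b where b: "bounded_clinear b" "\<And>h. b (x h - (- z) *\<^sub>C h) = h" "\<And>h. x (b h) - (- z)
          *\<^sub>C b h = h"
        by (auto simp: op_spectrum_def fun_eq_iff)
      have zz: "(- z) *\<^sub>C h = - (z *\<^sub>C h)" for h :: 'h
        using scaleC_add_left[of z "- z" h] scaleC_of_real[of 0 h] by (simp add: eq_neg_iff_add_eq_0 add.commute)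
      have "bounded_clinear (\<lambda>h. - b h)"
        using bounded_clinear_diff[OF bounded_clinear_zero b(1)] by simp
      moreover have "- b (- x h - z *\<^sub>C h) = h" for h
        using b(2)[of h] bounded_clinearD(4)[OF b(1), of "x h - (- z) *\<^sub>C h"] by (simp add: zz)
      moreover have "- x (- b h) - z *\<^sub>C (- b h) = h" for h
        using b(3)[of h] by (simp add: bl scaleC_minus_right zz)
      ultimately show False using z by (auto simp: op_spectrum_def fun_eq_iff)
    qed
    then obtain r where "r \<in> J" "- z = complex_of_real r" using spec by auto
    then have "z = complex_of_real (- r)" by (metis minus_minus of_real_minus)
    then show "z \<in> complex_of_real ` uminus ` J" using \<open>r \<in> J\<close> by blast
  qed
  note spec' = this
  have sa: "selfadjoint_op (\<lambda>h. - x h)"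
    by (rule selfadjoint_opI[OF bc]) (simp add: selfadjoint_opD(2)[OF x])
  obtain m where "m \<in> uminus ` J" "\<And>h. m * (norm h)\<^sup>2 \<le> - x h \<bullet> h"
    by (rule spectrum_lower_bound[OF sa spec' nontrivial]) blast
  then show thesis by (intro that[of "- m"]) (auto simp: le_minus_iff minus_le_iff inner_commute)
qed

section \<open>Weak compactness of measures on a cube\<close>

text \<open>At the first differing digit \<open>k\<close> the values differ by 3^-k, and all later
  digits together compensate at most half of it. In base 2 they could compensate everything.\<close>

lemma ternary_code_separates:
  fixes b c :: "nat \<Rightarrow> bool"
  assumes close: "\<bar>(\<Sum>j. of_bool (b j) / 3 ^ j) - (\<Sum>j. of_bool (c j) / 3 ^ j :: real)\<bar> < (1 / 2) *
      (1 / 3) ^ n"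
    and j: "j \<le> n"
  shows "b j = c j"
proof (rule ccontr)
  assume "b j \<noteq> c j"
  define k where "k = (LEAST k. b k \<noteq> c k)"
  have k: "b k \<noteq> c k" unfolding k_def by (rule LeastI) fact
  have kj: "k \<le> j" unfolding k_def by (rule Least_le) fact
  have below: "b i = c i" if "i < k" for i using not_less_Least that unfolding k_def by blast
  define d :: "nat \<Rightarrow> real" where "d i = of_bool (b i) / 3 ^ i - of_bool (c i) / 3 ^ i" for i
  have geo: "summable (\<lambda>i. (1 / 3 :: real) ^ i)" by (simp add: summable_geometric)
  have sb: "summable (\<lambda>i. of_bool (b i) / 3 ^ i :: real)" for b
    by (rule summable_comparison_test'[OF geo, of 0]) (auto simp: power_one_over divide_simps)
  have sd: "summable d" unfolding d_def by (intro summable_diff sb)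
  have tail: "summable (\<lambda>i. (1/3) ^ Suc k * (1 / 3 :: real) ^ i)" using geo by (rule summable_mult)
  have dle: "\<bar>d i\<bar> \<le> (1/3) ^ i" for i by (auto simp: d_def power_one_over of_bool_def)
  have "(\<Sum>i. of_bool (b i) / 3 ^ i :: real) - (\<Sum>i. of_bool (c i) / 3 ^ i) = suminf d"
    unfolding d_def by (rule suminf_diff[OF sb sb])
  also have "\<dots> = (\<Sum>i. d (i + Suc k)) + (\<Sum>i<Suc k. d i)" by (rule suminf_split_initial_segment[OF sd])
  also have "(\<Sum>i<Suc k. d i) = d k" using below by (simp add: d_def)
  finally have eq: "(\<Sum>i. of_bool (b i) / 3 ^ i :: real) - (\<Sum>i. of_bool (c i) / 3 ^ i) = (\<Sum>i. d (i + Suc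
      k)) + d k" .
  have bnd: "norm (d (i + Suc k)) \<le> (1/3) ^ Suc k * (1/3) ^ i" for i
    using dle[of "i + Suc k"] by (simp add: power_add mult_ac)
  have "\<bar>\<Sum>i. d (i + Suc k)\<bar> \<le> (\<Sum>i. (1/3) ^ Suc k * (1 / 3 :: real) ^ i)"
    using norm_suminf_le[OF bnd tail] by (simp only: real_norm_def)
  also have "\<dots> = (1 / 2) * (1/3) ^ k" unfolding suminf_mult[OF geo] by (simp add: suminf_geometric)
  finally have "\<bar>\<Sum>i. d (i + Suc k)\<bar> \<le> (1 / 2) * (1/3) ^ k" .
  moreover have "\<bar>d k\<bar> = (1/3) ^ k" using k by (auto simp: d_def power_one_over)
  ultimately have "(1 / 2) * (1/3) ^ k \<le> \<bar>(\<Sum>i. of_bool (b i) / 3 ^ i :: real) - (\<Sum>i. of_bool (c i) /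
      3 ^ i)\<bar>"
    unfolding eq by linarith
  moreover have "(1 / 3 :: real) ^ n \<le> (1/3) ^ k" using kj j by (intro power_decreasing) auto
  ultimately show False using close by linarith
qed

text \<open>The ternary code of the family of all half-spaces \<open>l\<^sub>i \<le> r\<close> with rational
  \<open>r\<close>: its inverse is uniformly continuous on bounded sets, which transports Helly's selection
  theorem from the line to higher dimension.\<close>

definition halfspace_code :: "real^'n::finite \<Rightarrow> real" where
  "halfspace_code l = (\<Sum>j. of_bool (l $ fst (from_nat j :: 'n \<times> rat) \<le> of_rat (snd (from_nat j :: 'n
      \<times> rat))) / 3 ^ j)"

lemma halfspace_code_measurable [measurable]: "halfspace_code \<in> borel_measurable borel"
  unfolding halfspace_code_def of_bool_def by measurable

lemma halfspace_code_bounds: "halfspace_code l \<in> {0..2}"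
proof -
  have geo: "summable (\<lambda>i. (1 / 3 :: real) ^ i)" by (simp add: summable_geometric)
  have s: "summable (\<lambda>i. of_bool (b i) / 3 ^ i :: real)" for b
    by (rule summable_comparison_test'[OF geo, of 0]) (auto simp: power_one_over divide_simps)
  have "halfspace_code l \<le> (\<Sum>i. (1 / 3) ^ i)"
    unfolding halfspace_code_def by (rule suminf_le[OF _ s geo]) (simp add: power_one_over divide_simps)
  also have "\<dots> \<le> 2" by (simp add: suminf_geometric)
  finally show ?thesis unfolding halfspace_code_def by (auto intro!: suminf_nonneg s)
qed

text \<open>On a bounded set finitely many thresholds k/M resolve every coordinate to within
  \<open>h\<close>. Their positions in the code are bounded by some \<open>n\<close>, so points with
  codes close enough to share the digits up to \<open>n\<close> are close.\<close>

lemma halfspace_code_inverse_uniform: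
  fixes K :: "(real^'n::finite) set"
  assumes e: "e > 0" and K: "\<And>l i. l \<in> K \<Longrightarrow> \<bar>l $ i\<bar> \<le> B"
  obtains d where "d > 0"
    "\<And>l l'. l \<in> K \<Longrightarrow> l' \<in> K \<Longrightarrow> \<bar>halfspace_code l - halfspace_code
        l'\<bar> < d \<Longrightarrow> dist l l' < e"
proof -
  \<comment> \<open>One more than the number of coordinates, so that the sum of the coordinate
    differences stays strictly below \<open>e\<close>.\<close>
  define N where "N = real CARD('n) + 1"
  define h where "h = e / N"
  have h: "h > 0" using e by (simp add: h_def N_def add_pos_nonneg)
  obtain M :: nat where M: "1 / h < real M" using reals_Archimedean2 by blast
  have M0: "real M > 0" using M h by (smt (verit) divide_pos_pos)
  have Mh: "1 / real M < h" using M M0 h by (simp add: field_simps)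
  \<comment> \<open>The digit positions of all thresholds k/M within reach of the bound
    \<open>B\<close>, for every coordinate.\<close>
  define G where "G = (\<lambda>(i, k). to_nat (i :: 'n, of_int k / of_nat M :: rat)) ` (UNIV \<times> {\<lfloor>- B *
      M\<rfloor>..\<lceil>B * M\<rceil> + 1})"
  have fin: "finite G" unfolding G_def by (intro finite_imageI finite_cartesian_product) auto
  define n where "n = Max (insert 0 G)"
  have agree: "\<not> l' $ i - l $ i \<ge> h"
    if "l \<in> K" "l' \<in> K" and close: "\<bar>halfspace_code l - halfspace_code l'\<bar> < (1 / 2) * (1 / 3) ^ n"
        for l l' i
  proof
    assume far: "l' $ i - l $ i \<ge> h"
    define k where "k = \<lceil>l $ i * M\<rceil>"
    have k1: "l $ i * M \<le> k" "k < l $ i * M + 1" unfolding k_def by linarith+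
    have "\<lfloor>- B * M\<rfloor> \<le> k"
      unfolding k_def using K[OF \<open>l \<in> K\<close>, of i] M0
      by (smt (verit) floor_le_ceiling floor_mono ceiling_mono mult_right_mono order_trans)
    moreover have "k \<le> \<lceil>B * M\<rceil> + 1"
      unfolding k_def using K[OF \<open>l \<in> K\<close>, of i] M0
      by (smt (verit) ceiling_mono mult_right_mono)
    ultimately have "to_nat (i, of_int k / of_nat M :: rat) \<in> G"
      unfolding G_def by (intro image_eqI[of _ _ "(i, k)"]) auto
    then have "to_nat (i, of_int k / of_nat M :: rat) \<le> n" unfolding n_def using fin by simp
    from ternary_code_separates[OF close[unfolded halfspace_code_def] this]
    have "(l $ i \<le> k / M) = (l' $ i \<le> k / M)" by (simp add: of_rat_divide)
    moreover have "l $ i \<le> k / M" using k1 M0 by (simp add: field_simps)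
    moreover have "k / M < l $ i + 1 / M" using k1 M0 by (simp add: field_simps)
    ultimately show False using far Mh by linarith
  qed
  show thesis
  proof (rule that[of "(1 / 2) * (1 / 3) ^ n"])
    fix l l' assume l: "l \<in> K" "l' \<in> K" "\<bar>halfspace_code l - halfspace_code l'\<bar> < (1 / 2) * (1 / 3) ^ n"
    have "\<bar>(l - l') $ i\<bar> \<le> h" for i
      using agree[OF l, of i] agree[OF l(2,1), of i] l(3) by (simp add: abs_minus_commute)
    then have "norm (l - l') \<le> (\<Sum>i\<in>(UNIV::'n set). h)"
      using norm_le_l1_cart[of "l - l'"] sum_mono order_trans by (metis (no_types, lifting))
    also have "\<dots> < N * h" using h by (simp add: N_def)
    also have "\<dots> = e" by (simp add: h_def N_def add_nonneg_eq_0_iff)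
    finally show "dist l l' < e" by (simp add: dist_norm)
  qed simp
qed

text \<open>The code jumps, but its inverse is uniformly continuous on the image of the box. It
  extends to the closure and then, by Dugundji's theorem for convex targets, to the whole line
  without leaving the box.\<close>

lemma halfspace_code_left_inverse:
  fixes a b :: "real^'n::finite"
  assumes ab: "cbox a b \<noteq> {}"
  obtains g :: "real \<Rightarrow> real^'n" where "continuous_on UNIV g" "range g \<subseteq> cbox a b"
    "\<And>l. l \<in> cbox a b \<Longrightarrow> g (halfspace_code l) = l"
proof -
  define K where "K = cbox a b"
  obtain B where B: "\<And>l. l \<in> K \<Longrightarrow> norm l \<le> B"
    using bounded_cbox[of a b] unfolding bounded_iff K_def by blast
  have K: "\<bar>l $ i\<bar> \<le> B" if "l \<in> K" for l i using B[OF that] component_le_norm_cart[of l i] by linarith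
  define g0 where "g0 = the_inv_into K halfspace_code"
  have inj: "inj_on halfspace_code K"
  proof (rule inj_onI, rule ccontr)
    fix l l' assume l: "l \<in> K" "l' \<in> K" "halfspace_code l = halfspace_code l'" "l \<noteq> l'"
    obtain d where "d > 0" "\<bar>halfspace_code l - halfspace_code l'\<bar> < d \<Longrightarrow> dist l l' < dist l l'"
      using halfspace_code_inverse_uniform[of "dist l l'" K B] K l by (metis zero_less_dist_iff)
    then show False using l by simp
  qed
  have g0: "g0 (halfspace_code l) = l" if "l \<in> K" for l
    unfolding g0_def using inj that by (rule the_inv_into_f_f)
  have "uniformly_continuous_on (halfspace_code ` K) g0"
    unfolding uniformly_continuous_on_def
  proof (intro allI impI)
    fix e :: real assume "e > 0"
    then obtain d where d: "d > 0"
      "\<And>l l'. l \<in> K \<Longrightarrow> l' \<in> K \<Longrightarrow> \<bar>halfspace_code l - halfspace_code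
          l'\<bar> < d \<Longrightarrow> dist l l' < e"
      using halfspace_code_inverse_uniform[of e K B] K by metis
    then show "\<exists>d>0. \<forall>x\<in>halfspace_code ` K. \<forall>x'\<in>halfspace_code ` K. dist x' x < d
        \<longrightarrow> dist (g0 x') (g0 x) < e"
      by (intro exI[of _ d]) (auto simp: g0 dist_real_def)
  qed
  from uniformly_continuous_on_extension_on_closure[OF this]
  obtain g1 where g1: "uniformly_continuous_on (closure (halfspace_code ` K)) g1"
    "\<And>x. x \<in> halfspace_code ` K \<Longrightarrow> g0 x = g1 x" by metis
  have cont1: "continuous_on (closure (halfspace_code ` K)) g1" by (rule uniformly_continuous_imp_continuous[OF g1(1)])
  have "g1 ` closure (halfspace_code ` K) \<subseteq> K"
  proof -
    have "g1 ` closure (halfspace_code ` K) \<subseteq> closure (g1 ` halfspace_code ` K)"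
      by (rule image_closure_subset[OF cont1]) (auto simp: closure_subset)
    also have "g1 ` halfspace_code ` K = K" using g1(2) g0 by force
    also have "closure K = K" by (simp add: K_def)
    finally show ?thesis .
  qed
  then obtain g where "continuous_on UNIV g" "g ` UNIV \<subseteq> K" "\<And>x. x \<in> closure (halfspace_code ` K)
      \<Longrightarrow> g x = g1 x"
    using Dugundji[of K UNIV "closure (halfspace_code ` K)" g1] ab cont1 by (auto simp: K_def)
  then show thesis
    using g1(2) g0 closure_subset[of "halfspace_code ` K"] by (intro that[of g]) (auto simp: K_def)
qed

text \<open>The images under the code are measures on a fixed bounded interval, hence tight. Weak
  convergence on the line is tested against \<phi> composed with the left inverse \<open>g\<close>,
  a bounded continuous function; on the box \<open>g\<close> undoes the code, so these integrals are
  the original ones. The code itself only has to be measurable.\<close>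

lemma prob_measures_cbox_weakly_compact:
  fixes M :: "nat \<Rightarrow> (real^'n::finite) measure"
  assumes prob: "\<And>k. prob_space (M k)" and sets: "\<And>k. sets (M k) = sets borel"
    and supp: "\<And>k. AE l in M k. l \<in> cbox a b"
  obtains r \<mu> where "strict_mono (r :: nat \<Rightarrow> nat)" "prob_space \<mu>" "sets \<mu> = sets borel"
    "AE l in \<mu>. l \<in> cbox a b"
    "\<And>\<phi> :: real^'n \<Rightarrow> real. continuous_on UNIV \<phi> \<Longrightarrow> (\<lambda>k. \<integral>l.
        \<phi> l \<partial>M (r k)) \<longlonglongrightarrow> (\<integral>l. \<phi> l \<partial>\<mu>)"
proof -
  have [measurable_cong]: "sets (M k) = sets borel" for k by (rule sets)
  have "cbox a b \<noteq> {}"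
  proof
    assume "cbox a b = {}"
    then have "AE l in M 0. False" using supp[of 0] by simp
    then show False using prob_space.AE_False[OF prob] by blast
  qed
  then obtain g :: "real \<Rightarrow> real^'n" where g: "continuous_on UNIV g" "range g \<subseteq> cbox a b"
    "\<And>l. l \<in> cbox a b \<Longrightarrow> g (halfspace_code l) = l"
    by (rule halfspace_code_left_inverse) blast
  have [measurable]: "g \<in> borel_measurable borel" using g(1) by (rule borel_measurable_continuous_onI)
  define N where "N k = distr (M k) borel halfspace_code" for k
  have N: "real_distribution (N k)" for k
    unfolding N_def by (intro prob_space.real_distribution_distr[OF prob]) simp
  have "tight N"
    unfolding tight_def
  proof (intro conjI allI impI N)
    fix \<epsilon> :: real assume "\<epsilon> > 0"
    \<comment> \<open>All codes lie in [0, 2], so this half-open interval carries the full mass for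
      every \<open>k\<close>.\<close>
    have "measure (N k) {- 1<..3} = 1" for k
    proof -
      have "- 1 < halfspace_code l \<and> halfspace_code l \<le> 3" for l :: "real^'n"
        using halfspace_code_bounds[of l] by simp
      then have "halfspace_code -` {- 1<..3} = (UNIV :: (real^'n) set)" by auto
      then have "measure (N k) {- 1<..3} = measure (M k) (space (M k))"
        unfolding N_def by (subst measure_distr) simp_all
      then show ?thesis by (simp add: prob_space.prob_space[OF prob])
    qed
    then show "\<exists>a b. a < b \<and> (\<forall>n. 1 - \<epsilon> < measure (N n) {a<..b})"
      using \<open>\<epsilon> > 0\<close> by (intro exI[of _ "-1"] exI[of _ 3]) auto
  qed
  then obtain r L where r: "strict_mono (r :: nat \<Rightarrow> nat)" and L: "real_distribution L"
    and conv: "weak_conv_m (N \<circ> id \<circ> r) L"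
    using tight_imp_convergent_subsubsequence[of N id] by (auto simp: strict_mono_id)
  interpret L: real_distribution L by (rule L)
  define \<mu> where "\<mu> = distr L borel g"
  show thesis
  proof (rule that[OF r])
    show "prob_space \<mu>" unfolding \<mu>_def by (rule L.prob_space_distr) simp
    show "sets \<mu> = sets borel" by (simp add: \<mu>_def)
    show "AE l in \<mu>. l \<in> cbox a b"
      unfolding \<mu>_def using g(2) by (subst AE_distr_iff) auto
    fix \<phi> :: "real^'n \<Rightarrow> real" assume \<phi>: "continuous_on UNIV \<phi>"
    have [measurable]: "\<phi> \<in> borel_measurable borel" using \<phi> by (rule borel_measurable_continuous_onI)
    have "compact (\<phi> ` cbox a b)" using \<phi> by (intro compact_continuous_image) (auto intro: continuous_on_subset)
    then obtain C where C: "\<And>l. l \<in> cbox a b \<Longrightarrow> norm (\<phi> l) \<le> C"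
      unfolding compact_eq_bounded_closed bounded_iff by blast
    have cont: "isCont (\<phi> \<circ> g) x" for x
      using continuous_on_compose[OF g(1) continuous_on_subset[OF \<phi>]]
      by (simp add: continuous_on_eq_continuous_at o_def)
    have "(\<lambda>k. integral\<^sup>L ((N \<circ> id \<circ> r) k) (\<phi> \<circ> g)) \<longlonglongrightarrow>
        integral\<^sup>L L (\<phi> \<circ> g)"
      by (rule weak_conv_imp_integral_bdd_continuous_conv[OF _ L conv cont, of C])
        (use N C g(2) in \<open>auto simp: o_def image_subset_iff\<close>)
    moreover have "integral\<^sup>L ((N \<circ> id \<circ> r) k) (\<phi> \<circ> g) = (\<integral>l. \<phi> l
        \<partial>M (r k))" for k
    proof -
      have "integral\<^sup>L ((N \<circ> id \<circ> r) k) (\<phi> \<circ> g) = (\<integral>l. \<phi> (g (halfspace_code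
          l)) \<partial>M (r k))"
        unfolding N_def o_def id_def by (subst integral_distr) auto
      also have "\<dots> = (\<integral>l. \<phi> l \<partial>M (r k))"
        by (rule integral_cong_AE) (use supp[of "r k"] g(3) in auto)
      finally show ?thesis .
    qed
    moreover have "integral\<^sup>L L (\<phi> \<circ> g) = (\<integral>l. \<phi> l \<partial>\<mu>)"
      unfolding \<mu>_def o_def by (subst integral_distr) auto
    ultimately show "(\<lambda>k. \<integral>l. \<phi> l \<partial>M (r k)) \<longlonglongrightarrow> (\<integral>l.
        \<phi> l \<partial>\<mu>)" by simp
  qed
qed

section \<open>Polynomials of operators and Bernstein approximation\<close>

text \<open>Horner's scheme along the coefficients, so that induction on \<open>pCons\<close>
  applies directly.\<close>

definition op_poly :: "('h::complex_hilbert \<Rightarrow> 'h) \<Rightarrow> real poly \<Rightarrow> 'h \<Rightarrow>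
    'h" where
  "op_poly x p = fold_coeffs (\<lambda>a g \<xi>. a *\<^sub>R \<xi> + x (g \<xi>)) p (\<lambda>_. 0)"

lemma op_poly_0 [simp]: "op_poly x 0 = (\<lambda>_. 0)"
  by (simp add: op_poly_def)

text \<open>The condition on 0 covers the case in which \<open>pCons 0 0\<close> collapses to the
  zero polynomial and nothing is folded.\<close>

lemma op_poly_pCons: "x 0 = 0 \<Longrightarrow> op_poly x (pCons a p) \<xi> = a *\<^sub>R \<xi> + x (op_poly x p \<xi>)"
  by (cases "p = 0 \<and> a = 0") (auto simp: op_poly_def fold_coeffs_pCons_eq)

context
  fixes x :: "'h::complex_hilbert \<Rightarrow> 'h"
  assumes x: "bounded_clinear x"
begin

lemma bounded_clinear_op_poly: "bounded_clinear (op_poly x p)"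
proof (induction p)
  case (pCons a p)
  have eq: "op_poly x (pCons a p) = (\<lambda>\<xi>. a *\<^sub>R \<xi> + (x \<circ> op_poly x p) \<xi>)"
    by (auto simp: op_poly_pCons bounded_clinearD[OF x])
  show ?case
    unfolding eq by (intro bounded_clinear_add bounded_clinear_scaleR bounded_clinear_comp x pCons.IH) simp
qed simp

lemma op_poly_add: "op_poly x (p + q) \<xi> = op_poly x p \<xi> + op_poly x q \<xi>"
  by (induction p q rule: poly_induct2)
    (simp_all add: op_poly_pCons bounded_clinearD[OF x] algebra_simps)

lemma op_poly_smult: "op_poly x (smult c p) \<xi> = c *\<^sub>R op_poly x p \<xi>"
  by (induction p) (simp_all add: op_poly_pCons bounded_clinearD[OF x] algebra_simps)

lemma op_poly_mult: "op_poly x (p * q) \<xi> = op_poly x p (op_poly x q \<xi>)"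
  by (induction p) (simp_all add: op_poly_pCons op_poly_add op_poly_smult bounded_clinearD[OF x])

lemma op_poly_1 [simp]: "op_poly x 1 \<xi> = \<xi>"
  by (simp add: one_pCons op_poly_pCons bounded_clinearD[OF x])

lemma op_poly_sum: "op_poly x (\<Sum>i\<in>A. f i) \<xi> = (\<Sum>i\<in>A. op_poly x (f i) \<xi>)"
  by (induction A rule: infinite_finite_induct) (auto simp: op_poly_add)

lemma op_poly_commute:
  assumes b: "bounded_clinear b" and "\<And>\<xi>. b (x \<xi>) = x (b \<xi>)"
  shows "b (op_poly x p \<xi>) = op_poly x p (b \<xi>)"
  using assms(2) by (induction p) (simp_all add: op_poly_pCons bounded_clinearD[OF x] bounded_clinearD[OF b])

end

lemma selfadjoint_op_poly:
  assumes x: "selfadjoint_op x"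
  shows "selfadjoint_op (op_poly x p)"
proof (rule selfadjoint_opI[OF bounded_clinear_op_poly[OF selfadjoint_opD(1)[OF x]]])
  note bl = bounded_clinearD[OF selfadjoint_opD(1)[OF x]]
  show "cinner (op_poly x p \<xi>) \<eta> = cinner \<xi> (op_poly x p \<eta>)" for \<xi> \<eta>
  proof (induction p arbitrary: \<xi> \<eta>)
    case (pCons a p)
    have "cinner (x (op_poly x p \<xi>)) \<eta> = cinner \<xi> (op_poly x p (x \<eta>))"
      by (simp add: selfadjoint_opD(2)[OF x] pCons)
    then show ?case
      by (simp add: op_poly_pCons bl cinner_algebra op_poly_commute[OF selfadjoint_opD(1)[OF x] selfadjoint_opD(1)[OF x]])
  qed simp
qed

section \<open>Bernstein weights of a positive contraction\<close>

definition bernstein_poly :: "nat \<Rightarrow> nat \<Rightarrow> real poly" where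
  "bernstein_poly m k = smult (of_nat (m choose k)) ([:0, 1:] ^ k * [:1, - 1:] ^ (m - k))"

lemma smult_sum_right: "smult c (\<Sum>i\<in>A. f i) = (\<Sum>i\<in>A. smult c (f i))"
  by (induction A rule: infinite_finite_induct) (auto simp: smult_add_right)

text \<open>The binomial moments of the binomial distribution, as a polynomial identity: the product
  of the two binomial coefficients is regrouped and the rest is a power of X + (1 - X) = 1. In this
  form the moments are exact, and the case r = 0 is the partition of unity.\<close>

lemma sum_choose_bernstein_poly:
  assumes r: "r \<le> m"
  shows "(\<Sum>j\<le>m. smult (of_nat (j choose r)) (bernstein_poly m j)) = smult (of_nat (m choose r)) ([:0, 1:] ^ r)"
proof -
  let ?X = "[:0, 1:] :: real poly" and ?Y = "[:1, - 1:] :: real poly"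
  have "(\<Sum>j\<le>m. smult (of_nat (j choose r)) (bernstein_poly m j)) =
      (\<Sum>j\<in>{r..m}. smult (of_nat (j choose r)) (bernstein_poly m j))"
    by (rule sum.mono_neutral_right) (auto simp: not_le)
  also have "\<dots> = (\<Sum>i\<in>{0..m-r}. smult (of_nat ((i + r) choose r)) (bernstein_poly m (i + r)))"
    using sum.shift_bounds_cl_nat_ivl[of "\<lambda>j. smult (of_nat (j choose r)) (bernstein_poly m j)" 0 r "m - r"] r
        by simp
  also have "\<dots> = (\<Sum>i\<in>{0..m-r}. smult (of_nat (m choose r)) (?X ^ r * (of_nat ((m - r) choose i) * ?X ^ i
      * ?Y ^ (m - r - i))))"
  proof (rule sum.cong[OF refl])
    fix i assume i: "i \<in> {0..m - r}"
    have "(m choose (i + r)) * ((i + r) choose r) = (m choose r) * ((m - r) choose i)"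
      using choose_mult[of r "i + r" m] i r by auto
    then have "real ((i + r) choose r) * real (m choose (i + r)) = real (m choose r) * real ((m - r) choose i)"
      by (metis mult.commute of_nat_mult)
    then show "smult (of_nat ((i + r) choose r)) (bernstein_poly m (i + r)) =
        smult (of_nat (m choose r)) (?X ^ r * (of_nat ((m - r) choose i) * ?X ^ i * ?Y ^ (m - r - i)))"
      by (simp add: bernstein_poly_def power_add of_nat_poly mult_ac add.commute)
  qed
  also have "\<dots> = smult (of_nat (m choose r)) (?X ^ r * (\<Sum>i\<le>m-r. of_nat ((m - r) choose i) * ?X ^ i * ?Y
      ^ (m - r - i)))"
    by (simp add: sum_distrib_left smult_sum_right atLeast0AtMost)
  also have "(\<Sum>i\<le>m-r. of_nat ((m - r) choose i) * ?X ^ i * ?Y ^ (m - r - i)) = (?X + ?Y) ^ (m - r)"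
    by (rule binomial_ring[symmetric])
  also have "?X + ?Y = 1" by (simp add: one_pCons)
  finally show ?thesis by simp
qed

text \<open>Bridges from the exact binomial moments to powers, uniformly in \<open>j\<close>.
  Passing from \<open>r\<close> to \<open>Suc r\<close> multiplies the ratio by (j - r)/(m - r) and
  the power by j/m; these factors differ by at most r/(m - r).\<close>

lemma choose_ratio_approx:
  "\<exists>\<epsilon>. \<epsilon> \<longlonglongrightarrow> 0 \<and> (\<forall>m>r. \<forall>j\<le>m. \<bar>(real j /
      real m) ^ r - real (j choose r) / real (m choose r)\<bar> \<le> \<epsilon> m)"
proof (induction r)
  case 0
  then show ?case by (auto intro!: exI[of _ "\<lambda>_. 0"])
next
  case (Suc r)
  then obtain \<epsilon> where \<epsilon>: "\<epsilon> \<longlonglongrightarrow> 0"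
    "\<And>m j. m > r \<Longrightarrow> j \<le> m \<Longrightarrow> \<bar>(real j / real m) ^ r - real (j choose r) /
        real (m choose r)\<bar> \<le> \<epsilon> m" by blast
  have "\<bar>(real j / real m) ^ Suc r - real (j choose Suc r) / real (m choose Suc r)\<bar> \<le> \<epsilon> m + real
      r / real (m - r)"
    if m: "m > Suc r" and j: "j \<le> m" for m j
  proof -
    define c where "c = real (j choose r) / real (m choose r)"
    \<comment> \<open>Stated over the reals, where \<open>j - r\<close> may be negative; in that
      case both binomial coefficients vanish.\<close>
    have absorb: "real (Suc r) * real (j choose Suc r) = (real j - real r) * real (j choose r)" for j
    proof (cases "r \<le> j")
      case True
      have "Suc r * (j choose Suc r) = (j - r) * (j choose r)"
        unfolding binomial_absorption binomial_absorb_comp ..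
      then show ?thesis using True by (metis of_nat_diff of_nat_mult)
    qed (simp add: binomial_eq_0)
    have pos: "real (m choose r) > 0" "real m - real r > 0" using m by auto
    have "real (j choose Suc r) / real (m choose Suc r) =
        (real (Suc r) * real (j choose Suc r)) / (real (Suc r) * real (m choose Suc r))" by simp
    also have "\<dots> = c * ((real j - real r) / (real m - real r))"
      unfolding absorb c_def by (simp add: mult.commute)
    finally have eq: "real (j choose Suc r) / real (m choose Suc r) = c * ((real j - real r) / (real m - real r))" .
    have c: "0 \<le> c" "c \<le> 1"
      using pos(1) j by (auto simp: c_def binomial_mono divide_le_eq_1 intro: binomial_right_mono)
    have jm: "0 \<le> real j / real m" "real j / real m \<le> 1" using j by (auto simp: divide_le_eq_1)
    have "real j / real m - (real j - real r) / (real m - real r) = (real r / (real m - real r)) * ((real m - real j) /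
        real m)"
      using pos m by (simp add: field_simps)
    moreover have "0 \<le> (real m - real j) / real m" "(real m - real j) / real m \<le> 1"
      using j m by (auto simp: divide_simps)
    moreover have "0 \<le> real r / (real m - real r)" using pos by simp
    ultimately have d: "\<bar>real j / real m - (real j - real r) / (real m - real r)\<bar> \<le> real r / (real m - real r)"
      by (metis abs_of_nonneg mult_left_le mult_nonneg_nonneg)
    have "(real j / real m) ^ Suc r - real (j choose Suc r) / real (m choose Suc r) =
       (real j / real m) * ((real j / real m) ^ r - c) + c * (real j / real m - (real j - real r) / (real m - real r))"
      unfolding eq by (simp add: algebra_simps)
    also have "\<bar>\<dots>\<bar> \<le> (real j / real m) * \<bar>(real j / real m) ^ r - c\<bar> + c * \<bar>real j /
        real m - (real j - real r) / (real m - real r)\<bar>"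
      using c jm by (intro order_trans[OF abs_triangle_ineq]) (simp add: abs_mult)
    also have "\<dots> \<le> 1 * \<bar>(real j / real m) ^ r - c\<bar> + 1 * \<bar>real j / real m - (real j - real r)
        / (real m - real r)\<bar>"
      using c jm by (intro add_mono mult_right_mono) auto
    also have "\<dots> \<le> \<epsilon> m + real r / (real m - real r)"
      using \<epsilon>(2)[of m j] m j d unfolding c_def by simp
    finally show ?thesis using m by (simp add: of_nat_diff)
  qed
  moreover have "(\<lambda>m. \<epsilon> m + real r / real (m - r)) \<longlonglongrightarrow> 0 + 0"
  proof (intro tendsto_add \<epsilon>)
    have "(\<lambda>m. real r / real (m + r - r)) \<longlonglongrightarrow> 0"
      using lim_const_over_n[of "real r"] by simp
    then show "(\<lambda>m. real r / real (m - r)) \<longlonglongrightarrow> 0" by (rule LIMSEQ_offset)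
  qed
  ultimately show ?case by (intro exI[of _ "\<lambda>m. \<epsilon> m + real r / real (m - r)"]) auto
qed

text \<open>Both \<open>x\<close> and \<open>1 - x\<close> are positive and at most 1, so the
  factors can be multiplied onto \<open>b\<close> one at a time. The accumulator \<open>b\<close>
  allows the weights of several coordinates to be multiplied by the same lemma.\<close>

lemma op_poly_bernstein_positive:
  assumes x: "positive_op x" "\<And>\<xi>. x \<xi> \<bullet> \<xi> \<le> \<xi> \<bullet> \<xi>" and b: "positive_op b"
      and comm: "\<And>\<xi>. b (x \<xi>) = x (b \<xi>)"
  shows "positive_op (op_poly x (bernstein_poly m k) \<circ> b)"
proof -
  have sx: "selfadjoint_op x" and px: "\<And>\<xi>. 0 \<le> x \<xi> \<bullet> \<xi>" using x(1) by (auto simp: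
      positive_op_iff Re_cinner)
  have xc: "bounded_clinear x" and bc: "bounded_clinear b" using x(1) b by (auto simp: positive_op_def)
  have y: "op_poly x [:1, - 1:] = (\<lambda>\<xi>. \<xi> - x \<xi>)" "op_poly x [:0, 1:] = x"
    by (auto simp: op_poly_pCons bounded_clinearD[OF xc])
  have py: "positive_op (op_poly x [:1, - 1:])"
    using selfadjoint_op_poly[OF sx, of "[:1, - 1:]"] x(2) by (simp add: positive_op_iff y Re_cinner inner_diff_left)
  have comm': "op_poly x p \<circ> (op_poly x q \<circ> b) = (op_poly x q \<circ> b) \<circ> op_poly x p" for p q
  proof
    fix \<xi>
    have "op_poly x p (op_poly x q (b \<xi>)) = op_poly x q (op_poly x p (b \<xi>))"
      by (metis op_poly_mult[OF xc] mult.commute)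
    then show "(op_poly x p \<circ> (op_poly x q \<circ> b)) \<xi> = ((op_poly x q \<circ> b) \<circ> op_poly x p) \<xi>"
      by (simp add: op_poly_commute[OF xc bc comm])
  qed
  have mult: "op_poly x (p * q) \<circ> b = op_poly x p \<circ> (op_poly x q \<circ> b)" for p q
    by (auto simp: op_poly_mult[OF xc])
  have 1: "positive_op (op_poly x ([:1, - 1:] ^ j) \<circ> b)" for j
  proof (induction j)
    case 0
    then show ?case using b by (simp add: o_def op_poly_1[OF xc])
  next
    case (Suc j)
    show ?case unfolding power_Suc mult
      by (rule positive_op_comp_commute[OF py Suc comm']) (use px in \<open>simp add: y inner_diff_left\<close>)
  qed
  have 2: "positive_op (op_poly x ([:0, 1:] ^ k * [:1, - 1:] ^ j) \<circ> b)" for k j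
  proof (induction k)
    case 0
    then show ?case using 1[of j] by (simp add: o_def)
  next
    case (Suc k)
    show ?case unfolding power_Suc mult.assoc mult[of "[:0, 1:]"]
      by (rule positive_op_comp_commute[OF _ Suc comm']) (use x in \<open>simp_all add: y\<close>)
  qed
  define c where "c = (op_poly x ([:0, 1:] ^ k * [:1, - 1:] ^ (m - k)) \<circ> b)"
  have eq: "op_poly x (bernstein_poly m k) \<circ> b = (\<lambda>\<xi>. real (m choose k) *\<^sub>R c \<xi>)"
    by (auto simp: bernstein_poly_def op_poly_smult[OF xc] c_def)
  have "positive_op c" using 2 by (simp add: c_def)
  then show ?thesis
    unfolding eq positive_op_iff
    by (auto intro!: selfadjoint_opI bounded_clinear_scaleR mult_nonneg_nonneg
        simp: selfadjoint_opD cinner_algebra)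
qed

text \<open>For a monomial the exact moments turn the error into \<Sum> d_j W_j with small
  coefficients. The W_j are positive with sum 1, so the numerical range, and with it the norm, is at
  most the largest coefficient. Linear combinations extend this to all polynomials. A norm estimate
  is wanted because such approximations are multiplied over the coordinates afterwards.\<close>

lemma op_poly_bernstein_approx:
  assumes x: "positive_op x" "\<And>\<xi>. x \<xi> \<bullet> \<xi> \<le> \<xi> \<bullet> \<xi>"
  shows "\<exists>\<epsilon>. \<epsilon> \<longlonglongrightarrow> 0 \<and> (\<exists>N. \<forall>m\<ge>N.
      \<forall>\<xi>. norm ((\<Sum>j\<le>m. poly p (real j / real m) *\<^sub>R op_poly x (bernstein_poly m j) \<xi>)
    - op_poly x p \<xi>) \<le> \<epsilon> m * norm \<xi>)" (is "?P p")
proof -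
  have sx: "selfadjoint_op x" using x(1) by (auto simp: positive_op_iff)
  have xc: "bounded_clinear x" using x(1) by (auto simp: positive_op_def)
  define W where "W m j = op_poly x (bernstein_poly m j)" for m j
  have W: "selfadjoint_op (W m j)" "0 \<le> W m j \<xi> \<bullet> \<xi>" for m j \<xi>
  proof -
    have "positive_op (op_poly x (bernstein_poly m j) \<circ> id)"
      by (rule op_poly_bernstein_positive[OF x]) (auto simp: positive_op_def cinner_self)
    then show "selfadjoint_op (W m j)" "0 \<le> W m j \<xi> \<bullet> \<xi>" by (auto simp: W_def positive_op_iff Re_cinner)
  qed
  have W1: "(\<Sum>j\<le>m. (real (j choose r) / real (m choose r)) *\<^sub>R W m j \<xi>) = op_poly x ([:0, 1:] ^ r)
      \<xi>" if r: "r \<le> m" for m r \<xi>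
  proof -
    have c: "real (m choose r) \<noteq> 0" using r by simp
    have "(\<Sum>j\<le>m. real (j choose r) *\<^sub>R W m j \<xi>) = real (m choose r) *\<^sub>R op_poly x ([:0, 1:] ^
        r) \<xi>"
      using arg_cong[OF sum_choose_bernstein_poly[OF r], of "\<lambda>p. op_poly x p \<xi>"]
      by (simp add: op_poly_sum[OF xc] op_poly_smult[OF xc] W_def)
    then have "(1 / real (m choose r)) *\<^sub>R (\<Sum>j\<le>m. real (j choose r) *\<^sub>R W m j \<xi>) = op_poly x
        ([:0, 1:] ^ r) \<xi>"
      using c by simp
    then show ?thesis by (simp add: scaleR_sum_right)
  qed
  have W2: "(\<Sum>j\<le>m. W m j \<xi>) = \<xi>" for m \<xi>
    using W1[of 0 m \<xi>] by (simp add: op_poly_1[OF xc])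
  have mono: "?P ([:0, 1:] ^ r)" for r
  proof -
    obtain \<epsilon> where \<epsilon>: "\<epsilon> \<longlonglongrightarrow> 0"
      "\<And>m j. m > r \<Longrightarrow> j \<le> m \<Longrightarrow> \<bar>(real j / real m) ^ r - real (j choose r) /
          real (m choose r)\<bar> \<le> \<epsilon> m"
      using choose_ratio_approx[of r] by blast
    have "norm ((\<Sum>j\<le>m. poly ([:0, 1:] ^ r) (real j / real m) *\<^sub>R W m j \<xi>) - op_poly x ([:0, 1:] ^ r)
        \<xi>) \<le> \<epsilon> m * norm \<xi>"
      if m: "m \<ge> Suc r" for m \<xi>
    proof -
      define d where "d j = (real j / real m) ^ r - real (j choose r) / real (m choose r)" for j
      define D where "D \<xi> = (\<Sum>j\<le>m. d j *\<^sub>R W m j \<xi>)" for \<xi>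
      have "norm (D \<xi>) \<le> \<epsilon> m * norm \<xi>"
      proof (rule selfadjoint_op_norm_bound)
        show "selfadjoint_op D"
          unfolding D_def
          by (rule selfadjoint_opI)
            (auto intro!: bounded_clinear_sum bounded_clinear_scaleR selfadjoint_opD(1)[OF W(1)]
              simp: cinner_sum_left cinner_sum_right cinner_algebra selfadjoint_opD(2)[OF W(1)])
        fix \<xi>
        have "\<bar>Re (cinner (D \<xi>) \<xi>)\<bar> \<le> (\<Sum>j\<le>m. \<bar>d j\<bar> * (W m j \<xi> \<bullet> \<xi>))"
          unfolding Re_cinner D_def inner_sum_left
          using W(2) by (intro order_trans[OF sum_abs] sum_mono) (simp add: abs_mult)
        also have "\<dots> \<le> (\<Sum>j\<le>m. \<epsilon> m * (W m j \<xi> \<bullet> \<xi>))"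
          using W(2) \<epsilon>(2) m by (intro sum_mono mult_right_mono) (auto simp: d_def)
        also have "\<dots> = \<epsilon> m * (norm \<xi>)\<^sup>2"
          unfolding sum_distrib_left[symmetric] inner_sum_left[symmetric] W2 by (simp add: dot_square_norm)
        finally show "\<bar>Re (cinner (D \<xi>) \<xi>)\<bar> \<le> \<epsilon> m * (norm \<xi>)\<^sup>2" .
      qed
      moreover have "D \<xi> = (\<Sum>j\<le>m. poly ([:0, 1:] ^ r) (real j / real m) *\<^sub>R W m j \<xi>) - op_poly x
          ([:0, 1:] ^ r) \<xi>"
        using W1[of r m \<xi>] m by (simp add: D_def d_def poly_power scaleR_diff_left sum_subtractf)
      ultimately show ?thesis by simp
    qed
    then show ?thesis
      using \<epsilon>(1) unfolding W_def by (intro exI[of _ \<epsilon>] conjI exI[of _ "Suc r"]) auto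
  qed
  have add: "?P (p + q)" if "?P p" "?P q" for p q
  proof -
    from that obtain e f N M where e: "e \<longlonglongrightarrow> 0" "f \<longlonglongrightarrow> 0"
      "\<And>m \<xi>. m \<ge> N \<Longrightarrow> norm ((\<Sum>j\<le>m. poly p (real j / real m) *\<^sub>R W m j \<xi>)
          - op_poly x p \<xi>) \<le> e m * norm \<xi>"
      "\<And>m \<xi>. m \<ge> M \<Longrightarrow> norm ((\<Sum>j\<le>m. poly q (real j / real m) *\<^sub>R W m j \<xi>)
          - op_poly x q \<xi>) \<le> f m * norm \<xi>"
      unfolding W_def by blast
    have "norm ((\<Sum>j\<le>m. poly (p + q) (real j / real m) *\<^sub>R W m j \<xi>) - op_poly x (p + q) \<xi>) \<le>
        (e m + f m) * norm \<xi>"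
      if "m \<ge> max N M" for m \<xi>
    proof -
      have "(\<Sum>j\<le>m. poly (p + q) (real j / real m) *\<^sub>R W m j \<xi>) - op_poly x (p + q) \<xi> =
        ((\<Sum>j\<le>m. poly p (real j / real m) *\<^sub>R W m j \<xi>) - op_poly x p \<xi>) +
        ((\<Sum>j\<le>m. poly q (real j / real m) *\<^sub>R W m j \<xi>) - op_poly x q \<xi>)"
        by (simp add: op_poly_add[OF xc] scaleR_add_left sum.distrib)
      also have "norm \<dots> \<le> e m * norm \<xi> + f m * norm \<xi>"
        using that by (intro norm_triangle_mono e) auto
      finally show ?thesis by (simp add: distrib_right)
    qed
    moreover have "(\<lambda>m. e m + f m) \<longlonglongrightarrow> 0" using tendsto_add[OF e(1,2)] by simp
    ultimately show ?thesis
      unfolding W_def by (intro exI[of _ "\<lambda>m. e m + f m"] conjI exI[of _ "max N M"]) auto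
  qed
  have smult: "?P (smult c p)" if "?P p" for c p
  proof -
    from that obtain e N where e: "e \<longlonglongrightarrow> 0"
      "\<And>m \<xi>. m \<ge> N \<Longrightarrow> norm ((\<Sum>j\<le>m. poly p (real j / real m) *\<^sub>R W m j \<xi>)
          - op_poly x p \<xi>) \<le> e m * norm \<xi>"
      unfolding W_def by blast
    have "norm ((\<Sum>j\<le>m. poly (smult c p) (real j / real m) *\<^sub>R W m j \<xi>) - op_poly x (smult c p)
        \<xi>) \<le> (\<bar>c\<bar> * e m) * norm \<xi>"
      if "m \<ge> N" for m \<xi>
    proof -
      have "(\<Sum>j\<le>m. poly (smult c p) (real j / real m) *\<^sub>R W m j \<xi>) - op_poly x (smult c p) \<xi> =
        c *\<^sub>R ((\<Sum>j\<le>m. poly p (real j / real m) *\<^sub>R W m j \<xi>) - op_poly x p \<xi>)"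
        by (simp add: op_poly_smult[OF xc] scaleR_diff_right scaleR_sum_right)
      then show ?thesis using mult_left_mono[OF e(2)[OF that, of \<xi>], of "\<bar>c\<bar>"] by (simp add: mult_ac)
    qed
    moreover have "(\<lambda>m. \<bar>c\<bar> * e m) \<longlonglongrightarrow> 0" using tendsto_mult_left[OF e(1), of
        "\<bar>c\<bar>"] by simp
    ultimately show ?thesis
      unfolding W_def by (intro exI[of _ "\<lambda>m. \<bar>c\<bar> * e m"] conjI exI[of _ N]) auto
  qed
  have zero: "?P 0" by (auto intro!: exI[of _ "\<lambda>_. 0"])
  have "?P (\<Sum>i\<in>A. smult (coeff p i) ([:0, 1:] ^ i))" if "finite A" for A
    using that
  proof (induction A rule: finite_induct)
    case empty
    show ?case unfolding sum.empty by (rule zero)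
  next
    case (insert i A)
    show ?case unfolding sum.insert[OF insert.hyps] by (rule add[OF smult[OF mono] insert.IH])
  qed
  from this[of "{..degree p}"] show ?thesis
    using poly_as_sum_of_monoms[of p] by (simp add: monom_altdef)
qed

section \<open>Products over the coordinates\<close>

definition op_prod :: "'i list \<Rightarrow> ('i \<Rightarrow> 'h \<Rightarrow> 'h) \<Rightarrow> 'h \<Rightarrow> 'h" where
  "op_prod is T = foldr (\<lambda>i b. T i \<circ> b) is id"

lemma op_prod_simps [simp]: "op_prod [] T = id" "op_prod (i # is) T = T i \<circ> op_prod is T"
  by (simp_all add: op_prod_def)

lemma bounded_clinear_op_prod: "(\<And>i. bounded_clinear (T i)) \<Longrightarrow> bounded_clinear (op_prod is T)"
  by (induction "is") auto

lemma op_prod_commute: "(\<And>i \<xi>. b (T i \<xi>) = T i (b \<xi>)) \<Longrightarrow> b (op_prod is T \<xi>) =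
    op_prod is T (b \<xi>)"
  by (induction "is" arbitrary: \<xi>) auto

lemma op_prod_comp:
  assumes "\<And>i j \<xi>. S i (T j \<xi>) = T j (S i \<xi>)"
  shows "op_prod is (\<lambda>i. T i \<circ> S i) = op_prod is T \<circ> op_prod is S"
proof (induction "is")
  case (Cons i "is")
  have "S i (op_prod is T \<xi>) = op_prod is T (S i \<xi>)" for \<xi> by (rule op_prod_commute) (rule assms)
  moreover have "op_prod (i # is) (\<lambda>i. T i \<circ> S i) = T i \<circ> S i \<circ> (op_prod is T \<circ> op_prod
      is S)"
    unfolding op_prod_simps Cons ..
  ultimately show ?case by (simp add: fun_eq_iff o_def)
qed simp

lemma selfadjoint_op_prod:
  assumes T: "\<And>i. selfadjoint_op (T i)" and comm: "\<And>i j \<xi>. T i (T j \<xi>) = T j (T i \<xi>)"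
  shows "selfadjoint_op (op_prod is T)"
proof (rule selfadjoint_opI[OF bounded_clinear_op_prod[OF selfadjoint_opD(1)[OF T]]])
  show "cinner (op_prod is T \<xi>) \<eta> = cinner \<xi> (op_prod is T \<eta>)" for \<xi> \<eta>
  proof (induction "is" arbitrary: \<xi> \<eta>)
    case (Cons i "is")
    then show ?case using op_prod_commute[of "T i" T, OF comm] by (simp add: selfadjoint_opD(2)[OF T])
  qed simp
qed

text \<open>Distributivity: a sum over multi-indices of product weights is the product of the
  one-variable sums. It evaluates the grid measures on product polynomials.\<close>

lemma sum_PiE_op_prod:
  assumes W: "\<And>i j. bounded_clinear (W i j)" and "distinct is" "finite A"
  shows "(\<Sum>k\<in>PiE (set is) (\<lambda>_. A). (\<Prod>i\<in>set is. c i (k i)) *\<^sub>R op_prod is (\<lambda>i.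
      W i (k i)) \<xi>) =
    op_prod is (\<lambda>i \<zeta>. \<Sum>j\<in>A. c i j *\<^sub>R W i j \<zeta>) \<xi>"
  using assms(2)
proof (induction "is")
  case (Cons a "is")
  have inj: "inj_on (\<lambda>(y, g). g(a := y)) (A \<times> PiE (set is) (\<lambda>_. A))"
    using Cons.prems by (intro inj_combinator) auto
  have cong: "op_prod is (\<lambda>i. W i ((k(a := y)) i)) = op_prod is (\<lambda>i. W i (k i))" for k y
    unfolding op_prod_def using Cons.prems by (intro foldr_cong) auto
  have prod: "(\<Prod>i\<in>set is. c i ((k(a := y)) i)) = (\<Prod>i\<in>set is. c i (k i))" for k y
    using Cons.prems by (intro prod.cong) auto
  have "(\<Sum>k\<in>PiE (set (a # is)) (\<lambda>_. A). (\<Prod>i\<in>set (a # is). c i (k i)) *\<^sub>R op_prod (a #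
      is) (\<lambda>i. W i (k i)) \<xi>) =
    (\<Sum>(y, k)\<in>A \<times> PiE (set is) (\<lambda>_. A). (c a y * (\<Prod>i\<in>set is. c i (k i))) *\<^sub>R W a
        y (op_prod is (\<lambda>i. W i (k i)) \<xi>))"
    unfolding list.set(2) PiE_insert_eq sum.reindex[OF inj] o_def
    using Cons.prems by (intro sum.cong) (auto simp: prod cong simp del: fun_upd_apply, simp)
  also have "\<dots> = (\<Sum>y\<in>A. c a y *\<^sub>R W a y (\<Sum>k\<in>PiE (set is) (\<lambda>_. A).
      (\<Prod>i\<in>set is. c i (k i)) *\<^sub>R op_prod is (\<lambda>i. W i (k i)) \<xi>))"
    by (simp add: sum.cartesian_product[symmetric] bounded_clinear_sum_arg[OF W] bounded_clinearD(7)[OF W] scaleR_sum_right)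
  finally show ?case using Cons by simp
qed simp

text \<open>The error of each factor is relative to the norm of its argument, so it also tends to 0
  along the convergent, varying vectors produced by the factors behind it.\<close>

lemma op_prod_tendsto:
  assumes e: "\<And>i. \<epsilon> i \<longlonglongrightarrow> 0"
    and approx: "\<And>i. \<exists>N. \<forall>m\<ge>N. \<forall>\<xi>. norm (S m i \<xi> - T i \<xi>) \<le> \<epsilon>
        i m * norm \<xi>"
    and T: "\<And>i. bounded_clinear (T i)"
  shows "(\<lambda>m. op_prod is (S m) \<xi>) \<longlonglongrightarrow> op_prod is T (\<xi> :: 'h::complex_hilbert)"
proof (induction "is")
  case (Cons i "is")
  define z where "z m = op_prod is (S m) \<xi>" for m
  have z: "z \<longlonglongrightarrow> op_prod is T \<xi>" using Cons unfolding z_def[abs_def] .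
  have "(\<lambda>m. S m i (z m) - T i (z m)) \<longlonglongrightarrow> 0"
  proof (rule Lim_null_comparison)
    show "(\<lambda>m. \<epsilon> i m * norm (z m)) \<longlonglongrightarrow> 0" using tendsto_mult[OF e
        tendsto_norm[OF z]] by simp
    show "eventually (\<lambda>m. norm (S m i (z m) - T i (z m)) \<le> \<epsilon> i m * norm (z m)) sequentially"
      using approx[of i] unfolding eventually_sequentially by blast
  qed
  moreover have "(\<lambda>m. T i (z m)) \<longlonglongrightarrow> T i (op_prod is T \<xi>)"
    by (rule bounded_linear.tendsto[OF bounded_clinearD(1)[OF T] z])
  ultimately have "(\<lambda>m. (S m i (z m) - T i (z m)) + T i (z m)) \<longlonglongrightarrow> 0 + T i (op_prod is T
      \<xi>)" by (rule tendsto_add)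
  then show ?case by (simp add: z_def)
qed simp

section \<open>Projection-valued measures of commuting operators\<close>

lemma projection_opD:
  assumes "projection_op p"
  shows "bounded_clinear p" "p (p x) = p x" "cinner (p x) x = of_real ((norm (p x))\<^sup>2)"
    "cinner (p x) y = cinner x (p y)" "p x \<bullet> x = (norm (p x))\<^sup>2" "norm (p x) \<le> norm x"
proof -
  have s: "selfadjoint_op p" and i: "p \<circ> p = p" using assms by (auto simp: projection_op_def)
  show "bounded_clinear p" "cinner (p x) y = cinner x (p y)" by (auto intro: selfadjoint_opD s)
  show i': "p (p x) = p x" using i by (metis comp_apply)
  then show *: "cinner (p x) x = of_real ((norm (p x))\<^sup>2)"
    by (metis cinner_self selfadjoint_opD(2)[OF s])
  then show **: "p x \<bullet> x = (norm (p x))\<^sup>2" by (metis Re_cinner Re_complex_of_real)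
  have "norm (p x) * norm (p x) \<le> norm (p x) * norm x"
    using ** norm_cauchy_schwarz[of "p x" x] by (simp add: power2_eq_square)
  then show "norm (p x) \<le> norm x" by (cases "p x = 0") auto
qed

lemma pvmD:
  assumes "pvm E"
  shows "S \<in> sets borel \<Longrightarrow> projection_op (E S)" "E {} = (\<lambda>_. 0)" "E UNIV = id"
    "S \<in> sets borel \<Longrightarrow> S' \<in> sets borel \<Longrightarrow> E (S \<inter> S') = E S \<circ> E S'"
    "range A \<subseteq> sets borel \<Longrightarrow> disjoint_family A \<Longrightarrow> (\<lambda>k::nat. E (A k)
        \<xi>) sums E (\<Union>k. A k) \<xi>"
    "S \<notin> sets borel \<Longrightarrow> E S = (\<lambda>_. 0)"
  using assms unfolding pvm_def by blast+

context
  fixes E :: "'a::topological_space set \<Rightarrow> 'h::complex_hilbert \<Rightarrow> 'h"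
  assumes E: "pvm E"
begin

lemma sets_pvm_measure [simp]: "sets (pvm_measure E \<xi>) = sets borel"
  unfolding pvm_measure_def using sets.sigma_sets_eq[of borel] by (subst sets_measure_of) auto

lemma space_pvm_measure [simp]: "space (pvm_measure E \<xi>) = UNIV"
  unfolding pvm_measure_def by (simp add: space_measure_of_conv)

lemma emeasure_pvm_measure:
  assumes "S \<in> sets borel"
  shows "emeasure (pvm_measure E \<xi>) S = ennreal ((norm (E S \<xi>))\<^sup>2)"
proof -
  let ?m = "\<lambda>S. ennreal (Re (cinner (E S \<xi>) \<xi>))"
  have "emeasure (pvm_measure E \<xi>) S = ?m S"
  proof (rule emeasure_measure_of[OF pvm_measure_def])
    show "positive (sets (pvm_measure E \<xi>)) ?m" by (simp add: positive_def pvmD(2)[OF E])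
    show "countably_additive (sets (pvm_measure E \<xi>)) ?m"
    proof (rule countably_additiveI)
      fix A :: "nat \<Rightarrow> 'a set" assume A: "range A \<subseteq> sets (pvm_measure E \<xi>)" "disjoint_family A"
      then have "(\<lambda>k. E (A k) \<xi>) sums E (\<Union>k. A k) \<xi>" by (intro pvmD(5)[OF E]) auto
      then have "(\<lambda>k. E (A k) \<xi> \<bullet> \<xi>) sums (E (\<Union>k. A k) \<xi> \<bullet> \<xi>)"
        by (rule bounded_linear.sums[OF bounded_linear_inner_left])
      moreover have "0 \<le> E (A k) \<xi> \<bullet> \<xi>" for k
        using projection_opD(5)[OF pvmD(1)[OF E], of "A k" \<xi>] A by auto
      ultimately show "(\<Sum>k. ?m (A k)) = ?m (\<Union>k. A k)"
        unfolding Re_cinner by (intro suminf_ennreal_eq)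
    qed
  qed (use assms sets.space_closed in auto)
  then show ?thesis using projection_opD(3)[OF pvmD(1)[OF E assms], of \<xi>] by simp
qed

lemma finite_measure_pvm_measure: "finite_measure (pvm_measure E \<xi>)"
  by (rule finite_measureI) (simp add: emeasure_pvm_measure)

lemma measure_pvm_measure:
  "S \<in> sets borel \<Longrightarrow> measure (pvm_measure E \<xi>) S = (norm (E S \<xi>))\<^sup>2"
  by (simp add: measure_def emeasure_pvm_measure)

lemma measure_pvm_measure_UNIV: "measure (pvm_measure E \<xi>) UNIV = (norm \<xi>)\<^sup>2"
  by (simp add: measure_pvm_measure pvmD(3)[OF E])

end

text \<open>On a Borel set the diagonal values determine the projection by polarization. Elsewhere
  both functions vanish by the last clause of \<open>pvm\<close>, so they are equal as functions, as
  definite descriptions require.\<close>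

lemma pvm_eqI:
  assumes E: "pvm E" and F: "pvm F"
    and eq: "\<And>\<xi> S. S \<in> sets borel \<Longrightarrow> measure (pvm_measure E \<xi>) S = measure (pvm_measure
        F \<xi>) S"
  shows "E = F"
proof
  fix S show "E S = F S"
  proof (cases "S \<in> sets borel")
    case True
    note PE = pvmD(1)[OF E True] and PF = pvmD(1)[OF F True]
    show ?thesis
      by (rule clinear_eqI[OF projection_opD(1)[OF PE] projection_opD(1)[OF PF]])
        (use eq[OF True] in \<open>simp add: projection_opD(3)[OF PE] projection_opD(3)[OF PF]
          measure_pvm_measure[OF E True] measure_pvm_measure[OF F True] del: of_real_power\<close>)
  next
    case False
    then show ?thesis by (simp add: pvmD(6)[OF E] pvmD(6)[OF F])
  qed
qed

section \<open>Dynkin induction over orthants\<close>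

lemma sets_borel_orthants: "sets borel = sigma_sets UNIV (range (\<lambda>s::'a::ordered_euclidean_space. {..s}))"
  by (subst borel_eq_atMost) simp

lemma Int_stable_orthants: "Int_stable (range (\<lambda>s::'a::ordered_euclidean_space. {..s}))"
proof (rule Int_stableI_image)
  fix s t :: 'a
  have "{..s} \<inter> {..t} = {..inf s t}" by auto
  then show "\<exists>u\<in>UNIV. {..s} \<inter> {..t} = {..u}" by blast
qed

lemma borel_induct_orthants [consumes 1, case_names orthant empty compl union]:
  assumes S: "S \<in> sets (borel :: 'a::ordered_euclidean_space measure)"
    and "\<And>s. P {..s}" "P {}" "\<And>A. A \<in> sets borel \<Longrightarrow> P A \<Longrightarrow> P (- A)"
    and "\<And>A. disjoint_family A \<Longrightarrow> range A \<subseteq> sets borel \<Longrightarrow> (\<And>i::nat. P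
        (A i)) \<Longrightarrow> P (\<Union>i. A i)"
  shows "P S"
proof (rule sigma_sets_induct_disjoint[OF Int_stable_orthants _ S[unfolded sets_borel_orthants]])
  fix A :: "'a set" assume "A \<in> sigma_sets UNIV (range (\<lambda>s. {..s}))" "P A"
  then show "P (UNIV - A)" using assms(4)[of A] by (simp add: sets_borel_orthants Compl_eq_Diff_UNIV)
next
  fix A :: "nat \<Rightarrow> 'a set"
  assume "disjoint_family A" "range A \<subseteq> sigma_sets UNIV (range (\<lambda>s. {..s}))" "\<And>i. P (A i)"
  then show "P (\<Union>i. A i)" by (intro assms(5)) (auto simp: sets_borel_orthants)
qed (use assms in auto)

text \<open>The ramps \<open>h k\<close> are 1 up to \<open>s\<close> and descend with slope
  \<open>k\<close> to the right of it, so their limit is correct at \<open>s\<close> itself.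
  Weierstrass approximation within 1/(k+1) keeps the limit and bounds the polynomials by 1 +
  1.\<close>

lemma polys_tendsto_indicator_atMost:
  fixes a b s :: real
  obtains p :: "nat \<Rightarrow> real poly"
  where "\<And>l. l \<in> {a..b} \<Longrightarrow> (\<lambda>k. poly (p k) l) \<longlonglongrightarrow> indicator {..s} l"
    "\<And>k l. l \<in> {a..b} \<Longrightarrow> \<bar>poly (p k) l\<bar> \<le> 2"
proof -
  define h where "h k l = max 0 (min 1 (1 - real k * (l - s)))" for k l
  have "\<exists>p. \<forall>l\<in>{a..b}. \<bar>h k l - poly p l\<bar> < 1 / real (Suc k)" for k
  proof -
    have "continuous_on {a..b} (h k)" unfolding h_def by (intro continuous_intros)
    then obtain g where g: "real_polynomial_function g" "\<And>l. l \<in> {a..b} \<Longrightarrow> \<bar>h k l - g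
        l\<bar> < 1 / real (Suc k)"
      using Stone_Weierstrass_real_polynomial_function[of "{a..b}" "h k" "1 / real (Suc k)"] by auto
    then obtain c n where "g = (\<lambda>l. \<Sum>i\<le>n. c i * l ^ i)" using real_polynomial_function_iff_sum by metis
    then have "g l = poly (\<Sum>i\<le>n. monom (c i) i) l" for l by (simp add: poly_sum poly_monom)
    then show ?thesis using g(2) by (intro exI[of _ "\<Sum>i\<le>n. monom (c i) i"]) simp
  qed
  then obtain p where p: "\<And>k l. l \<in> {a..b} \<Longrightarrow> \<bar>h k l - poly (p k) l\<bar> < 1 / real (Suc
      k)" by metis
  have lim: "(\<lambda>k. poly (p k) l) \<longlonglongrightarrow> indicator {..s} l" if l: "l \<in> {a..b}" for l
  proof -
    have "(\<lambda>k. h k l) \<longlonglongrightarrow> indicator {..s} l"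
    proof (cases "l \<le> s")
      case True
      have "h k l = 1" for k using True mult_nonneg_nonpos[of "real k" "l - s"] by (simp add: h_def)
      then show ?thesis using True by simp
    next
      case False
      obtain N :: nat where N: "1 / (l - s) < real N" using reals_Archimedean2 by blast
      have "h k l = 0" if "k \<ge> N" for k
      proof -
        have "1 < real N * (l - s)" using N False by (simp add: field_simps)
        also have "\<dots> \<le> real k * (l - s)" using that False by (intro mult_right_mono) auto
        finally show ?thesis by (simp add: h_def)
      qed
      then have "eventually (\<lambda>k. h k l = indicator {..s} l) sequentially"
        using False unfolding eventually_sequentially by auto
      then show ?thesis by (rule tendsto_eventually)
    qed
    moreover have "(\<lambda>k. poly (p k) l - h k l) \<longlonglongrightarrow> 0"
    proof (rule Lim_null_comparison[OF always_eventually])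
      show "\<forall>k. norm (poly (p k) l - h k l) \<le> inverse (real (Suc k))"
        using p[OF l] by (metis abs_minus_commute inverse_eq_divide less_imp_le real_norm_def)
      show "(\<lambda>k. inverse (real (Suc k))) \<longlonglongrightarrow> 0" by (rule LIMSEQ_inverse_real_of_nat)
    qed
    ultimately have "(\<lambda>k. (poly (p k) l - h k l) + h k l) \<longlonglongrightarrow> 0 + indicator {..s} l" by
        (intro tendsto_add)
    then show ?thesis by simp
  qed
  have bound: "\<bar>poly (p k) l\<bar> \<le> 2" if "l \<in> {a..b}" for k l
  proof -
    have "\<bar>h k l\<bar> \<le> 1" "1 / real (Suc k) \<le> 1" by (auto simp: h_def)
    then show ?thesis using p[OF that, of k] by linarith
  qed
  show thesis by (rule that[of p]) (use lim bound in auto)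
qed

section \<open>The joint projection-valued measure of commuting positive contractions\<close>

context
  fixes X :: "'n::finite \<Rightarrow> 'h::complex_hilbert \<Rightarrow> 'h" and idx :: "'n list"
  assumes pos: "\<And>i. positive_op (X i)" and le1: "\<And>i \<xi>. X i \<xi> \<bullet> \<xi> \<le> \<xi> \<bullet> \<xi>"
    and comm: "\<And>i j \<xi>. X i (X j \<xi>) = X j (X i \<xi>)"
    and idx: "distinct idx" "set idx = UNIV"
begin

private lemma X: "selfadjoint_op (X i)" "bounded_clinear (X i)"
  using pos by (simp_all add: positive_op_iff selfadjoint_opD(1))

private lemma op_poly_comm: "op_poly (X i) p (op_poly (X j) q \<xi>) = op_poly (X j) q (op_poly (X i) p \<xi>)"
  by (intro op_poly_commute X bounded_clinear_op_poly op_poly_commute[OF X(2) X(2), symmetric] comm)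

text \<open>Only product polynomials occur: they are closed under multiplication, and orthant
  indicators are bounded limits of them on the cube.\<close>

private definition Op :: "('n \<Rightarrow> real poly) \<Rightarrow> 'h \<Rightarrow> 'h" where "Op p = op_prod idx
    (\<lambda>i. op_poly (X i) (p i))"

private definition Pl :: "('n \<Rightarrow> real poly) \<Rightarrow> real^'n \<Rightarrow> real" where "Pl p l =
    (\<Prod>i\<in>UNIV. poly (p i) (l $ i))"

private lemma Op_selfadjoint: "selfadjoint_op (Op p)"
  unfolding Op_def by (intro selfadjoint_op_prod selfadjoint_op_poly X op_poly_comm)

private lemma Op_mult: "Op p (Op q \<xi>) = Op (\<lambda>i. p i * q i) \<xi>"
proof -
  have "op_poly (X i) (p i * q i) = op_poly (X i) (p i) \<circ> op_poly (X i) (q i)" for i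
    by (auto simp: op_poly_mult X)
  then show ?thesis unfolding Op_def
    using op_prod_comp[of "\<lambda>i. op_poly (X i) (q i)" "\<lambda>i. op_poly (X i) (p i)" idx, OF op_poly_comm] by simp
qed

private lemma continuous_Pl: "continuous_on UNIV (Pl p)"
  unfolding Pl_def by (intro continuous_intros)

text \<open>The integral of a product polynomial over the grid measure \<open>M m\<close> is the
  diagonal value of the product of its one-variable Bernstein operators. These converge in norm on
  each coordinate, so every weak limit of the \<open>M m\<close> has the required moments.\<close>

lemma moment_measure_unit:
  assumes \<xi>: "norm \<xi> = 1"
  shows "\<exists>\<mu>. prob_space \<mu> \<and> sets \<mu> = sets borel \<and> (AE l in \<mu>. l \<in> cbox 0 1) \<and>
    (\<forall>p. (\<integral>l. Pl p l \<partial>\<mu>) = Op p \<xi> \<bullet> \<xi>)"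
proof -
  define W where "W m i j = op_poly (X i) (bernstein_poly m j)" for m i j
  define K where "K m = PiE (UNIV::'n set) (\<lambda>_. {..m::nat})" for m
  define w where "w m k = op_prod idx (\<lambda>i. W m i (k i)) \<xi> \<bullet> \<xi>" for m k
  define atom :: "nat \<Rightarrow> ('n \<Rightarrow> nat) \<Rightarrow> real^'n" where "atom m k = (\<chi> i. real (k
      i) / real m)" for m k
  have K: "finite (K m)" for m unfolding K_def by (intro finite_PiE) auto
  have Wc: "bounded_clinear (W m i j)" for m i j unfolding W_def by (intro bounded_clinear_op_poly X)
  \<comment> \<open>The coordinates are added one at a time, with the product so far as the
    accumulator \<open>b\<close> of the positivity lemma.\<close>
  have "positive_op (op_prod js (\<lambda>i. W m i (k i)))" for js m k
  proof (induction js)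
    case Nil
    then show ?case by (simp add: positive_op_def cinner_self)
  next
    case (Cons i js)
    have "op_prod js (\<lambda>i. W m i (k i)) (X i \<xi>) = X i (op_prod js (\<lambda>i. W m i (k i)) \<xi>)" for \<xi>
      unfolding W_def by (intro op_prod_commute[symmetric] op_poly_commute X comm)
    then show ?case unfolding op_prod_simps unfolding W_def
      by (intro op_poly_bernstein_positive[OF pos le1 Cons[unfolded W_def]]) (simp add: W_def)
  qed
  then have w0: "0 \<le> w m k" for m k unfolding w_def by (auto simp: positive_op_iff Re_cinner)
  have sum_w: "(\<Sum>k\<in>K m. (\<Prod>i\<in>UNIV. c i (k i)) * w m k) = op_prod idx (\<lambda>i \<zeta>.
      \<Sum>j\<le>m. c i j *\<^sub>R W m i j \<zeta>) \<xi> \<bullet> \<xi>"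
    for m and c :: "'n \<Rightarrow> nat \<Rightarrow> real"
    using sum_PiE_op_prod[of "W m" idx "{..m}" c \<xi>, OF Wc idx(1)]
    unfolding idx(2) K_def[symmetric] w_def by (simp add: inner_sum_left[symmetric] inner_scaleR_left[symmetric] del:
        inner_scaleR_left)
  define S where "S p m i = (\<lambda>\<zeta>. \<Sum>j\<le>m. poly (p i) (real j / real m) *\<^sub>R W m i j \<zeta>)"
      for p :: "'n \<Rightarrow> real poly" and m i
  define M where "M m = distr (point_measure (K m) (\<lambda>k. ennreal (w m k))) borel (atom m)" for m
  have meas: "atom m \<in> measurable (point_measure (K m) (\<lambda>k. ennreal (w m k))) borel" for m
    by (simp add: measurable_point_measure_eq1)
  have int: "(\<integral>l. f l \<partial>M m) = (\<Sum>k\<in>K m. f (atom m k) * w m k)" if "f \<in> borel_measurable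
      borel" for f :: "real^'n \<Rightarrow> real" and m
    unfolding M_def integral_distr[OF meas that]
    by (subst lebesgue_integral_point_measure_finite) (auto simp: K w0 mult.commute)
  have intP: "(\<integral>l. Pl p l \<partial>M m) = op_prod idx (S p m) \<xi> \<bullet> \<xi>" for p m
    unfolding S_def sum_w[symmetric] int[OF borel_measurable_continuous_onI[OF continuous_Pl]]
    by (simp add: Pl_def atom_def)
  have lim: "(\<lambda>m. \<integral>l. Pl p l \<partial>M m) \<longlonglongrightarrow> Op p \<xi> \<bullet> \<xi>" for p
  proof -
    have "\<exists>\<epsilon>. \<epsilon> \<longlonglongrightarrow> 0 \<and> (\<exists>N. \<forall>m\<ge>N.
        \<forall>\<zeta>. norm (S p m i \<zeta> - op_poly (X i) (p i) \<zeta>) \<le> \<epsilon> m * norm \<zeta>)" for i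
      unfolding S_def W_def by (rule op_poly_bernstein_approx[OF pos le1])
    then obtain \<epsilon> where \<epsilon>: "\<And>i. \<epsilon> i \<longlonglongrightarrow> 0"
      "\<And>i. \<exists>N. \<forall>m\<ge>N. \<forall>\<zeta>. norm (S p m i \<zeta> - op_poly (X i) (p i) \<zeta>)
          \<le> \<epsilon> i m * norm \<zeta>" by metis
    show ?thesis unfolding intP Op_def
      by (intro tendsto_intros op_prod_tendsto[OF \<epsilon>] bounded_clinear_op_poly X)
  qed
  have prob: "prob_space (M m)" for m
  proof -
    have W1: "(\<Sum>j\<le>m. 1 *\<^sub>R W m i j \<zeta>) = \<zeta>" for i \<zeta>
    proof -
      have "(\<Sum>j\<le>m. bernstein_poly m j) = 1" using sum_choose_bernstein_poly[of 0 m] by simp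
      from arg_cong[OF this, of "\<lambda>p. op_poly (X i) p \<zeta>"] show ?thesis
        by (simp add: W_def op_poly_sum X op_poly_1)
    qed
    have "op_prod js (\<lambda>i \<zeta>. \<zeta>) \<zeta> = \<zeta>" for js :: "'n list" and \<zeta> :: 'h by
        (induction js) auto
    then have "(\<Sum>k\<in>K m. w m k) = 1"
      using sum_w[of "\<lambda>_ _. 1" m] \<xi> unfolding W1 by (simp add: dot_square_norm)
    then have "emeasure (point_measure (K m) (\<lambda>k. ennreal (w m k))) (K m) = 1"
      by (simp add: emeasure_point_measure_finite[OF K] sum_ennreal w0)
    then have "prob_space (point_measure (K m) (\<lambda>k. ennreal (w m k)))"
      by (intro prob_spaceI) (simp add: space_point_measure)
    then show ?thesis unfolding M_def by (rule prob_space.prob_space_distr[OF _ meas])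
  qed
  have sets: "sets (M m) = sets borel" for m by (simp add: M_def)
  have supp: "AE l in M m. l \<in> cbox 0 1" for m
    unfolding M_def
  proof (subst AE_distr_iff[OF meas])
    show "{x \<in> space borel. x \<in> cbox 0 (1::real^'n)} \<in> sets borel" by simp
    have "atom m k \<in> cbox 0 1" if "k \<in> K m" for k
    proof -
      have "k i \<le> m" for i using that by (auto simp: K_def)
      \<comment> \<open>For \<open>m = 0\<close> the quotient is 0 by the convention on division, so
        the single atom is still in the cube.\<close>
      then have "real (k i) / real m \<le> 1" for i
        by (cases "m = 0") (auto simp: divide_le_eq_1)
      then show ?thesis by (auto simp: mem_box_cart atom_def)
    qed
    then show "AE k in point_measure (K m) (\<lambda>k. ennreal (w m k)). atom m k \<in> cbox 0 1"
      by (intro AE_I2) (simp add: space_point_measure)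
  qed
  obtain r \<mu> where r: "strict_mono (r :: nat \<Rightarrow> nat)" and \<mu>: "prob_space \<mu>" "sets \<mu> = sets
      borel" "AE l in \<mu>. l \<in> cbox 0 1"
    and conv: "\<And>\<phi> :: real^'n \<Rightarrow> real. continuous_on UNIV \<phi> \<Longrightarrow> (\<lambda>k.
        \<integral>l. \<phi> l \<partial>M (r k)) \<longlonglongrightarrow> (\<integral>l. \<phi> l \<partial>\<mu>)"
    using prob_measures_cbox_weakly_compact[of M 0 1, OF prob sets supp] by metis
  have "(\<integral>l. Pl p l \<partial>\<mu>) = Op p \<xi> \<bullet> \<xi>" for p
    using LIMSEQ_unique[OF conv[OF continuous_Pl] LIMSEQ_subseq_LIMSEQ[OF lim r, unfolded o_def]] .
  then show ?thesis using \<mu> by blast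
qed

private definition mom :: "'h \<Rightarrow> (real^'n) measure \<Rightarrow> bool" where
  "mom \<xi> \<mu> \<longleftrightarrow> finite_measure \<mu> \<and> sets \<mu> = sets borel \<and> (AE l in \<mu>. l
      \<in> cbox 0 1) \<and>
    (\<forall>p. (\<integral>l. Pl p l \<partial>\<mu>) = Op p \<xi> \<bullet> \<xi>)"

text \<open>Both sides scale with the square of the norm, which reduces to unit vectors; the zero
  vector receives the zero measure.\<close>

lemma moment_measure: "\<exists>\<mu>. mom \<xi> \<mu>"
proof (cases "\<xi> = 0")
  case True
  define \<nu> where "\<nu> = density (return borel (0::real^'n)) (\<lambda>_. 0)"
  have "(\<integral>l. Pl p l \<partial>\<nu>) = 0" for p
    unfolding \<nu>_def using borel_measurable_continuous_onI[OF continuous_Pl, of p]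
    by (subst integral_density[where g="\<lambda>_. 0", unfolded ennreal_0]) auto
  moreover have "AE l in \<nu>. l \<in> cbox 0 1" unfolding \<nu>_def by (subst AE_density) auto
  ultimately have "mom \<xi> \<nu>"
    unfolding mom_def using True bounded_clinearD(5)[OF selfadjoint_opD(1)[OF Op_selfadjoint]]
    by (auto simp: \<nu>_def AE_density emeasure_density intro!: finite_measureI)
  then show ?thesis by blast
next
  case False
  define u where "u = (1 / norm \<xi>) *\<^sub>R \<xi>"
  have u: "norm u = 1" "\<xi> = norm \<xi> *\<^sub>R u" using False by (auto simp: u_def)
  obtain \<mu> where \<mu>: "prob_space \<mu>" "sets \<mu> = sets borel" "AE l in \<mu>. l \<in> cbox 0 1"
    "\<And>p. (\<integral>l. Pl p l \<partial>\<mu>) = Op p u \<bullet> u" using moment_measure_unit[OF u(1)] by blast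
  have [measurable_cong]: "sets \<mu> = sets borel" by fact
  interpret prob_space \<mu> by fact
  define \<nu> where "\<nu> = density \<mu> (\<lambda>_. ennreal ((norm \<xi>)\<^sup>2))"
  have "finite_measure \<nu>"
    unfolding \<nu>_def by (rule finite_measureI) (auto simp: emeasure_density nn_integral_const
        ennreal_mult_eq_top_iff emeasure_eq_measure)
  moreover have "(\<integral>l. Pl p l \<partial>\<nu>) = Op p \<xi> \<bullet> \<xi>" for p
  proof -
    have [measurable]: "Pl p \<in> borel_measurable borel" by (rule borel_measurable_continuous_onI[OF continuous_Pl])
    have "(\<integral>l. Pl p l \<partial>\<nu>) = (\<integral>l. (norm \<xi>)\<^sup>2 *\<^sub>R Pl p l \<partial>\<mu>)"
      unfolding \<nu>_def by (rule integral_density) auto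
    also have "\<dots> = (norm \<xi>)\<^sup>2 * (Op p u \<bullet> u)" by (simp add: \<mu>(4))
    also have "\<dots> = Op p (norm \<xi> *\<^sub>R u) \<bullet> (norm \<xi> *\<^sub>R u)"
      using bounded_clinearD(7)[OF selfadjoint_opD(1)[OF Op_selfadjoint]] by (simp add: power2_eq_square)
    finally show ?thesis using u(2) by simp
  qed
  moreover have "AE l in \<nu>. l \<in> cbox 0 1"
    unfolding \<nu>_def by (subst AE_density) (use \<mu>(3) in auto)
  moreover have "sets \<nu> = sets borel" by (simp add: \<nu>_def \<mu>(2))
  ultimately have "mom \<xi> \<nu>" by (simp add: mom_def)
  then show ?thesis by blast
qed


text \<open>The choice is made for each vector separately. That the measure of a fixed set is a
  quadratic form in the vector is not built in; it is recovered through the relation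
  \<open>R\<close>.\<close>

private definition \<mu> :: "'h \<Rightarrow> (real^'n) measure" where "\<mu> \<xi> = (SOME m. mom \<xi> m)"

private lemma \<mu>: "finite_measure (\<mu> \<xi>)" "sets (\<mu> \<xi>) = sets borel" "AE l in \<mu> \<xi>. l \<in> cbox 0 1"
  "(\<integral>l. Pl p l \<partial>\<mu> \<xi>) = Op p \<xi> \<bullet> \<xi>"
proof -
  have "mom \<xi> (\<mu> \<xi>)" unfolding \<mu>_def by (rule someI_ex[OF moment_measure])
  then show "finite_measure (\<mu> \<xi>)" "sets (\<mu> \<xi>) = sets borel" "AE l in \<mu> \<xi>. l \<in> cbox 0 1"
    "(\<integral>l. Pl p l \<partial>\<mu> \<xi>) = Op p \<xi> \<bullet> \<xi>" by (simp_all add: mom_def)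
qed

private lemma space_\<mu>: "space (\<mu> \<xi>) = UNIV"
  using sets_eq_imp_space_eq[OF \<mu>(2)] by simp

private lemma Op_1: "Op (\<lambda>_. 1) = id"
proof -
  have "op_prod js (\<lambda>i. op_poly (X i) 1) \<zeta> = \<zeta>" for js \<zeta> by (induction js arbitrary: \<zeta>)
      (auto simp: X op_poly_1)
  then show ?thesis by (auto simp: Op_def)
qed

private lemma measure_\<mu>: "measure (\<mu> \<xi>) UNIV = (norm \<xi>)\<^sup>2"
  using \<mu>(4)[where p="\<lambda>_. 1" and \<xi>=\<xi>] by (simp add: Pl_def Op_1 space_\<mu> dot_square_norm)

text \<open>Stands for "\<open>T\<close> is the integral of \<open>f\<close>" before a
  projection-valued measure is at hand: one operator must have all the integrals as its
  diagonal.\<close>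

private definition R :: "(real^'n \<Rightarrow> real) \<Rightarrow> ('h \<Rightarrow> 'h) \<Rightarrow> bool" where
  "R f T \<longleftrightarrow> bounded_clinear T \<and> (\<forall>\<xi>. cinner (T \<xi>) \<xi> = of_real
      (\<integral>l. f l \<partial>\<mu> \<xi>))"

private lemma R_selfadjoint: "R f T \<Longrightarrow> selfadjoint_op T"
  unfolding R_def by (rule selfadjoint_opI_real) auto

private lemma R_unique: "R f T \<Longrightarrow> R f T' \<Longrightarrow> T = T'"
  unfolding R_def by (rule clinear_eqI) auto

private lemma R_Pl: "R (Pl p) (Op p)"
  unfolding R_def using Op_selfadjoint[of p]
  by (metis \<mu>(4) Re_cinner selfadjoint_opD(1,3))

private lemma integrable_\<mu>:
  fixes f :: "real^'n \<Rightarrow> real"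
  assumes f: "f \<in> borel_measurable borel" "\<And>l. l \<in> cbox 0 1 \<Longrightarrow> \<bar>f l\<bar> \<le> B"
  shows "integrable (\<mu> \<xi>) f" "\<bar>\<integral>l. f l \<partial>\<mu> \<xi>\<bar> \<le> B * (norm \<xi>)\<^sup>2"
proof -
  interpret finite_measure "\<mu> \<xi>" by (rule \<mu>(1))
  have [measurable_cong]: "sets (\<mu> \<xi>) = sets borel" by (rule \<mu>(2))
  have AE: "AE l in \<mu> \<xi>. \<bar>f l\<bar> \<le> B" using \<mu>(3)[of \<xi>] f(2) by (auto elim: eventually_mono)
  show int: "integrable (\<mu> \<xi>) f" using AE f(1) by (intro integrable_const_bound[of _ B]) auto
  have "\<bar>\<integral>l. f l \<partial>\<mu> \<xi>\<bar> \<le> (\<integral>l. \<bar>f l\<bar> \<partial>\<mu>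
      \<xi>)" by (rule integral_abs_bound)
  also have "\<dots> \<le> (\<integral>l. B \<partial>\<mu> \<xi>)" using int AE by (intro integral_mono_AE) auto
  also have "\<dots> = B * (norm \<xi>)\<^sup>2" by (simp add: space_\<mu> measure_\<mu>)
  finally show "\<bar>\<integral>l. f l \<partial>\<mu> \<xi>\<bar> \<le> B * (norm \<xi>)\<^sup>2" .
qed

text \<open>Bounded pointwise limits on the cube preserve representability: dominated convergence
  gives the diagonals, and the bound on the numerical ranges is a uniform norm bound, so the
  operators converge weakly.\<close>

private lemma R_limit:
  assumes R: "\<And>k::nat. R (f k) (T k)" and f: "\<And>k. f k \<in> borel_measurable borel"
    and B: "\<And>k l. l \<in> cbox 0 1 \<Longrightarrow> \<bar>f k l\<bar> \<le> B"
    and g: "g \<in> borel_measurable borel" and lim: "\<And>l. l \<in> cbox 0 1 \<Longrightarrow> (\<lambda>k. f k l)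
        \<longlonglongrightarrow> g l"
  obtains S where "R g S" "\<And>\<xi> \<eta>. (\<lambda>k. cinner (T k \<xi>) \<eta>) \<longlonglongrightarrow> cinner
      (S \<xi>) \<eta>"
proof -
  have int: "(\<lambda>k. \<integral>l. f k l \<partial>\<mu> \<xi>) \<longlonglongrightarrow> (\<integral>l. g l
      \<partial>\<mu> \<xi>)" for \<xi>
  proof -
    interpret finite_measure "\<mu> \<xi>" by (rule \<mu>(1))
    have [measurable_cong]: "sets (\<mu> \<xi>) = sets borel" by (rule \<mu>(2))
    show ?thesis
      by (rule integral_dominated_convergence[where w="\<lambda>_. B"])
        (use f g \<mu>(3)[of \<xi>] B lim in \<open>auto elim: eventually_mono\<close>)
  qed
  then have conv: "(\<lambda>k. cinner (T k \<xi>) \<xi>) \<longlonglongrightarrow> of_real (\<integral>l. g l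
      \<partial>\<mu> \<xi>)" for \<xi>
    using R unfolding R_def by (simp add: tendsto_of_real)
  have norm: "norm (T k \<xi>) \<le> B * norm \<xi>" for k \<xi>
  proof (rule selfadjoint_op_norm_bound[OF R_selfadjoint[OF R]])
    show "\<bar>Re (cinner (T k \<xi>) \<xi>)\<bar> \<le> B * (norm \<xi>)\<^sup>2" for \<xi>
      using integrable_\<mu>(2)[OF f B, where \<xi>=\<xi>] R unfolding R_def by simp
  qed
  obtain S where S: "bounded_clinear S" "\<And>\<xi> \<eta>. (\<lambda>k. cinner (T k \<xi>) \<eta>)
      \<longlonglongrightarrow> cinner (S \<xi>) \<eta>"
  proof (rule weak_limit_operator[of T B])
    show "bounded_clinear (T k)" for k using R by (simp add: R_def)
    show "convergent (\<lambda>k. cinner (T k \<xi>) \<xi>)" for \<xi> using conv by (auto simp: convergent_def)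
  qed (use norm in auto)
  have "R g S" unfolding R_def using S LIMSEQ_unique[OF S(2) conv] by blast
  then show thesis using S(2) by (rule that)
qed

text \<open>The form for a candidate \<open>S\<close> known in advance: weak limits are unique, so
  convergence on the diagonal identifies it.\<close>

private lemma R_limitI:
  assumes "\<And>k::nat. R (f k) (T k)" "\<And>k. f k \<in> borel_measurable borel"
    "\<And>k l. l \<in> cbox 0 1 \<Longrightarrow> \<bar>f k l\<bar> \<le> B"
    "g \<in> borel_measurable borel" "\<And>l. l \<in> cbox 0 1 \<Longrightarrow> (\<lambda>k. f k l)
        \<longlonglongrightarrow> g l"
    and S: "bounded_clinear S" "\<And>\<xi>. (\<lambda>k. cinner (T k \<xi>) \<xi>) \<longlonglongrightarrow> cinner (S
        \<xi>) \<xi>"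
  shows "R g S"
proof -
  obtain S' where S': "R g S'" "\<And>\<xi> \<eta>. (\<lambda>k. cinner (T k \<xi>) \<eta>) \<longlonglongrightarrow>
      cinner (S' \<xi>) \<eta>"
    using R_limit[of f T B g] assms by blast
  have "S = S'"
    by (rule clinear_eqI[OF S(1)]) (use S'(1) LIMSEQ_unique[OF S(2) S'(2)] in \<open>auto simp: R_def\<close>)
  then show ?thesis using S'(1) by simp
qed

private lemma orthant_polys:
  obtains p where "\<And>k l. l \<in> cbox 0 1 \<Longrightarrow> \<bar>Pl (p k) l\<bar> \<le> 2 ^ CARD('n)"
    "\<And>l. l \<in> cbox 0 1 \<Longrightarrow> (\<lambda>k::nat. Pl (p k) l) \<longlonglongrightarrow> indicator {..s} l"
proof -
  have "\<exists>p :: nat \<Rightarrow> real poly. (\<forall>l\<in>{0..1}. (\<lambda>k. poly (p k) l)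
      \<longlonglongrightarrow> indicator {..s $ i} l) \<and>
     (\<forall>k. \<forall>l\<in>{0..1}. \<bar>poly (p k) l\<bar> \<le> 2)" for i
    by (rule polys_tendsto_indicator_atMost[of 0 1 "s $ i"]) blast
  then obtain p :: "'n \<Rightarrow> nat \<Rightarrow> real poly" where
    p: "\<And>i l. l \<in> {0..1} \<Longrightarrow> (\<lambda>k. poly (p i k) l) \<longlonglongrightarrow> indicator
        {..s $ i} l"
    "\<And>i k l. l \<in> {0..1} \<Longrightarrow> \<bar>poly (p i k) l\<bar> \<le> 2" by metis
  have cube: "l $ i \<in> {0..1}" if "l \<in> cbox 0 1" for l :: "real^'n" and i
    using that by (simp add: mem_box_cart)
  have ind: "indicator {..s} l = (\<Prod>i\<in>UNIV. indicator {..s $ i} (l $ i) :: real)" for l :: "real^'n"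
    by (auto simp: indicator_def less_eq_vec_def prod_zero_iff)
  show thesis
  proof (rule that[of "\<lambda>k i. p i k"])
    fix k and l :: "real^'n" assume "l \<in> cbox 0 1"
    then have "(\<Prod>i\<in>UNIV. \<bar>poly (p i k) (l $ i)\<bar>) \<le> (\<Prod>i\<in>(UNIV::'n set). 2)"
      using p(2) cube by (intro prod_mono) auto
    then show "\<bar>Pl (\<lambda>i. p i k) l\<bar> \<le> 2 ^ CARD('n)" by (simp add: Pl_def abs_prod)
  next
    fix l :: "real^'n" assume "l \<in> cbox 0 1"
    then show "(\<lambda>k. Pl (\<lambda>i. p i k) l) \<longlonglongrightarrow> indicator {..s} l"
      unfolding ind Pl_def using p(1) cube by (intro tendsto_prod) auto
  qed
qed

private lemma meas_Pl [measurable]: "Pl p \<in> borel_measurable borel"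
  by (rule borel_measurable_continuous_onI[OF continuous_Pl])

private lemma meas_orthant [measurable]: "{..s::real^'n} \<in> sets borel"
  by simp

private lemma R_zero: "R (\<lambda>_. 0) (\<lambda>_. 0)"
  by (simp add: R_def)

private lemma R_empty: "R (indicator {}) (\<lambda>_. 0)"
proof -
  have "(indicator {} :: real^'n \<Rightarrow> real) = (\<lambda>_. 0)" by auto
  then show ?thesis using R_zero by simp
qed

private lemma R_one: "R (\<lambda>_. 1) id"
  by (simp add: R_def space_\<mu> measure_\<mu> cinner_self)

private lemma R_diff:
  assumes "R f S" "R g T" "\<And>\<xi>. integrable (\<mu> \<xi>) f" "\<And>\<xi>. integrable (\<mu> \<xi>) g"
  shows "R (\<lambda>l. f l - g l) (\<lambda>\<xi>. S \<xi> - T \<xi>)"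
  using assms by (simp add: R_def bounded_clinear_diff cinner_diff_left)

private lemma integrable_indicator_\<mu>:
  assumes "S \<in> sets borel"
  shows "integrable (\<mu> \<xi>) (indicator S :: _ \<Rightarrow> real)"
  by (rule integrable_\<mu>(1)[of _ 1]) (use assms in \<open>auto simp: indicator_def\<close>)

private lemma abs_indicator_le_1: "\<bar>indicator S l :: real\<bar> \<le> 1"
  by (simp add: indicator_def)

private lemma R_sum_indicator:
  assumes R: "\<And>i. R (indicator (A i)) (T i)" and A: "\<And>i::nat. A i \<in> sets borel" and disj: "disjoint_family A"
  shows "R (indicator (\<Union>i<k. A i)) (\<lambda>\<xi>. \<Sum>i<k. T i \<xi>)"
proof -
  have eq: "(indicator (\<Union>i<k. A i) :: _ \<Rightarrow> real) = (\<lambda>l. \<Sum>i<k. indicator (A i) l)"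
    using disj by (intro ext indicator_UN_disjoint) (auto simp: disjoint_family_on_def)
  have "(\<integral>l. (\<Sum>i<k. indicator (A i) l) \<partial>\<mu> \<xi>) = (\<Sum>i<k. \<integral>l. indicator (A
      i) l \<partial>\<mu> \<xi> :: real)" for \<xi>
    by (intro Bochner_Integration.integral_sum integrable_indicator_\<mu> A)
  then show ?thesis
    using R unfolding eq R_def by (auto simp: cinner_sum_left intro!: bounded_clinear_sum)
qed

private lemma indicator_union_tendsto: "(\<lambda>k. indicator (\<Union>i<k. A i) l :: real) \<longlonglongrightarrow>
    indicator (\<Union>i::nat. A i) l"
  by (rule LIMSEQ_indicator_UN)

text \<open>Orthants are reached by polynomials. Complements and disjoint unions stay within the
  reach of \<open>R\<close>, as a difference from the identity and as limits of partial
  sums.\<close>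

private lemma indicator_operator:
  assumes "S \<in> sets borel"
  shows "\<exists>T. R (indicator S) T"
  using assms
proof (induction rule: borel_induct_orthants)
  case (orthant s)
  obtain p where p: "\<And>k l. l \<in> cbox 0 1 \<Longrightarrow> \<bar>Pl (p k) l\<bar> \<le> 2 ^ CARD('n)"
    "\<And>l. l \<in> cbox 0 1 \<Longrightarrow> (\<lambda>k::nat. Pl (p k) l) \<longlonglongrightarrow> indicator
        {..s} l" by (rule orthant_polys[of s]) blast
  show ?case
    by (rule R_limit[of "\<lambda>k. Pl (p k)" "\<lambda>k. Op (p k)" "2 ^ CARD('n)" "indicator {..s}", OF R_Pl meas_Pl
        p(1) _ p(2)])
      auto
next
  case empty
  then show ?case using R_empty by blast
next
  case (compl A)
  then obtain T where T: "R (indicator A) T" by blast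
  have "R (\<lambda>l. 1 - indicator A l) (\<lambda>\<xi>. id \<xi> - T \<xi>)"
    using integrable_\<mu>(1)[of "\<lambda>_. 1" 1] by (intro R_diff[OF R_one T] integrable_indicator_\<mu> compl) auto
  moreover have "(\<lambda>l. 1 - indicator A l :: real) = indicator (- A)" by (auto simp: indicator_def)
  ultimately show ?case by auto
next
  case (union A)
  then obtain T where T: "\<And>i. R (indicator (A i)) (T i)" by metis
  have A: "A i \<in> sets borel" for i using union by auto
  show ?case
    by (rule R_limit[OF R_sum_indicator[OF T A union(1)] _ _ _ indicator_union_tendsto, of 1])
      (use A in \<open>auto simp: indicator_def\<close>)
qed

private definition E :: "(real^'n) set \<Rightarrow> 'h \<Rightarrow> 'h" where
  "E S = (if S \<in> sets borel then SOME T. R (indicator S) T else (\<lambda>_. 0))"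

private lemma R_E: "S \<in> sets borel \<Longrightarrow> R (indicator S) (E S)"
  unfolding E_def using someI_ex[OF indicator_operator] by simp

private lemma E_eqI: "S \<in> sets borel \<Longrightarrow> R (indicator S) T \<Longrightarrow> E S = T"
  using R_unique R_E by blast

private lemma E_clinear: "S \<in> sets borel \<Longrightarrow> bounded_clinear (E S)"
  using R_E by (auto simp: R_def)

private lemma E_orthant:
  obtains p where "\<And>k l. l \<in> cbox 0 1 \<Longrightarrow> \<bar>Pl (p k) l\<bar> \<le> 2 ^ CARD('n)"
    "\<And>l. l \<in> cbox 0 1 \<Longrightarrow> (\<lambda>k::nat. Pl (p k) l) \<longlonglongrightarrow> indicator {..s} l"
    "\<And>\<xi> \<eta>. (\<lambda>k. cinner (Op (p k) \<xi>) \<eta>) \<longlonglongrightarrow> cinner (E {..s} \<xi>)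
        \<eta>"
proof -
  obtain p where p: "\<And>k l. l \<in> cbox 0 1 \<Longrightarrow> \<bar>Pl (p k) l\<bar> \<le> 2 ^ CARD('n)"
    "\<And>l. l \<in> cbox 0 1 \<Longrightarrow> (\<lambda>k::nat. Pl (p k) l) \<longlonglongrightarrow> indicator
        {..s} l" by (rule orthant_polys[of s]) blast
  obtain S where "R (indicator {..s}) S" "\<And>\<xi> \<eta>. (\<lambda>k. cinner (Op (p k) \<xi>) \<eta>)
      \<longlonglongrightarrow> cinner (S \<xi>) \<eta>"
    by (rule R_limit[of "\<lambda>k. Pl (p k)" "\<lambda>k. Op (p k)" "2 ^ CARD('n)" "indicator {..s}", OF R_Pl meas_Pl
        p(1) _ p(2)])
      auto
  then show thesis using p E_eqI[of "{..s}" S] by (intro that[of p]) auto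
qed

private lemma Pl_bounded:
  obtains B where "\<And>l. l \<in> cbox 0 1 \<Longrightarrow> \<bar>Pl p l\<bar> \<le> B" "B \<ge> 0"
proof -
  have "compact (Pl p ` cbox 0 1)"
    by (intro compact_continuous_image continuous_on_subset[OF continuous_Pl]) auto
  then obtain B where "\<And>l. l \<in> cbox 0 1 \<Longrightarrow> \<bar>Pl p l\<bar> \<le> B"
    unfolding compact_eq_bounded_closed bounded_iff by auto
  then show thesis by (intro that[of "max B 0"]) force+
qed

text \<open>Products of two weakly convergent sequences need not converge to the product of the
  limits. Multiplicativity is therefore passed to the limit in one factor at a time, with a fixed
  polynomial on the right.\<close>

private lemma E_orthant_Op: "R (\<lambda>l. indicator {..s} l * Pl q l) (E {..s} \<circ> Op q)"
proof -
  obtain p where p: "\<And>k l. l \<in> cbox 0 1 \<Longrightarrow> \<bar>Pl (p k) l\<bar> \<le> 2 ^ CARD('n)"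
    "\<And>l. l \<in> cbox 0 1 \<Longrightarrow> (\<lambda>k::nat. Pl (p k) l) \<longlonglongrightarrow> indicator {..s} l"
    "\<And>\<xi> \<eta>. (\<lambda>k. cinner (Op (p k) \<xi>) \<eta>) \<longlonglongrightarrow> cinner (E {..s} \<xi>)
        \<eta>" by (rule E_orthant[of s]) blast
  obtain B where B: "\<And>l. l \<in> cbox 0 1 \<Longrightarrow> \<bar>Pl q l\<bar> \<le> B" "B \<ge> 0" by (rule
      Pl_bounded[of q]) blast
  show ?thesis
  proof (rule R_limitI[of "\<lambda>k. Pl (\<lambda>i. p k i * q i)" "\<lambda>k. Op (\<lambda>i. p k i * q i)" "2 ^
      CARD('n) * B"])
    show "\<bar>Pl (\<lambda>i. p k i * q i) l\<bar> \<le> 2 ^ CARD('n) * B" if "l \<in> cbox 0 1" for k l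
      using p(1)[OF that, of k] B(1)[OF that] by (simp add: Pl_def prod.distrib abs_mult mult_mono)
    show "(\<lambda>k. Pl (\<lambda>i. p k i * q i) l) \<longlonglongrightarrow> indicator {..s} l * Pl q l" if "l
        \<in> cbox 0 1" for l
      using tendsto_mult_right[OF p(2)[OF that], of "Pl q l"] by (simp add: Pl_def prod.distrib)
    show "bounded_clinear (E {..s} \<circ> Op q)"
      by (intro bounded_clinear_comp E_clinear selfadjoint_opD(1)[OF Op_selfadjoint]) simp
    show "(\<lambda>k. cinner (Op (\<lambda>i. p k i * q i) \<xi>) \<xi>) \<longlonglongrightarrow> cinner ((E {..s}
        \<circ> Op q) \<xi>) \<xi>" for \<xi>
      using p(3)[of "Op q \<xi>" \<xi>] by (simp add: Op_mult)
  qed (auto intro: R_Pl)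
qed

text \<open>Now the second factor moves. The fixed projection is self-adjoint and is transferred to
  the other vector, so weak convergence of the polynomials suffices.\<close>

private lemma E_orthant_orthant: "R (indicator ({..s} \<inter> {..t})) (E {..s} \<circ> E {..t})"
proof -
  obtain q where q: "\<And>k l. l \<in> cbox 0 1 \<Longrightarrow> \<bar>Pl (q k) l\<bar> \<le> 2 ^ CARD('n)"
    "\<And>l. l \<in> cbox 0 1 \<Longrightarrow> (\<lambda>k::nat. Pl (q k) l) \<longlonglongrightarrow> indicator {..t} l"
    "\<And>\<xi> \<eta>. (\<lambda>k. cinner (Op (q k) \<xi>) \<eta>) \<longlonglongrightarrow> cinner (E {..t} \<xi>)
        \<eta>" by (rule E_orthant[of t]) blast
  note sa = R_selfadjoint[OF R_E[OF meas_orthant[of s]]]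
  show ?thesis
  proof (rule R_limitI[OF E_orthant_Op, of _ q "2 ^ CARD('n)"])
    show "\<bar>indicator {..s} l * Pl (q k) l\<bar> \<le> 2 ^ CARD('n)" if "l \<in> cbox 0 1" for k l
      using q(1)[OF that, of k] by (simp add: indicator_def)
    show "(\<lambda>k. indicator {..s} l * Pl (q k) l) \<longlonglongrightarrow> indicator ({..s} \<inter> {..t}) l" if
        "l \<in> cbox 0 1" for l
      unfolding indicator_inter_arith by (intro tendsto_intros q that)
    show "bounded_clinear (E {..s} \<circ> E {..t})" by (intro bounded_clinear_comp E_clinear) auto
    show "(\<lambda>k. cinner ((E {..s} \<circ> Op (q k)) \<xi>) \<xi>) \<longlonglongrightarrow> cinner ((E {..s}
        \<circ> E {..t}) \<xi>) \<xi>" for \<xi>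
      using q(3)[of \<xi> "E {..s} \<xi>"] by (simp add: selfadjoint_opD(2)[OF sa])
  qed auto
qed

private lemma E_compl: "A \<in> sets borel \<Longrightarrow> E (- A) = (\<lambda>\<xi>. \<xi> - E A \<xi>)"
proof (rule E_eqI)
  assume A: "A \<in> sets borel"
  have "R (\<lambda>l. 1 - indicator A l) (\<lambda>\<xi>. id \<xi> - E A \<xi>)"
    using integrable_\<mu>(1)[of "\<lambda>_. 1" 1] by (intro R_diff[OF R_one R_E[OF A]] integrable_indicator_\<mu> A) auto
  moreover have "(\<lambda>l. 1 - indicator A l :: real) = indicator (- A)" by (auto simp: indicator_def)
  ultimately show "R (indicator (- A)) (\<lambda>\<xi>. \<xi> - E A \<xi>)" by simp
qed auto

text \<open>One set runs through the Borel sets while the other stays fixed; each step of the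
  induction is linear or a weak limit in the left factor.\<close>

private lemma E_Int_induct:
  assumes S: "S \<in> sets borel" and B: "B \<in> sets borel"
    and orth: "\<And>s. R (indicator ({..s} \<inter> B)) (E {..s} \<circ> E B)"
  shows "R (indicator (S \<inter> B)) (E S \<circ> E B)"
  using S
proof (induction rule: borel_induct_orthants)
  case (orthant s)
  show ?case by (rule orth)
next
  case empty
  have "E {} = (\<lambda>_. 0)" by (rule E_eqI[OF _ R_empty]) simp
  then show ?case by (simp add: o_def R_zero)
next
  case (compl A)
  have "R (\<lambda>l. indicator B l - indicator (A \<inter> B) l) (\<lambda>\<xi>. E B \<xi> - (E A \<circ> E B) \<xi>)"
    by (intro R_diff R_E integrable_indicator_\<mu> compl B sets.Int)
  moreover have "(\<lambda>l. indicator B l - indicator (A \<inter> B) l :: real) = indicator (- A \<inter> B)" by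
      (auto simp: indicator_def)
  moreover have "E (- A) \<circ> E B = (\<lambda>\<xi>. E B \<xi> - (E A \<circ> E B) \<xi>)" by (auto simp: E_compl[OF
      compl(1)])
  ultimately show ?case by simp
next
  case (union A)
  have A: "A i \<in> sets borel" for i using union by auto
  obtain T where T: "R (indicator (\<Union>i. A i)) T"
    "\<And>\<xi> \<eta>. (\<lambda>k. cinner (\<Sum>i<k. E (A i) \<xi>) \<eta>) \<longlonglongrightarrow> cinner (T
        \<xi>) \<eta>"
    by (rule R_limit[OF R_sum_indicator[OF R_E[OF A] A union(1)] _ _ _ indicator_union_tendsto, of 1])
      (use A in \<open>auto simp: abs_indicator_le_1\<close>)
  have eq: "E (\<Union>i. A i) = T" using A T(1) by (intro E_eqI) auto
  show ?case
  proof (rule R_limitI[OF R_sum_indicator[of "\<lambda>i. A i \<inter> B" "\<lambda>i. E (A i) \<circ> E B"], where B=1])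
    show "R (indicator (A i \<inter> B)) (E (A i) \<circ> E B)" for i by (rule union(3))
    show "disjoint_family (\<lambda>i. A i \<inter> B)" using union(1) by (auto simp: disjoint_family_on_def)
    show "(\<lambda>k. indicator (\<Union>i<k. A i \<inter> B) l :: real) \<longlonglongrightarrow> indicator
        ((\<Union>i. A i) \<inter> B) l" for l
    proof -
      have eq: "(\<Union>i. A i) \<inter> B = (\<Union>i. A i \<inter> B)" by auto
      show ?thesis unfolding eq by (rule LIMSEQ_indicator_UN)
    qed
    show "bounded_clinear (E (\<Union>i. A i) \<circ> E B)" using A B by (intro bounded_clinear_comp E_clinear) auto
    show "(\<lambda>k. cinner (\<Sum>i<k. (E (A i) \<circ> E B) \<xi>) \<xi>) \<longlonglongrightarrow> cinner ((E
        (\<Union>i. A i) \<circ> E B) \<xi>) \<xi>" for \<xi>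
      using T(2)[of "E B \<xi>" \<xi>] by (simp add: eq)
  qed (use A B union in \<open>auto simp: abs_indicator_le_1\<close>)
qed

text \<open>The induction is applied twice, once for each set. In between the factors are exchanged
  by taking adjoints: the diagonal of the reversed product is the complex conjugate, and it is
  real.\<close>

private lemma E_Int:
  assumes S: "S \<in> sets borel" and B: "B \<in> sets borel"
  shows "E (S \<inter> B) = E S \<circ> E B"
proof -
  have swap: "R (indicator (S \<inter> B)) (E B \<circ> E S)"
    if "R (indicator (S \<inter> B)) (E S \<circ> E B)" and S: "S \<in> sets borel" and B: "B \<in> sets borel" for S B
  proof -
    have "cinner ((E B \<circ> E S) \<xi>) \<xi> = cnj (cinner ((E S \<circ> E B) \<xi>) \<xi>)" for \<xi>
      using selfadjoint_opD(2)[OF R_selfadjoint[OF R_E[OF B]]] selfadjoint_opD(2)[OF R_selfadjoint[OF R_E[OF S]]]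
      by (metis cinner_commute comp_apply)
    then show ?thesis using that(1) E_clinear[OF S] E_clinear[OF B] by (auto simp: R_def)
  qed
  have "R (indicator (S \<inter> {..t})) (E S \<circ> E {..t})" for t
    by (rule E_Int_induct[OF S]) (auto intro: E_orthant_orthant)
  then have "R (indicator ({..t} \<inter> S)) (E {..t} \<circ> E S)" for t
    using swap[OF _ S, of "{..t}"] by (simp add: Int_commute)
  from E_Int_induct[OF B S this] have "R (indicator (B \<inter> S)) (E B \<circ> E S)" .
  from swap[OF this B S] show ?thesis using S B by (intro E_eqI) (auto simp: Int_commute)
qed

private lemma E_projection: "S \<in> sets borel \<Longrightarrow> projection_op (E S)"
  using R_selfadjoint[OF R_E] E_Int[of S S] by (simp add: projection_op_def)

private lemma E_norm: "S \<in> sets borel \<Longrightarrow> (norm (E S \<xi>))\<^sup>2 = measure (\<mu> \<xi>) S"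
proof -
  assume S: "S \<in> sets borel"
  have "complex_of_real ((norm (E S \<xi>))\<^sup>2) = of_real (\<integral>l. indicator S l \<partial>\<mu> \<xi>)"
    using R_E[OF S] projection_opD(3)[OF E_projection[OF S], of \<xi>] by (simp add: R_def)
  then show ?thesis using S by (simp only: of_real_eq_iff) (simp add: \<mu>(2) space_\<mu>)
qed

private lemma pvm_E: "pvm E"
  unfolding pvm_def
proof (intro conjI ballI allI impI)
  show "E {} = (\<lambda>_. 0)" by (rule E_eqI[OF _ R_empty]) simp
  show "E UNIV = id" using R_one by (intro E_eqI) (auto simp: indicator_def[abs_def])
  fix A :: "nat \<Rightarrow> (real^'n) set" and \<xi> assume A: "range A \<subseteq> sets borel" "disjoint_family A"
  have A': "A i \<in> sets borel" for i using A by auto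
  interpret finite_measure "\<mu> \<xi>" by (rule \<mu>(1))
  let ?U = "\<Union>i. A i"
  have part: "(\<Sum>i<k. E (A i) \<xi>) = E (\<Union>i<k. A i) \<xi>" for k
    using E_eqI[OF _ R_sum_indicator[OF R_E[OF A'] A' A(2), of k]] A' by (simp add: fun_eq_iff)
  \<comment> \<open>The squared distance to the limit is the measure of the tail, so strong
    convergence follows from continuity of a finite measure from above.\<close>
  have dist: "(norm ((\<Sum>i<k. E (A i) \<xi>) - E ?U \<xi>))\<^sup>2 = measure (\<mu> \<xi>) (?U - (\<Union>i<k. A
      i))" for k
  proof -
    have *: "?U \<in> sets borel" "(\<Union>i<k. A i) \<in> sets borel" using A' by auto
    have U: "?U - (\<Union>i<k. A i) = - (\<Union>i<k. A i) \<inter> ?U" by auto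
    have "E (- (\<Union>i<k. A i) \<inter> ?U) = E (- (\<Union>i<k. A i)) \<circ> E ?U"
      by (intro E_Int borel_comp *)
    then have "E (?U - (\<Union>i<k. A i)) \<xi> = E ?U \<xi> - E (\<Union>i<k. A i) (E ?U \<xi>)"
      unfolding U E_compl[OF *(2)] by simp
    also have "E (\<Union>i<k. A i) (E ?U \<xi>) = E ((\<Union>i<k. A i) \<inter> ?U) \<xi>" using * by (simp add: E_Int)
    also have "(\<Union>i<k. A i) \<inter> ?U = (\<Union>i<k. A i)" by auto
    finally have "(\<Sum>i<k. E (A i) \<xi>) - E ?U \<xi> = - E (?U - (\<Union>i<k. A i)) \<xi>" by (simp add: part)
    then show ?thesis using * by (simp add: E_norm)
  qed
  have lim: "(\<lambda>k. measure (\<mu> \<xi>) (?U - (\<Union>i<k. A i))) \<longlonglongrightarrow> measure (\<mu>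
      \<xi>) (\<Inter>k. ?U - (\<Union>i<k. A i))"
    using A' by (intro finite_Lim_measure_decseq decseq_SucI) (auto simp: \<mu>(2) lessThan_Suc)
  have empty: "(\<Inter>k. ?U - (\<Union>i<k. A i)) = {}" by (auto; metis lessI)
  have "(\<lambda>k. (norm ((\<Sum>i<k. E (A i) \<xi>) - E ?U \<xi>))\<^sup>2) \<longlonglongrightarrow> 0"
    using lim unfolding dist empty measure_empty .
  then have "(\<lambda>k. sqrt ((norm ((\<Sum>i<k. E (A i) \<xi>) - E ?U \<xi>))\<^sup>2)) \<longlonglongrightarrow>
      sqrt 0" by (rule tendsto_real_sqrt)
  then show "(\<lambda>i. E (A i) \<xi>) sums E ?U \<xi>"
    unfolding sums_def by (subst LIM_zero_iff[symmetric]) (simp add: tendsto_norm_zero_iff)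
qed (simp_all add: E_projection E_Int, simp add: E_def)

private lemma pvm_measure_E: "pvm_measure E \<xi> = \<mu> \<xi>"
proof (rule measure_eqI)
  interpret finite_measure "\<mu> \<xi>" by (rule \<mu>(1))
  fix S assume "S \<in> sets (pvm_measure E \<xi>)"
  then have "S \<in> sets borel" by (simp add: sets_pvm_measure[OF pvm_E])
  then show "emeasure (pvm_measure E \<xi>) S = emeasure (\<mu> \<xi>) S"
    by (simp add: emeasure_pvm_measure[OF pvm_E] E_norm emeasure_eq_measure)
qed (simp add: sets_pvm_measure[OF pvm_E] \<mu>(2))

theorem joint_pvm_exists:
  "\<exists>E. pvm E \<and> (\<forall>\<xi>. AE l in pvm_measure E \<xi>. l \<in> cbox 0 1) \<and>
    (\<forall>p \<xi>. (\<integral>l. (\<Prod>i\<in>UNIV. poly (p i) (l $ i)) \<partial>pvm_measure E \<xi>) =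
      op_prod idx (\<lambda>i. op_poly (X i) (p i)) \<xi> \<bullet> \<xi>)"
  using pvm_E \<mu>(3,4) unfolding pvm_measure_E[symmetric] Pl_def Op_def by (intro exI[of _ E]) auto

end

section \<open>Integration against projection-valued measures\<close>

lemma finite_measure_eqI_orthants:
  fixes M N :: "'a::ordered_euclidean_space measure"
  assumes M: "finite_measure M" "sets M = sets borel" and N: "finite_measure N" "sets N = sets borel"
    and UNIV: "measure M UNIV = measure N UNIV" and eq: "\<And>s. measure M {..s} = measure N {..s}"
    and S: "S \<in> sets borel"
  shows "measure M S = measure N S"
  using S
proof (induction rule: borel_induct_orthants)
  case (compl A)
  have "space M = UNIV" "space N = UNIV"
    using sets_eq_imp_space_eq[OF M(2)] sets_eq_imp_space_eq[OF N(2)] by simp_all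
  then have "measure M (- A) = measure M UNIV - measure M A" "measure N (- A) = measure N UNIV - measure N A"
    using finite_measure.finite_measure_compl[OF M(1), of A] finite_measure.finite_measure_compl[OF N(1), of A]
      compl(1) M(2) N(2) by (simp_all add: Compl_eq_Diff_UNIV)
  then show ?case using UNIV compl(2) by simp
next
  case (union A)
  have "(\<lambda>i. measure M (A i)) sums measure M (\<Union>i. A i)"
    using union(1,2) M(2) by (intro finite_measure.finite_measure_UNION[OF M(1)]) simp_all
  moreover have "(\<lambda>i. measure N (A i)) sums measure N (\<Union>i. A i)"
    using union(1,2) N(2) by (intro finite_measure.finite_measure_UNION[OF N(1)]) simp_all
  ultimately show ?case unfolding union(3) by (rule sums_unique2)
qed (auto simp: eq)

lemma pvm_eqI_orthants:
  fixes E F :: "'a::ordered_euclidean_space set \<Rightarrow> 'h::complex_hilbert \<Rightarrow> 'h"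
  assumes E: "pvm E" and F: "pvm F"
    and eq: "\<And>\<xi> s. measure (pvm_measure E \<xi>) {..s} = measure (pvm_measure F \<xi>) {..s}"
  shows "E = F"
proof (rule pvm_eqI[OF E F])
  fix \<xi> and S :: "'a set" assume S: "S \<in> sets borel"
  show "measure (pvm_measure E \<xi>) S = measure (pvm_measure F \<xi>) S"
    by (rule finite_measure_eqI_orthants[OF finite_measure_pvm_measure[OF E] _ finite_measure_pvm_measure[OF F] _ _ eq S])
      (auto simp: sets_pvm_measure[OF E] sets_pvm_measure[OF F] measure_pvm_measure_UNIV[OF E]
          measure_pvm_measure_UNIV[OF F])
qed

section \<open>Operator integrals and image measures\<close>

lemma has_pvm_integral_UNIV_iff:
  "has_pvm_integral E UNIV f b \<longleftrightarrow> bounded_clinear b \<and>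
    (\<forall>\<xi>. integrable (pvm_measure E \<xi>) f \<and> cinner (b \<xi>) \<xi> = of_real (\<integral>l. f l
        \<partial>pvm_measure E \<xi>))"
  by (simp add: has_pvm_integral_def set_integrable_def set_lebesgue_integral_def)

lemma has_pvm_integral_unique:
  "has_pvm_integral E S f b \<Longrightarrow> has_pvm_integral E S f b' \<Longrightarrow> b = b'"
  unfolding has_pvm_integral_def by (rule clinear_eqI) auto

lemma has_pvm_integral_inner:
  "has_pvm_integral E UNIV f b \<Longrightarrow> b \<xi> \<bullet> \<xi> = (\<integral>l. f l \<partial>pvm_measure E \<xi>)"
  by (simp add: has_pvm_integral_UNIV_iff Re_cinner[symmetric])

lemma has_pvm_integral_selfadjoint: "has_pvm_integral E S f b \<Longrightarrow> selfadjoint_op b"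
  unfolding has_pvm_integral_def by (rule selfadjoint_opI_real) auto

text \<open>The image measure. The case distinction is needed because the preimage of a set that is
  not Borel may be Borel, whereas \<open>pvm\<close> prescribes 0 there.\<close>

definition pvm_push :: "('a::topological_space \<Rightarrow> 'b::topological_space) \<Rightarrow> ('a set \<Rightarrow>
    'h \<Rightarrow> 'h) \<Rightarrow>
    'b set \<Rightarrow> 'h::complex_hilbert \<Rightarrow> 'h" where
  "pvm_push h E S = (if S \<in> sets borel then E (h -` S) else (\<lambda>_. 0))"

lemma
  fixes E :: "'a::topological_space set \<Rightarrow> 'h::complex_hilbert \<Rightarrow> 'h" and h :: "'a \<Rightarrow>
      'b::topological_space"
  assumes E: "pvm E" and h: "h \<in> borel_measurable borel"
  shows pvm_pvm_push: "pvm (pvm_push h E)"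
    and pvm_measure_push: "pvm_measure (pvm_push h E) \<xi> = distr (pvm_measure E \<xi>) borel h"
proof -
  have hS: "h -` S \<in> sets borel" if "S \<in> sets borel" for S
    using measurable_sets[OF h that] by simp
  show P: "pvm (pvm_push h E)"
    unfolding pvm_def
  proof (intro conjI ballI allI impI)
    show "projection_op (pvm_push h E S)" if "S \<in> sets borel" for S
      using that by (simp add: pvm_push_def pvmD(1)[OF E hS])
    show "pvm_push h E (S \<inter> S') = pvm_push h E S \<circ> pvm_push h E S'" if "S \<in> sets borel" "S' \<in> sets
        borel" for S S'
      using that by (simp add: pvm_push_def vimage_Int pvmD(4)[OF E hS hS] sets.Int)
    fix A :: "nat \<Rightarrow> 'b set" and \<xi> assume A: "range A \<subseteq> sets borel" "disjoint_family A"
    then have "(\<lambda>k. E (h -` A k) \<xi>) sums E (\<Union>k. h -` A k) \<xi>"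
      using hS by (intro pvmD(5)[OF E]) (auto simp: disjoint_family_on_def)
    moreover have "(\<Union>k. A k) \<in> sets borel" using A by auto
    ultimately show "(\<lambda>k. pvm_push h E (A k) \<xi>) sums pvm_push h E (\<Union>k. A k) \<xi>"
      using A by (simp add: pvm_push_def vimage_UN image_subset_iff)
  qed (auto simp: pvm_push_def pvmD(2,3)[OF E])
  show "pvm_measure (pvm_push h E) \<xi> = distr (pvm_measure E \<xi>) borel h"
  proof (rule measure_eqI)
    fix S assume "S \<in> sets (pvm_measure (pvm_push h E) \<xi>)"
    then have S: "S \<in> sets borel" by (simp add: sets_pvm_measure[OF P])
    have "h \<in> measurable (pvm_measure E \<xi>) borel"
      using h by (simp cong: measurable_cong_sets add: sets_pvm_measure[OF E])
    from emeasure_distr[OF this S] show "emeasure (pvm_measure (pvm_push h E) \<xi>) S = emeasure (distr (pvm_measure E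
        \<xi>) borel h) S"
      using S by (simp add: emeasure_pvm_measure[OF P] emeasure_pvm_measure[OF E] hS space_pvm_measure[OF E] pvm_push_def)
  qed (simp add: sets_pvm_measure[OF P])
qed

lemma has_pvm_integral_push:
  fixes E :: "'a::topological_space set \<Rightarrow> 'h::complex_hilbert \<Rightarrow> 'h" and h :: "'a \<Rightarrow>
      'b::topological_space"
  assumes E: "pvm E" and h: "h \<in> borel_measurable borel" and f: "f \<in> borel_measurable borel"
  shows "has_pvm_integral (pvm_push h E) UNIV f b \<longleftrightarrow> has_pvm_integral E UNIV (\<lambda>l. f (h l)) b"
proof -
  have "h \<in> measurable (pvm_measure E \<xi>) borel" for \<xi>
    using h by (simp cong: measurable_cong_sets add: sets_pvm_measure[OF E])
  then show ?thesis
    unfolding has_pvm_integral_UNIV_iff pvm_measure_push[OF E h]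
    by (simp add: integrable_distr_eq[OF _ f] integral_distr[OF _ f])
qed

context
  fixes E :: "'a::topological_space set \<Rightarrow> 'h::complex_hilbert \<Rightarrow> 'h"
  assumes E: "pvm E"
begin

private lemma [measurable_cong]: "sets (pvm_measure E \<xi>) = sets borel"
  by (rule sets_pvm_measure[OF E])

lemma integrable_pvm_measure_bounded:
  fixes f :: "'a \<Rightarrow> real"
  assumes f: "f \<in> borel_measurable borel" "AE l in pvm_measure E \<xi>. \<bar>f l\<bar> \<le> B"
  shows "integrable (pvm_measure E \<xi>) f" "\<bar>\<integral>l. f l \<partial>pvm_measure E \<xi>\<bar> \<le> B *
      (norm \<xi>)\<^sup>2"
proof -
  interpret finite_measure "pvm_measure E \<xi>" by (rule finite_measure_pvm_measure[OF E])
  show int: "integrable (pvm_measure E \<xi>) f" using f by (intro integrable_const_bound[of _ B]) auto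
  have "\<bar>\<integral>l. f l \<partial>pvm_measure E \<xi>\<bar> \<le> (\<integral>l. \<bar>f l\<bar>
      \<partial>pvm_measure E \<xi>)" by (rule integral_abs_bound)
  also have "\<dots> \<le> (\<integral>l. B \<partial>pvm_measure E \<xi>)" using int f by (intro integral_mono_AE) auto
  also have "\<dots> = B * (norm \<xi>)\<^sup>2" by (simp add: space_pvm_measure[OF E] measure_pvm_measure_UNIV[OF E])
  finally show "\<bar>\<integral>l. f l \<partial>pvm_measure E \<xi>\<bar> \<le> B * (norm \<xi>)\<^sup>2" .
qed

lemma has_pvm_integral_cong_AE:
  assumes "has_pvm_integral E UNIV f b" "f \<in> borel_measurable borel" "g \<in> borel_measurable borel"
    "\<And>\<xi>. AE l in pvm_measure E \<xi>. f l = g l"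
  shows "has_pvm_integral E UNIV g b"
  unfolding has_pvm_integral_UNIV_iff
proof (intro conjI allI)
  fix \<xi>
  have fg: "AE l in pvm_measure E \<xi>. f l = g l" by (rule assms)
  have [measurable]: "f \<in> borel_measurable borel" "g \<in> borel_measurable borel" by fact+
  show "integrable (pvm_measure E \<xi>) g"
    using assms(1) integrable_cong_AE[OF _ _ fg] by (simp add: has_pvm_integral_UNIV_iff)
  show "cinner (b \<xi>) \<xi> = of_real (\<integral>l. g l \<partial>pvm_measure E \<xi>)"
    using assms(1) integral_cong_AE[OF _ _ fg] by (simp add: has_pvm_integral_UNIV_iff)
qed (use assms(1) in \<open>simp add: has_pvm_integral_UNIV_iff\<close>)

lemma has_pvm_integral_add:
  assumes "has_pvm_integral E UNIV f a" "has_pvm_integral E UNIV g b"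
  shows "has_pvm_integral E UNIV (\<lambda>l. f l + g l) (\<lambda>\<xi>. a \<xi> + b \<xi>)"
  using assms unfolding has_pvm_integral_UNIV_iff by (auto simp: bounded_clinear_add cinner_algebra)

lemma has_pvm_integral_scale:
  assumes "has_pvm_integral E UNIV f a"
  shows "has_pvm_integral E UNIV (\<lambda>l. c * f l) (\<lambda>\<xi>. c *\<^sub>R a \<xi>)"
  using assms unfolding has_pvm_integral_UNIV_iff by (auto simp: bounded_clinear_scaleR cinner_algebra)

lemma has_pvm_integral_indicator:
  assumes S: "S \<in> sets borel"
  shows "has_pvm_integral E UNIV (indicator S) (E S)"
  unfolding has_pvm_integral_UNIV_iff
  using S projection_opD(1,3)[OF pvmD(1)[OF E S]]
  by (auto intro!: integrable_pvm_measure_bounded(1)[where B=1]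
      simp: space_pvm_measure[OF E] measure_pvm_measure[OF E] indicator_def[of S])

lemma has_pvm_integral_const: "has_pvm_integral E UNIV (\<lambda>_. c) (\<lambda>\<xi>. c *\<^sub>R \<xi>)"
  using has_pvm_integral_scale[OF has_pvm_integral_indicator[of UNIV], of c] by (simp add: pvmD(3)[OF E])

lemma has_pvm_integral_sum:
  assumes "finite J" "\<And>j. j \<in> J \<Longrightarrow> has_pvm_integral E UNIV (f j) (a j)"
  shows "has_pvm_integral E UNIV (\<lambda>l. \<Sum>j\<in>J. f j l) (\<lambda>\<xi>. \<Sum>j\<in>J. a j \<xi>)"
  using assms
  by (induction rule: finite_induct) (use has_pvm_integral_const[of 0] in \<open>auto intro: has_pvm_integral_add\<close>)

text \<open>Rounding \<open>f\<close> down to multiples of 1/(k+1) gives finite combinations of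
  projections, whose forms converge to that of the integral. For disjoint level sets the projections
  have orthogonal ranges, so the squared norm of a step operator applied to a vector integrates the
  square of the step function; the identity passes to the limit.\<close>

lemma has_pvm_integral_bounded_ex:
  assumes f: "f \<in> borel_measurable borel" "\<And>l. \<bar>f l\<bar> \<le> B"
  shows "\<exists>a. has_pvm_integral E UNIV f a \<and> (\<forall>\<xi>. (norm (a \<xi>))\<^sup>2 = (\<integral>l. (f
      l)\<^sup>2 \<partial>pvm_measure E \<xi>))"
proof -
  have [measurable]: "f \<in> borel_measurable borel" by fact
  have B: "B \<ge> 0" using f(2) abs_ge_zero order_trans by blast
  define A where "A k j = {l. \<lfloor>real (Suc k) * f l\<rfloor> = j}" for k :: nat and j :: int
  define J where "J k = {- \<lceil>real (Suc k) * B\<rceil> - 1 .. \<lceil>real (Suc k) * B\<rceil>}" for k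
  define c where "c k j = of_int j / real (Suc k)" for k and j :: int
  define s where "s k l = (\<Sum>j\<in>J k. c k j * indicator (A k j) l)" for k l
  define H where "H k \<xi> = (\<Sum>j\<in>J k. c k j *\<^sub>R E (A k j) \<xi>)" for k \<xi>
  have A[measurable]: "A k j \<in> sets borel" for k j unfolding A_def by measurable
  have in_J: "\<lfloor>real (Suc k) * f l\<rfloor> \<in> J k" for k l
  proof -
    have "\<bar>real (Suc k) * f l\<bar> \<le> real (Suc k) * B" using f(2)[of l] by (simp add: abs_mult del: of_nat_Suc)
    then show ?thesis unfolding J_def atLeastAtMost_iff by (intro conjI) linarith+
  qed
  have s: "s k l = c k \<lfloor>real (Suc k) * f l\<rfloor>" for k l
  proof -
    have "s k l = (\<Sum>j\<in>J k. if \<lfloor>real (Suc k) * f l\<rfloor> = j then c k j else 0)"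
      unfolding s_def by (intro sum.cong) (auto simp: A_def)
    then show ?thesis using in_J by (simp add: J_def)
  qed
  have [measurable]: "s k \<in> borel_measurable borel" for k unfolding s_def by measurable
  have approx: "\<bar>s k l - f l\<bar> \<le> 1 / real (Suc k)" for k l
  proof -
    have "\<bar>of_int \<lfloor>real (Suc k) * f l\<rfloor> - real (Suc k) * f l\<bar> \<le> 1" by linarith
    then have "\<bar>of_int \<lfloor>real (Suc k) * f l\<rfloor> - real (Suc k) * f l\<bar> / real (Suc k) \<le> 1 /
        real (Suc k)"
      by (intro divide_right_mono) auto
    moreover have "(of_int \<lfloor>real (Suc k) * f l\<rfloor> - real (Suc k) * f l) / real (Suc k) = s k l - f l"
      unfolding s c_def by (simp add: diff_divide_distrib del: of_nat_Suc)
    ultimately show ?thesis by (metis abs_divide abs_of_nat)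
  qed
  have eps: "(\<lambda>k. 1 / real (Suc k)) \<longlonglongrightarrow> 0"
    using LIMSEQ_inverse_real_of_nat by (simp add: inverse_eq_divide)
  have lim: "(\<lambda>k. s k l) \<longlonglongrightarrow> f l" for l
    by (rule Lim_transform2[OF tendsto_const, OF Lim_null_comparison[OF always_eventually eps]])
      (use approx in \<open>auto simp: abs_minus_commute\<close>)
  have sB: "\<bar>s k l\<bar> \<le> B + 1" for k l
  proof -
    have "1 / real (Suc k) \<le> 1" by simp
    then show ?thesis using approx[of k l] f(2)[of l] by linarith
  qed
  have H: "has_pvm_integral E UNIV (s k) (H k)" for k
    unfolding s_def[abs_def] H_def[abs_def]
    by (intro has_pvm_integral_sum has_pvm_integral_scale has_pvm_integral_indicator A) (simp add: J_def)
  have int_lim: "(\<lambda>k. \<integral>l. g (s k l) \<partial>pvm_measure E \<xi>) \<longlonglongrightarrow>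
      (\<integral>l. g (f l) \<partial>pvm_measure E \<xi>)"
    if g: "continuous_on UNIV g" "\<And>r. \<bar>r\<bar> \<le> B + 1 \<Longrightarrow> \<bar>g r\<bar> \<le> D" for g
        :: "real \<Rightarrow> real" and D \<xi>
  proof -
    interpret finite_measure "pvm_measure E \<xi>" by (rule finite_measure_pvm_measure[OF E])
    have [measurable]: "g \<in> borel_measurable borel" using g(1) by (rule borel_measurable_continuous_onI)
    have "(\<lambda>k. g (s k l)) \<longlonglongrightarrow> g (f l)" for l
      by (rule continuous_on_tendsto_compose[OF g(1) lim]) auto
    then show ?thesis
      by (intro integral_dominated_convergence[where w="\<lambda>_. D"]) (use g(2) sB in auto)
  qed
  have norm_H: "norm (H k \<xi>) \<le> (B + 1) * norm \<xi>" for k \<xi>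
  proof (rule selfadjoint_op_norm_bound[OF has_pvm_integral_selfadjoint[OF H]])
    show "\<bar>Re (cinner (H k \<xi>) \<xi>)\<bar> \<le> (B + 1) * (norm \<xi>)\<^sup>2" for \<xi>
      using H[of k] integrable_pvm_measure_bounded(2)[of "s k" "B + 1" \<xi>] sB
      by (simp add: has_pvm_integral_UNIV_iff)
  qed
  have int_s: "(\<lambda>k. \<integral>l. s k l \<partial>pvm_measure E \<xi>) \<longlonglongrightarrow> (\<integral>l.
      f l \<partial>pvm_measure E \<xi>)" for \<xi>
    using int_lim[of "\<lambda>r. r" "B + 1"] by (simp add: continuous_on_id)
  then have conv: "(\<lambda>k. cinner (H k \<xi>) \<xi>) \<longlonglongrightarrow> of_real (\<integral>l. f l
      \<partial>pvm_measure E \<xi>)" for \<xi>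
    using H by (simp add: has_pvm_integral_UNIV_iff tendsto_of_real)
  obtain a where a: "bounded_clinear a" "\<And>\<xi> \<eta>. (\<lambda>k. cinner (H k \<xi>) \<eta>)
      \<longlonglongrightarrow> cinner (a \<xi>) \<eta>"
  proof (rule weak_limit_operator[of H "B + 1"])
    show "bounded_clinear (H k)" for k using H by (simp add: has_pvm_integral_def)
    show "convergent (\<lambda>k. cinner (H k \<xi>) \<xi>)" for \<xi> using conv by (auto simp: convergent_def)
  qed (use norm_H in auto)
  have diag: "cinner (a \<xi>) \<xi> = of_real (\<integral>l. f l \<partial>pvm_measure E \<xi>)" for \<xi>
    using LIMSEQ_unique[OF a(2) conv] .
  then have int_f: "has_pvm_integral E UNIV f a"
    unfolding has_pvm_integral_UNIV_iff using a(1) f by (auto intro: integrable_pvm_measure_bounded(1)[where B=B])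
  \<comment> \<open>Weak convergence alone would lose the norms. The difference is the integral of a
    function of size at most 1/(k+1), so the convergence is in norm.\<close>
  have "norm (H k \<xi> - a \<xi>) \<le> (1 / real (Suc k)) * norm \<xi>" for k \<xi>
  proof -
    have d: "has_pvm_integral E UNIV (\<lambda>l. s k l + (- 1) * f l) (\<lambda>\<xi>. H k \<xi> + (- 1) *\<^sub>R a \<xi>)"
      by (intro has_pvm_integral_add has_pvm_integral_scale H int_f)
    have "norm (H k \<xi> + (- 1) *\<^sub>R a \<xi>) \<le> (1 / real (Suc k)) * norm \<xi>"
    proof (rule selfadjoint_op_norm_bound[OF has_pvm_integral_selfadjoint[OF d]])
      show "\<bar>Re (cinner (H k \<xi> + (- 1) *\<^sub>R a \<xi>) \<xi>)\<bar> \<le> (1 / real (Suc k)) * (norm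
          \<xi>)\<^sup>2" for \<xi>
        using d integrable_pvm_measure_bounded(2)[of "\<lambda>l. s k l + (- 1) * f l" "1 / real (Suc k)" \<xi>] approx[of k]
        unfolding has_pvm_integral_UNIV_iff by simp
    qed
    then show ?thesis by simp
  qed
  then have "(\<lambda>k. H k \<xi> - a \<xi>) \<longlonglongrightarrow> 0" for \<xi>
    by (rule Lim_null_comparison[OF always_eventually[OF allI] tendsto_mult_left_zero[OF eps, of "norm \<xi>"]])
  then have Ha: "(\<lambda>k. H k \<xi>) \<longlonglongrightarrow> a \<xi>" for \<xi> by (simp add: LIM_zero_iff)
  have normH: "(norm (H k \<xi>))\<^sup>2 = (\<integral>l. (s k l)\<^sup>2 \<partial>pvm_measure E \<xi>)" for k \<xi>
  proof -
    have orth: "E (A k i) \<xi> \<bullet> E (A k j) \<xi> = (if i = j then (norm (E (A k i) \<xi>))\<^sup>2 else 0)" for i j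
    proof -
      have "E (A k i) \<xi> \<bullet> E (A k j) \<xi> = Re (cinner \<xi> (E (A k i \<inter> A k j) \<xi>))"
        using projection_opD(4)[OF pvmD(1)[OF E A]] by (simp add: pvmD(4)[OF E A A] Re_cinner[symmetric])
      moreover have "A k i \<inter> A k j = (if i = j then A k i else {})" by (auto simp: A_def)
      ultimately show ?thesis
        using projection_opD(5)[OF pvmD(1)[OF E A], of k i \<xi>]
        by (cases "i = j") (simp_all add: pvmD(2)[OF E] Re_cinner inner_commute)
    qed
    have "(norm (H k \<xi>))\<^sup>2 = (\<Sum>i\<in>J k. \<Sum>j\<in>J k. c k i * (c k j * (E (A k i) \<xi> \<bullet> E
        (A k j) \<xi>)))"
      unfolding power2_norm_eq_inner H_def inner_sum_left inner_sum_right
      by (subst sum.swap) (simp add: mult_ac)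
    also have "\<dots> = (\<Sum>i\<in>J k. (c k i)\<^sup>2 * (norm (E (A k i) \<xi>))\<^sup>2)"
    proof (rule sum.cong[OF refl])
      fix i assume "i \<in> J k"
      then show "(\<Sum>j\<in>J k. c k i * (c k j * (E (A k i) \<xi> \<bullet> E (A k j) \<xi>))) = (c k i)\<^sup>2 *
          (norm (E (A k i) \<xi>))\<^sup>2"
      proof -
        have "c k i * (c k j * (E (A k i) \<xi> \<bullet> E (A k j) \<xi>)) =
            (if i = j then (c k i)\<^sup>2 * (norm (E (A k i) \<xi>))\<^sup>2 else 0)" for j
          unfolding orth by (simp add: power2_eq_square)
        then show ?thesis using \<open>i \<in> J k\<close> by (simp add: J_def)
      qed
    qed
    also have "\<dots> = (\<integral>l. (\<Sum>i\<in>J k. (c k i)\<^sup>2 * indicator (A k i) l) \<partial>pvm_measure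
        E \<xi>)"
    proof -
      have "has_pvm_integral E UNIV (\<lambda>l. \<Sum>i\<in>J k. (c k i)\<^sup>2 * indicator (A k i) l)
          (\<lambda>\<xi>. \<Sum>i\<in>J k. (c k i)\<^sup>2 *\<^sub>R E (A k i) \<xi>)"
        by (intro has_pvm_integral_sum has_pvm_integral_scale has_pvm_integral_indicator A) (simp add: J_def)
      from has_pvm_integral_inner[OF this, of \<xi>]
      show ?thesis
        unfolding inner_sum_left using projection_opD(5)[OF pvmD(1)[OF E A], of k _ \<xi>] by simp
    qed
    also have "(\<lambda>l. \<Sum>i\<in>J k. (c k i)\<^sup>2 * indicator (A k i) l) = (\<lambda>l. (s k l)\<^sup>2)"
    proof
      fix l
      have "(\<Sum>i\<in>J k. (c k i)\<^sup>2 * indicator (A k i) l) = (\<Sum>j\<in>J k. if \<lfloor>real (Suc k) * f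
          l\<rfloor> = j then (c k j)\<^sup>2 else 0)"
        by (intro sum.cong) (auto simp: A_def)
      then show "(\<Sum>i\<in>J k. (c k i)\<^sup>2 * indicator (A k i) l) = (s k l)\<^sup>2" using in_J by (simp add: s
          J_def)
    qed
    finally show ?thesis .
  qed
  have "(norm (a \<xi>))\<^sup>2 = (\<integral>l. (f l)\<^sup>2 \<partial>pvm_measure E \<xi>)" for \<xi>
  proof (rule LIMSEQ_unique)
    show "(\<lambda>k. (norm (H k \<xi>))\<^sup>2) \<longlonglongrightarrow> (norm (a \<xi>))\<^sup>2" by (intro
        tendsto_intros Ha)
    show "(\<lambda>k. (norm (H k \<xi>))\<^sup>2) \<longlonglongrightarrow> (\<integral>l. (f l)\<^sup>2
        \<partial>pvm_measure E \<xi>)"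
      unfolding normH
      by (rule int_lim[of "\<lambda>r. r\<^sup>2" "(B + 1)\<^sup>2"])
        (use B in \<open>auto intro!: continuous_intros simp: abs_le_square_iff[symmetric]\<close>)
  qed
  then show ?thesis using int_f by blast
qed

lemma has_pvm_integral_norm:
  assumes "has_pvm_integral E UNIV f a" "f \<in> borel_measurable borel" "\<And>l. \<bar>f l\<bar> \<le> B"
  shows "(norm (a \<xi>))\<^sup>2 = (\<integral>l. (f l)\<^sup>2 \<partial>pvm_measure E \<xi>)"
  using has_pvm_integral_bounded_ex[OF assms(2,3)] has_pvm_integral_unique[OF assms(1)] by blast

text \<open>The norm identity for \<open>a\<close>, \<open>b\<close> and \<open>a + b\<close> gives
  the inner product of \<open>a \<xi>\<close> and \<open>b \<xi>\<close> as the integral of the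
  product. Commutation makes the diagonal of the composition real, so the real part is all of
  it.\<close>

lemma has_pvm_integral_mult:
  assumes a: "has_pvm_integral E UNIV f a" "f \<in> borel_measurable borel" "\<And>l. \<bar>f l\<bar> \<le> B"
    and b: "has_pvm_integral E UNIV g b" "g \<in> borel_measurable borel" "\<And>l. \<bar>g l\<bar> \<le> C"
    and comm: "\<And>\<xi>. a (b \<xi>) = b (a \<xi>)"
  shows "has_pvm_integral E UNIV (\<lambda>l. f l * g l) (\<lambda>\<xi>. a (b \<xi>))"
  unfolding has_pvm_integral_UNIV_iff
proof (intro conjI allI)
  have [measurable]: "f \<in> borel_measurable borel" "g \<in> borel_measurable borel" by fact+
  note sa = has_pvm_integral_selfadjoint[OF a(1)] and sb = has_pvm_integral_selfadjoint[OF b(1)]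
  note abc = selfadjoint_opD(1)[OF sa] selfadjoint_opD(1)[OF sb]
  show "bounded_clinear (\<lambda>\<xi>. a (b \<xi>))" using bounded_clinear_comp[OF abc] by (simp add: o_def)
  fix \<xi>
  have BC: "\<bar>f l * g l\<bar> \<le> B * C" for l
    using a(3)[of l] b(3)[of l] by (simp add: abs_mult mult_mono')
  have "(f l)\<^sup>2 \<le> B\<^sup>2" "(g l)\<^sup>2 \<le> C\<^sup>2" for l
    using power_mono[OF a(3)[of l] abs_ge_zero, of 2] power_mono[OF b(3)[of l] abs_ge_zero, of 2] by simp_all
  then have sq: "integrable (pvm_measure E \<xi>) (\<lambda>l. (f l)\<^sup>2)" "integrable (pvm_measure E \<xi>)
      (\<lambda>l. (g l)\<^sup>2)"
    by (intro integrable_pvm_measure_bounded(1)[where B="B\<^sup>2"]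
        integrable_pvm_measure_bounded(1)[where B="C\<^sup>2"]; simp)+
  show int: "integrable (pvm_measure E \<xi>) (\<lambda>l. f l * g l)"
    using BC by (intro integrable_pvm_measure_bounded(1)[where B="B * C"]) auto
  have "\<bar>f l + g l\<bar> \<le> B + C" for l using a(3)[of l] b(3)[of l] by linarith
  then have "(norm (a \<xi> + b \<xi>))\<^sup>2 = (\<integral>l. (f l + g l)\<^sup>2 \<partial>pvm_measure E \<xi>)"
    by (intro has_pvm_integral_norm[OF has_pvm_integral_add[OF a(1) b(1)]]) auto
  also have "\<dots> = (\<integral>l. (f l)\<^sup>2 \<partial>pvm_measure E \<xi>) + (\<integral>l. (g l)\<^sup>2
      \<partial>pvm_measure E \<xi>) + 2 * (\<integral>l. f l * g l \<partial>pvm_measure E \<xi>)"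
    using sq int by (simp add: power2_sum mult.assoc)
  also have "(\<integral>l. (f l)\<^sup>2 \<partial>pvm_measure E \<xi>) = (norm (a \<xi>))\<^sup>2" by (rule
      has_pvm_integral_norm[OF a, symmetric])
  also have "(\<integral>l. (g l)\<^sup>2 \<partial>pvm_measure E \<xi>) = (norm (b \<xi>))\<^sup>2" by (rule
      has_pvm_integral_norm[OF b, symmetric])
  finally have "a \<xi> \<bullet> b \<xi> = (\<integral>l. f l * g l \<partial>pvm_measure E \<xi>)"
    by (simp add: power2_norm_eq_inner inner_add_left inner_add_right inner_commute)
  moreover have "a \<xi> \<bullet> b \<xi> = Re (cinner (a (b \<xi>)) \<xi>)"
    by (simp add: Re_cinner selfadjoint_op_inner[OF sa] inner_commute)
  moreover have "cinner (a (b \<xi>)) \<xi> = cnj (cinner (a (b \<xi>)) \<xi>)"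
    using selfadjoint_opD(2)[OF sa] selfadjoint_opD(2)[OF sb] comm by (metis cinner_commute)
  ultimately show "cinner (a (b \<xi>)) \<xi> = of_real (\<integral>l. f l * g l \<partial>pvm_measure E \<xi>)"
    by (metis Reals_cnj_iff of_real_Re)
qed

text \<open>Boundedness of the polynomial is carried through the induction because the product rule
  is restricted to bounded functions.\<close>

lemma has_pvm_integral_poly:
  assumes a: "has_pvm_integral E UNIV f a" "f \<in> borel_measurable borel" "\<And>l. \<bar>f l\<bar> \<le> B"
  shows "has_pvm_integral E UNIV (\<lambda>l. poly p (f l)) (op_poly a p) \<and> (\<exists>D. \<forall>l. \<bar>poly p
      (f l)\<bar> \<le> D)"
proof (induction p)
  case 0
  then show ?case using has_pvm_integral_const[of 0] by auto
next
  case (pCons c p)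
  then obtain D where D: "\<And>l. \<bar>poly p (f l)\<bar> \<le> D" and IH: "has_pvm_integral E UNIV (\<lambda>l. poly
      p (f l)) (op_poly a p)" by blast
  have [measurable]: "f \<in> borel_measurable borel" by fact
  have bc: "bounded_clinear a" using a(1) by (simp add: has_pvm_integral_def)
  have "continuous_on UNIV (\<lambda>r. poly p r)" by (intro continuous_intros)
  from borel_measurable_continuous_on[OF this a(2)]
  have "(\<lambda>l. poly p (f l)) \<in> borel_measurable borel" .
  moreover have "a (op_poly a p \<xi>) = op_poly a p (a \<xi>)" for \<xi>
    by (rule op_poly_commute[OF bc bc]) (rule refl)
  ultimately
  have "has_pvm_integral E UNIV (\<lambda>l. f l * poly p (f l)) (\<lambda>\<xi>. a (op_poly a p \<xi>))"
    by (rule has_pvm_integral_mult[where b="op_poly a p", OF a IH _ D])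
  from has_pvm_integral_add[OF has_pvm_integral_const[of c] this]
  have "has_pvm_integral E UNIV (\<lambda>l. poly (pCons c p) (f l)) (\<lambda>\<xi>. c *\<^sub>R \<xi> + a (op_poly a
      p \<xi>))" by simp
  moreover have "op_poly a (pCons c p) = (\<lambda>\<xi>. c *\<^sub>R \<xi> + a (op_poly a p \<xi>))"
    by (rule ext, rule op_poly_pCons) (rule bounded_clinearD(5)[OF bc])
  ultimately have "has_pvm_integral E UNIV (\<lambda>l. poly (pCons c p) (f l)) (op_poly a (pCons c p))" by simp
  moreover have "\<bar>poly (pCons c p) (f l)\<bar> \<le> \<bar>c\<bar> + B * D" for l
  proof -
    have "\<bar>f l * poly p (f l)\<bar> \<le> B * D" using a(3)[of l] D[of l] by (simp add: abs_mult mult_mono')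
    then show ?thesis using abs_triangle_ineq[of c "f l * poly p (f l)"] by simp
  qed
  ultimately show ?case by blast
qed

text \<open>A vector in the range of the projection has its diagonal measure on the set where
  \<open>f\<close> is below \<open>m\<close>. Its form would then be strictly below the assumed
  bound unless the vector is 0.\<close>

lemma pvm_lower_support:
  assumes x: "has_pvm_integral E UNIV f x" and f: "f \<in> borel_measurable borel"
    and low: "\<And>h. m * (norm h)\<^sup>2 \<le> x h \<bullet> h"
  shows "E {l. f l < m} = (\<lambda>_. 0)"
proof
  fix \<xi>
  have [measurable]: "f \<in> borel_measurable borel" by fact
  define S where "S = {l. f l < m}"
  have S: "S \<in> sets borel" "- S \<in> sets borel" unfolding S_def by (auto intro!: borel_comp)
  define h where "h = E S \<xi>"
  interpret finite_measure "pvm_measure E h" by (rule finite_measure_pvm_measure[OF E])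
  have "E (- S) h = E (- S \<inter> S) \<xi>" unfolding pvmD(4)[OF E S(2,1)] by (simp add: h_def)
  then have "emeasure (pvm_measure E h) (- S) = 0"
    using S by (simp add: emeasure_pvm_measure[OF E] pvmD(2)[OF E])
  then have AE: "AE l in pvm_measure E h. f l < m"
    using S by (intro AE_I[of _ _ "- S"]) (auto simp: S_def sets_pvm_measure[OF E])
  have int: "integrable (pvm_measure E h) f" "x h \<bullet> h = (\<integral>l. f l \<partial>pvm_measure E h)"
    using x unfolding has_pvm_integral_UNIV_iff by (auto simp: Re_cinner[symmetric])
  have eq: "(\<integral>l. m - f l \<partial>pvm_measure E h) = m * (norm h)\<^sup>2 - x h \<bullet> h"
    using int by (simp add: space_pvm_measure[OF E] measure_pvm_measure_UNIV[OF E])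
  have nn: "AE l in pvm_measure E h. 0 \<le> m - f l" using AE by (rule eventually_mono) simp
  have "(\<integral>l. m - f l \<partial>pvm_measure E h) = 0"
    using integral_nonneg_AE[OF nn] low[of h] eq by simp
  then have "AE l in pvm_measure E h. m - f l = 0"
    using integral_nonneg_eq_0_iff_AE[OF _ nn] int(1) by simp
  with AE have "AE l in pvm_measure E h. False" by eventually_elim simp
  then have "measure (pvm_measure E h) UNIV = 0"
    using AE_iff_measurable[of UNIV "pvm_measure E h" "\<lambda>_. False"]
    by (simp add: space_pvm_measure[OF E] sets_pvm_measure[OF E] measure_def)
  then show "E {l. f l < m} \<xi> = 0" by (simp add: measure_pvm_measure_UNIV[OF E] h_def S_def)
qed

lemma pvm_upper_support:
  assumes x: "has_pvm_integral E UNIV f x" and f: "f \<in> borel_measurable borel"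
    and up: "\<And>h. x h \<bullet> h \<le> M * (norm h)\<^sup>2"
  shows "E {l. M < f l} = (\<lambda>_. 0)"
proof -
  have "E {l. (- 1) * f l < - M} = (\<lambda>_. 0)"
    using f up by (intro pvm_lower_support[OF has_pvm_integral_scale[OF x, of "- 1"]]) auto
  then show ?thesis by simp
qed

lemma AE_pvm_bounds:
  assumes x: "has_pvm_integral E UNIV f x" and f: "f \<in> borel_measurable borel"
    and low: "\<And>h. m * (norm h)\<^sup>2 \<le> x h \<bullet> h" and up: "\<And>h. x h \<bullet> h \<le> M * (norm
        h)\<^sup>2"
  shows "AE l in pvm_measure E \<xi>. f l \<in> {m..M}"
proof -
  have [measurable]: "f \<in> borel_measurable borel" by fact
  have "{l. f l < m} \<in> sets borel" "{l. M < f l} \<in> sets borel" by measurable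
  then have "{l. f l < m} \<in> null_sets (pvm_measure E \<xi>)" "{l. M < f l} \<in> null_sets (pvm_measure E \<xi>)"
    using pvm_lower_support[OF x f low] pvm_upper_support[OF x f up]
    by (auto simp: null_sets_def sets_pvm_measure[OF E] emeasure_pvm_measure[OF E])
  from AE_not_in[OF this(1)] AE_not_in[OF this(2)] show ?thesis by eventually_elim auto
qed

end

section \<open>Spectral measures and functional calculus\<close>

text \<open>The coordinate function is unbounded. Truncating it at the bound of the operator changes
  it only on null sets, and the calculus of bounded functions becomes applicable.\<close>

lemma has_pvm_integral_clamp:
  assumes E: "pvm E" and x: "has_pvm_integral E UNIV f x" and f: "f \<in> borel_measurable borel"
    and bound: "\<And>h. \<bar>x h \<bullet> h\<bar> \<le> C * (norm h)\<^sup>2"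
  shows "has_pvm_integral E UNIV (\<lambda>l. max (- C) (min C (f l))) x"
proof (rule has_pvm_integral_cong_AE[OF E x f])
  have [measurable]: "f \<in> borel_measurable borel" by fact
  show "(\<lambda>l. max (- C) (min C (f l))) \<in> borel_measurable borel" by measurable
  have "- C * (norm h)\<^sup>2 \<le> x h \<bullet> h" "x h \<bullet> h \<le> C * (norm h)\<^sup>2" for h using bound[of
      h] by linarith+
  then show "AE l in pvm_measure E \<xi>. f l = max (- C) (min C (f l))" for \<xi>
    by (rule eventually_mono[OF AE_pvm_bounds[OF E x f]]) auto
qed

text \<open>The essential point is the order of the quantifiers: the polynomials depend only on
  \<open>C\<close> and \<open>s\<close>, not on the operator, its spectral measure or the vector.
  Uniqueness of the spectral measure and its measurability along a field both come from
  this.\<close>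

lemma spectral_atMost_limit:
  assumes C: "C \<ge> 0"
  obtains p where "\<And>(E :: real set \<Rightarrow> 'h::complex_hilbert \<Rightarrow> 'h) x \<xi>. pvm E
      \<Longrightarrow> has_pvm_integral E UNIV (\<lambda>l. l) x \<Longrightarrow>
    (\<And>h. \<bar>x h \<bullet> h\<bar> \<le> C * (norm h)\<^sup>2) \<Longrightarrow>
    (\<lambda>k::nat. op_poly x (p k) \<xi> \<bullet> \<xi>) \<longlonglongrightarrow> measure (pvm_measure E \<xi>) {..s}"
proof -
  obtain p :: "nat \<Rightarrow> real poly" where p: "\<And>l. l \<in> {- C..C} \<Longrightarrow> (\<lambda>k. poly (p
      k) l) \<longlonglongrightarrow> indicator {..s} l"
    "\<And>k l. l \<in> {- C..C} \<Longrightarrow> \<bar>poly (p k) l\<bar> \<le> 2"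
    by (rule polys_tendsto_indicator_atMost[of "- C" C s]) blast
  show thesis
  proof (rule that[of p])
    fix E :: "real set \<Rightarrow> 'h \<Rightarrow> 'h" and x \<xi>
    assume E: "pvm E" and x: "has_pvm_integral E UNIV (\<lambda>l. l) x" and bound: "\<And>h. \<bar>x h \<bullet>
        h\<bar> \<le> C * (norm h)\<^sup>2"
    define c where "c l = max (- C) (min C l)" for l :: real
    have c: "c l \<in> {- C..C}" for l using C by (auto simp: c_def)
    have [measurable]: "c \<in> borel_measurable borel" unfolding c_def by measurable
    have xc: "has_pvm_integral E UNIV c x"
      unfolding c_def by (rule has_pvm_integral_clamp[OF E x _ bound]) simp
    have cC: "\<bar>c l\<bar> \<le> C" for l using c[of l] by auto
    have pk: "op_poly x (p k) \<xi> \<bullet> \<xi> = (\<integral>l. poly (p k) (c l) \<partial>pvm_measure E \<xi>)" for k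
      by (rule has_pvm_integral_inner) (use has_pvm_integral_poly[OF E xc _ cC] in simp)
    interpret finite_measure "pvm_measure E \<xi>" by (rule finite_measure_pvm_measure[OF E])
    have [measurable_cong]: "sets (pvm_measure E \<xi>) = sets borel" by (rule sets_pvm_measure[OF E])
    have [measurable]: "(\<lambda>l. poly (p k) (c l)) \<in> borel_measurable borel" for k
    proof -
      have "continuous_on UNIV (\<lambda>r. poly (p k) r)" by (intro continuous_intros)
      from borel_measurable_continuous_on[OF this \<open>c \<in> borel_measurable borel\<close>] show ?thesis .
    qed
    have "(\<lambda>k. \<integral>l. poly (p k) (c l) \<partial>pvm_measure E \<xi>) \<longlonglongrightarrow>
        (\<integral>l. indicator {..s} (c l) \<partial>pvm_measure E \<xi>)"
    proof (rule integral_dominated_convergence[where w="\<lambda>_. 2"])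
      show "AE l in pvm_measure E \<xi>. (\<lambda>k. poly (p k) (c l)) \<longlonglongrightarrow> indicator {..s} (c l)"
        by (rule AE_I2) (rule p(1)[OF c])
      show "AE l in pvm_measure E \<xi>. norm (poly (p k) (c l)) \<le> 2" for k
        using p(2)[OF c] by simp
    qed auto
    also have "(\<integral>l. indicator {..s} (c l) \<partial>pvm_measure E \<xi>) = (\<integral>l. indicator {..s} l
        \<partial>pvm_measure E \<xi> :: real)"
    proof (rule integral_cong_AE)
      have "- C * (norm h)\<^sup>2 \<le> x h \<bullet> h" "x h \<bullet> h \<le> C * (norm h)\<^sup>2" for h using
          bound[of h] by linarith+
      from AE_pvm_bounds[OF E x _ this] have "AE l in pvm_measure E \<xi>. l \<in> {- C..C}" by simp
      then show "AE l in pvm_measure E \<xi>. (indicator {..s} (c l) :: real) = indicator {..s} l"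
        by (rule eventually_mono) (auto simp: c_def max_def min_def)
    qed auto
    finally show "(\<lambda>k. op_poly x (p k) \<xi> \<bullet> \<xi>) \<longlonglongrightarrow> measure (pvm_measure E
        \<xi>) {..s}"
      unfolding pk by (simp add: space_pvm_measure[OF E])
  qed
qed

lemma bounded_clinear_quadratic_bound:
  assumes "bounded_clinear x"
  obtains C where "C > 0" "\<And>h. \<bar>x h \<bullet> h\<bar> \<le> C * (norm h)\<^sup>2"
proof -
  obtain C where C: "C > 0" "\<And>h. norm (x h) \<le> C * norm h" using bounded_clinear_bound[OF assms] by metis
  have "\<bar>x h \<bullet> h\<bar> \<le> C * (norm h)\<^sup>2" for h
    using Cauchy_Schwarz_ineq2[of "x h" h] mult_right_mono[OF C(2)[of h], of "norm h"]
    by (simp add: power2_eq_square)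
  then show thesis using C(1) by (intro that[of C]) auto
qed

text \<open>Any two candidates give every half-line the limit of the same numbers, which involve
  only the operator.\<close>

lemma spectral_measure_eqI:
  fixes E :: "real set \<Rightarrow> 'h::complex_hilbert \<Rightarrow> 'h"
  assumes E: "pvm E" and x: "has_pvm_integral E UNIV (\<lambda>l. l) x"
  shows "spectral_measure x = E"
  unfolding spectral_measure_def
proof (rule the_equality)
  show "pvm E \<and> has_pvm_integral E UNIV (\<lambda>l. l) x" using assms by blast
  fix F :: "real set \<Rightarrow> 'h \<Rightarrow> 'h" assume F: "pvm F \<and> has_pvm_integral F UNIV (\<lambda>l. l) x"
  obtain C where C: "C > 0" "\<And>h. \<bar>x h \<bullet> h\<bar> \<le> C * (norm h)\<^sup>2"
    using x bounded_clinear_quadratic_bound[of x] unfolding has_pvm_integral_def by metis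
  show "F = E"
  proof (rule pvm_eqI_orthants)
    fix \<xi> s
    obtain p where p: "\<And>(E :: real set \<Rightarrow> 'h \<Rightarrow> 'h) x \<xi>. pvm E \<Longrightarrow>
        has_pvm_integral E UNIV (\<lambda>l. l) x \<Longrightarrow>
      (\<And>h. \<bar>x h \<bullet> h\<bar> \<le> C * (norm h)\<^sup>2) \<Longrightarrow>
      (\<lambda>k::nat. op_poly x (p k) \<xi> \<bullet> \<xi>) \<longlonglongrightarrow> measure (pvm_measure E \<xi>) {..s}"
      using spectral_atMost_limit[of C s, where 'h='h] C(1) by (metis less_imp_le)
    show "measure (pvm_measure F \<xi>) {..s} = measure (pvm_measure E \<xi>) {..s}"
      by (rule LIMSEQ_unique[OF p p]) (use E x F C in auto)
  qed (use E F in auto)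
qed

lemma cart_box_eq_atMost: "{l. \<forall>i. l $ i \<in> {..s $ i}} = {..s::real^'n}"
  by (auto simp: less_eq_vec_def)

text \<open>An affine change of variables reduces to positive contractions; the measure obtained
  there is transported back. Multiplicativity splits a box into slabs in any order of the
  coordinates, and two candidates that agree on orthants are equal, so the definite description is
  met.\<close>

theorem joint_spectral_measure:
  fixes x :: "'n::finite \<Rightarrow> 'h::complex_hilbert \<Rightarrow> 'h"
  assumes sa: "\<And>i. selfadjoint_op (x i)" and comm: "abelian_tuple x"
  shows pvm_joint_spectral_measure: "pvm (joint_spectral_measure x)"
    and has_pvm_integral_joint_component: "has_pvm_integral (joint_spectral_measure x) UNIV (\<lambda>l. l $ i) (x i)"
    and joint_spectral_measure_atMost: "distinct idx \<Longrightarrow> set idx = UNIV \<Longrightarrow>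
      joint_spectral_measure x {..s} = foldr (\<lambda>i b. spectral_measure (x i) {..s $ i} \<circ> b) idx id"
    and pvm_spectral_measure: "pvm (spectral_measure (x i))"
    and has_pvm_integral_spectral_measure: "has_pvm_integral (spectral_measure (x i)) UNIV (\<lambda>l. l) (x i)"
proof -
  note bc = selfadjoint_opD(1)[OF sa]
  have "\<exists>C>0. \<forall>h. \<bar>x i h \<bullet> h\<bar> \<le> C * (norm h)\<^sup>2" for i
    using bounded_clinear_quadratic_bound[OF bc[of i]] by metis
  then obtain c where c: "\<And>i. c i > 0" "\<And>i h. \<bar>x i h \<bullet> h\<bar> \<le> c i * (norm h)\<^sup>2" by metis
  define C where "C = (\<Sum>i\<in>UNIV. c i)"
  have cC: "c i \<le> C" for i unfolding C_def using c(1) by (intro member_le_sum) (auto intro: less_imp_le)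
  have C: "C > 0" unfolding C_def using c(1) by (intro sum_pos) auto
  have bound: "\<bar>x i h \<bullet> h\<bar> \<le> C * (norm h)\<^sup>2" for i h
    using c(2)[of i h] mult_right_mono[OF cC[of i], of "(norm h)\<^sup>2"] by simp
  \<comment> \<open>The affine map taking [-C, C] to [0, 1]; its inverse is the map \<open>g\<close>
    below.\<close>
  define X where "X i h = (1/2) *\<^sub>R h + (1/(2*C)) *\<^sub>R x i h" for i h
  have Xc: "bounded_clinear (X i)" for i
    unfolding X_def by (intro bounded_clinear_add bounded_clinear_scaleR bc) simp
  have Xin: "X i h \<bullet> h = (1/2) * (norm h)\<^sup>2 + (1/(2*C)) * (x i h \<bullet> h)" for i h
    by (simp add: X_def inner_add_left dot_square_norm)
  have bnd: "(1/(2*C)) * \<bar>x i h \<bullet> h\<bar> \<le> (1/2) * (norm h)\<^sup>2" for i h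
    using mult_left_mono[OF bound[of i h], of "1/(2*C)"] C by simp
  have bnd2: "\<bar>(1/(2*C)) * (x i h \<bullet> h)\<bar> \<le> (1/2) * (norm h)\<^sup>2" for i h
    using bnd[of i h] C by (simp add: abs_mult)
  have pos: "positive_op (X i)" for i
    unfolding positive_op_iff
  proof (intro conjI allI)
    show "selfadjoint_op (X i)"
      by (rule selfadjoint_opI[OF Xc]) (simp add: X_def cinner_algebra selfadjoint_opD(2)[OF sa])
    show "0 \<le> Re (cinner (X i h) h)" for h
      unfolding Re_cinner Xin using bnd2[of i h] by linarith
  qed
  have le1: "X i h \<bullet> h \<le> h \<bullet> h" for i h
    unfolding Xin dot_square_norm using bnd2[of i h] by linarith
  have xx: "x i (x j h) = x j (x i h)" for i j h
    using comm unfolding abelian_tuple_def by (metis comp_apply)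
  have XX: "X i (X j h) = X j (X i h)" for i j h
    by (simp add: X_def bounded_clinearD[OF bc] xx algebra_simps)
  obtain idx0 :: "'n list" where idx0: "distinct idx0" "set idx0 = UNIV"
    using finite_distinct_list[of "UNIV :: 'n set"] by auto
  obtain E :: "(real^'n) set \<Rightarrow> 'h \<Rightarrow> 'h" where E: "pvm E" "\<And>\<xi>. AE l in pvm_measure E
      \<xi>. l \<in> cbox 0 1"
    and mom: "\<And>p \<xi>. (\<integral>l. (\<Prod>i\<in>UNIV. poly (p i) (l $ i)) \<partial>pvm_measure E \<xi>) =
      op_prod idx0 (\<lambda>i. op_poly (X i) (p i)) \<xi> \<bullet> \<xi>"
    using joint_pvm_exists[of X idx0, OF pos le1 XX idx0] by blast
  define g where "g l = (\<chi> i. 2 * C * l $ i - C)" for l :: "real^'n"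
  have g: "g \<in> borel_measurable borel"
    unfolding g_def by (intro borel_measurable_continuous_onI continuous_intros)
  define G where "G = pvm_push g E"
  have G: "pvm G" unfolding G_def by (rule pvm_pvm_push[OF E(1) g])
  have comp: "(\<lambda>l::real^'n. l $ i) \<in> borel_measurable borel" for i
    by (intro borel_measurable_continuous_onI continuous_intros)
  have int: "has_pvm_integral G UNIV (\<lambda>l. l $ i) (x i)" for i
    unfolding G_def has_pvm_integral_push[OF E(1) g comp]
  proof -
    \<comment> \<open>The inverse affine map in coordinate \<open>i\<close> and the constant 1
      elsewhere, so that the product polynomial is the single coordinate of
      \<open>g l\<close>.\<close>
    define p where "p j = (if j = i then [:- C, 2 * C:] else 1 :: real poly)" for j
    have P: "(\<Prod>j\<in>UNIV. poly (p j) (l $ j)) = 2 * C * l $ i - C" for l :: "real^'n"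
    proof -
      have "(\<Prod>j\<in>UNIV. poly (p j) (l $ j)) = (\<Prod>j\<in>UNIV. if j = i then 2 * C * l $ i - C else 1)"
        by (intro prod.cong) (auto simp: p_def)
      then show ?thesis by simp
    qed
    have one: "op_poly (X j) (p j) h = h" if "j \<noteq> i" for j h
      using that by (simp add: p_def op_poly_1[OF Xc])
    have xi: "op_poly (X i) (p i) h = x i h" for h
    proof -
      have "X i 0 = 0" using bounded_clinearD(5)[OF Xc] .
      then have "op_poly (X i) (p i) h = - C *\<^sub>R h + (2 * C) *\<^sub>R X i h"
        by (simp add: p_def op_poly_pCons bounded_clinearD[OF Xc])
      also have "\<dots> = x i h" using C by (simp add: X_def scaleR_add_right)
      finally show ?thesis .
    qed
    have "op_prod js (\<lambda>i. op_poly (X i) (p i)) h = (if i \<in> set js then x i h else h)" if "distinct js" for js h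
      using that
    proof (induction js arbitrary: h)
      case (Cons j js)
      then show ?case by (cases "j = i") (auto simp: one xi)
    qed simp
    then have eq: "op_prod idx0 (\<lambda>i. op_poly (X i) (p i)) h = x i h" for h
      using idx0 by simp
    show "has_pvm_integral E UNIV (\<lambda>l. g l $ i) (x i)"
      unfolding has_pvm_integral_UNIV_iff
    proof (intro conjI allI bc)
      fix \<xi>
      have "AE l in pvm_measure E \<xi>. \<bar>g l $ i\<bar> \<le> C"
        using E(2)[of \<xi>]
      proof (rule eventually_mono)
        fix l :: "real^'n" assume "l \<in> cbox 0 1"
        then have "0 \<le> l $ i" "l $ i \<le> 1" by (auto simp: mem_box_cart)
        then have "0 \<le> 2 * C * l $ i" "2 * C * l $ i \<le> 2 * C * 1" using C by (auto intro!: mult_left_mono)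
        then show "\<bar>g l $ i\<bar> \<le> C" by (simp add: g_def abs_le_iff)
      qed
      moreover have "(\<lambda>l. g l $ i) \<in> borel_measurable borel"
        unfolding g_def by (intro borel_measurable_continuous_onI) (simp, intro continuous_intros)
      ultimately show "integrable (pvm_measure E \<xi>) (\<lambda>l. g l $ i)"
        by (rule integrable_pvm_measure_bounded(1)[OF E(1), rotated])
      have "x i \<xi> \<bullet> \<xi> = (\<integral>l. g l $ i \<partial>pvm_measure E \<xi>)"
        using mom[of \<xi> p] unfolding eq P by (simp add: g_def)
      then show "cinner (x i \<xi>) \<xi> = complex_of_real (\<integral>l. g l $ i \<partial>pvm_measure E \<xi>)"
        using selfadjoint_opD(3)[OF sa, of i \<xi>] by (simp add: Re_cinner)
    qed
  qed
  \<comment> \<open>The marginals of the joint measure are the spectral measures of the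
    components.\<close>
  define M where "M i = pvm_push (\<lambda>l. l $ i) G" for i
  have M: "pvm (M i)" "has_pvm_integral (M i) UNIV (\<lambda>l. l) (x i)" for i
    unfolding M_def using has_pvm_integral_push[OF G comp] int by (auto intro: pvm_pvm_push[OF G comp])
  have sm: "spectral_measure (x i) = M i" for i by (rule spectral_measure_eqI[OF M])
  then show "pvm (spectral_measure (x i))" "has_pvm_integral (spectral_measure (x i)) UNIV (\<lambda>l. l) (x i)" for i
    using M by auto
  have box: "G {l. \<forall>i\<in>set js. l $ i \<in> S i} = foldr (\<lambda>i b. spectral_measure (x i) (S i) \<circ>
      b) js id"
    if S: "\<And>i. S i \<in> sets borel" for js S
  proof (induction js)
    case Nil
    then show ?case by (simp add: pvmD(3)[OF G])
  next
    case (Cons j js)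
    have meas: "{l :: real^'n. l $ i \<in> S i} \<in> sets borel" for i
      using measurable_sets[OF comp S[of i]] by (simp add: vimage_def)
    have "{l :: real^'n. \<forall>i\<in>set js. l $ i \<in> S i} = (\<Inter>i\<in>set js. {l. l $ i \<in> S i})
        \<inter> UNIV" by auto
    moreover have "\<dots> \<in> sets borel"
      by (cases "js = []") (auto intro!: sets.finite_INT meas sets.Int)
    ultimately have meas2: "{l :: real^'n. \<forall>i\<in>set js. l $ i \<in> S i} \<in> sets borel" by simp
    have "{l. \<forall>i\<in>set (j # js). l $ i \<in> S i} = {l. l $ j \<in> S j} \<inter> {l. \<forall>i\<in>set js.
        l $ i \<in> S i}" by auto
    then have "G {l. \<forall>i\<in>set (j # js). l $ i \<in> S i} = G {l. l $ j \<in> S j} \<circ> G {l.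
        \<forall>i\<in>set js. l $ i \<in> S i}"
      using pvmD(4)[OF G meas meas2] by simp
    moreover have "G {l. l $ j \<in> S j} = spectral_measure (x j) (S j)"
      using S by (simp add: sm M_def pvm_push_def vimage_def)
    ultimately show ?case using Cons by simp
  qed
  have joint: "joint_spectral_measure x = G"
    unfolding joint_spectral_measure_def
  proof (rule the_equality)
    show "pvm G \<and> (\<forall>S. (\<forall>i. S i \<in> sets borel) \<longrightarrow> (\<forall>is. distinct is
        \<longrightarrow> set is = UNIV \<longrightarrow>
        G {l. \<forall>i. l $ i \<in> S i} = foldr (\<lambda>i b. spectral_measure (x i) (S i) \<circ> b) is id))"
    proof (intro conjI allI impI G)
      fix S :: "'n \<Rightarrow> real set" and js :: "'n list" assume "\<forall>i. S i \<in> sets borel" "set js = UNIV"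
      then show "G {l. \<forall>i. l $ i \<in> S i} = foldr (\<lambda>i b. spectral_measure (x i) (S i) \<circ> b) js id"
        using box[of S js] by simp
    qed
    fix F assume F: "pvm F \<and> (\<forall>S. (\<forall>i. S i \<in> sets borel) \<longrightarrow> (\<forall>is.
        distinct is \<longrightarrow> set is = UNIV \<longrightarrow>
        F {l. \<forall>i. l $ i \<in> S i} = foldr (\<lambda>i b. spectral_measure (x i) (S i) \<circ> b) is id))"
    then have F_box: "F {l. \<forall>i. l $ i \<in> S i} = foldr (\<lambda>i b. spectral_measure (x i) (S i) \<circ> b)
        idx0 id"
      if "\<forall>i. S i \<in> sets borel" for S using that idx0 by blast
    have "F {..s} = G {..s}" for s
    proof -
      have "F {l. \<forall>i. l $ i \<in> {..s $ i}} = foldr (\<lambda>i b. spectral_measure (x i) {..s $ i} \<circ> b)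
          idx0 id"
        by (rule F_box) simp
      also have "\<dots> = G {l. \<forall>i. l $ i \<in> {..s $ i}}"
        using box[of "\<lambda>i. {..s $ i}" idx0] idx0 by simp
      finally show ?thesis unfolding cart_box_eq_atMost .
    qed
    then show "F = G"
      using F G by (intro pvm_eqI_orthants) (auto simp: measure_pvm_measure)
  qed
  show "pvm (joint_spectral_measure x)" "has_pvm_integral (joint_spectral_measure x) UNIV (\<lambda>l. l $ i) (x i)" for i
    using G int joint by auto
  show "joint_spectral_measure x {..s} = foldr (\<lambda>i b. spectral_measure (x i) {..s $ i} \<circ> b) idx id"
    if "distinct idx" "set idx = UNIV" for idx s
    using box[of "\<lambda>i. {..s $ i}" idx] that unfolding joint cart_box_eq_atMost[symmetric] by simp
qed

lemma cart_box_borel: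
  fixes J :: "'n::finite \<Rightarrow> real set"
  assumes "\<And>i. is_interval (J i)"
  shows "{l :: real^'n. \<forall>i. l $ i \<in> J i} \<in> sets borel"
proof -
  have "{l :: real^'n. l $ i \<in> J i} \<in> sets borel" for i
  proof -
    have "(\<lambda>l::real^'n. l $ i) \<in> borel_measurable borel"
      by (intro borel_measurable_continuous_onI continuous_intros)
    from measurable_sets[OF this real_interval_borel_measurable[OF assms]] show ?thesis by (simp add: vimage_def)
  qed
  then have "(\<Inter>i\<in>UNIV. {l :: real^'n. l $ i \<in> J i}) \<in> sets borel" by (intro sets.finite_INT) auto
  moreover have "(\<Inter>i\<in>UNIV. {l :: real^'n. l $ i \<in> J i}) = {l. \<forall>i. l $ i \<in> J i}" by auto
  ultimately show ?thesis by simp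
qed

text \<open>Each interval contains bounds for the form of its operator. The box spanned by these
  bounds is compact, is contained in the possibly non-closed cube, and carries the joint measure, so
  \<open>f\<close> is bounded almost everywhere and its integral exists.\<close>

theorem functional_calculus_integral:
  fixes x :: "'n::finite \<Rightarrow> 'h::complex_hilbert \<Rightarrow> 'h" and J :: "'n \<Rightarrow> real set"
  assumes sa: "\<And>i. selfadjoint_op (x i)" and comm: "abelian_tuple x"
    and J: "\<And>i. is_interval (J i)" and I: "I = {l. \<forall>i. l $ i \<in> J i}" and f: "continuous_on I f"
    and spec: "\<And>i. op_spectrum (x i) \<subseteq> complex_of_real ` J i" and u: "(u::'h) \<noteq> 0"
  shows has_pvm_integral_functional_calculus:
      "has_pvm_integral (joint_spectral_measure x) I f (functional_calculus I f x)"
    and AE_joint_spectral_measure: "AE l in pvm_measure (joint_spectral_measure x) \<xi>. l \<in> I"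
proof -
  define E where "E = joint_spectral_measure x"
  have E: "pvm E" unfolding E_def by (rule pvm_joint_spectral_measure[OF sa comm])
  have comp: "has_pvm_integral E UNIV (\<lambda>l. l $ i) (x i)" for i
    unfolding E_def by (rule has_pvm_integral_joint_component[OF sa comm])
  have "\<exists>m\<in>J i. \<forall>h. m * (norm h)\<^sup>2 \<le> x i h \<bullet> h" for i
    by (rule spectrum_lower_bound[OF sa spec u]) blast
  then obtain m where m: "\<And>i. m i \<in> J i" "\<And>i h. m i * (norm h)\<^sup>2 \<le> x i h \<bullet> h" by metis
  have "\<exists>M\<in>J i. \<forall>h. x i h \<bullet> h \<le> M * (norm h)\<^sup>2" for i
    by (rule spectrum_upper_bound[OF sa spec u]) blast
  then obtain M where M: "\<And>i. M i \<in> J i" "\<And>i h. x i h \<bullet> h \<le> M i * (norm h)\<^sup>2" by metis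
  define K where "K = cbox (\<chi> i. m i) (\<chi> i. M i)"
  have KI: "K \<subseteq> I"
    unfolding K_def I using J m(1) M(1) by (auto simp: mem_box_cart) (meson mem_is_interval_1_I)
  have AE_K: "AE l in pvm_measure E \<xi>. l \<in> K" for \<xi>
  proof -
    have "AE l in pvm_measure E \<xi>. l $ i \<in> {m i..M i}" for i
      by (rule AE_pvm_bounds[OF E comp _ m(2) M(2)]) (intro borel_measurable_continuous_onI continuous_intros)
    then have "AE l in pvm_measure E \<xi>. \<forall>i\<in>UNIV. l $ i \<in> {m i..M i}" by (intro AE_finite_allI) auto
    then show ?thesis by (rule eventually_mono) (auto simp: K_def mem_box_cart)
  qed
  then show "AE l in pvm_measure (joint_spectral_measure x) \<xi>. l \<in> I"
    unfolding E_def[symmetric] by (rule eventually_mono) (use KI in auto)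
  have "compact (f ` K)"
    using continuous_on_subset[OF f KI] by (intro compact_continuous_image) (auto simp: K_def)
  then obtain B where B: "\<And>l. l \<in> K \<Longrightarrow> \<bar>f l\<bar> \<le> B"
    unfolding compact_eq_bounded_closed bounded_iff by auto
  have IB: "I \<in> sets borel" unfolding I by (rule cart_box_borel[OF J])
  have fK: "(\<lambda>l. indicator K l *\<^sub>R f l) \<in> borel_measurable borel"
    by (intro borel_measurable_continuous_on_indicator continuous_on_subset[OF f KI]) (auto simp: K_def)
  have fI: "(\<lambda>l. indicator I l *\<^sub>R f l) \<in> borel_measurable borel"
    by (intro borel_measurable_continuous_on_indicator f IB)
  have "\<bar>indicator K l *\<^sub>R f l\<bar> \<le> max B 0" for l
    using B[of l] by (auto simp: indicator_def)
  from has_pvm_integral_bounded_ex[OF E fK this]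
  obtain b where b: "has_pvm_integral E UNIV (\<lambda>l. indicator K l *\<^sub>R f l) b" by blast
  have "AE l in pvm_measure E \<xi>. indicator K l *\<^sub>R f l = indicator I l *\<^sub>R f l" for \<xi>
    by (rule eventually_mono[OF AE_K]) (use KI in auto)
  from has_pvm_integral_cong_AE[OF E b fK fI this]
  have "has_pvm_integral E UNIV (\<lambda>l. indicator I l *\<^sub>R f l) b" .
  then have "has_pvm_integral E I f b"
    by (simp add: has_pvm_integral_def set_integrable_def set_lebesgue_integral_def)
  moreover have "functional_calculus I f x = b"
    unfolding functional_calculus_def E_def[symmetric]
    by (rule the_equality) (use calculation has_pvm_integral_unique in blast)+
  ultimately show "has_pvm_integral (joint_spectral_measure x) I f (functional_calculus I f x)"
    by (simp add: E_def)
qed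

text \<open>A single operator is treated as a tuple indexed by the one-element type.\<close>

lemma
  assumes "selfadjoint_op x"
  shows pvm_spectral_measure_op: "pvm (spectral_measure x)"
    and spectral_theorem: "has_pvm_integral (spectral_measure x) UNIV (\<lambda>l. l) x"
  using pvm_spectral_measure[of "\<lambda>_::1. x"] has_pvm_integral_spectral_measure[of "\<lambda>_::1. x"] assms
  by (auto simp: abelian_tuple_def)

lemma positive_op_sqrt:
  assumes p: "positive_op p"
  obtains q where "positive_op q" "q \<circ> q = p"
proof -
  have sa: "selfadjoint_op p" and pos: "\<And>h. 0 * (norm h)\<^sup>2 \<le> p h \<bullet> h"
    using p by (auto simp: positive_op_iff Re_cinner)
  define E where "E = spectral_measure p"
  have E: "pvm E" "has_pvm_integral E UNIV (\<lambda>l. l) p"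
    unfolding E_def by (intro pvm_spectral_measure_op spectral_theorem sa)+
  obtain C where C: "C > 0" "\<And>h. \<bar>p h \<bullet> h\<bar> \<le> C * (norm h)\<^sup>2"
    using bounded_clinear_quadratic_bound[OF selfadjoint_opD(1)[OF sa]] by blast
  define f where "f l = max 0 (min C l)" for l :: real
  have f: "0 \<le> f l" "f l \<le> C" for l using C by (auto simp: f_def)
  have [measurable]: "f \<in> borel_measurable borel" unfolding f_def by measurable
  have "p h \<bullet> h \<le> C * (norm h)\<^sup>2" for h using C(2)[of h] by linarith
  from AE_pvm_bounds[OF E _ pos this] have AE: "AE l in pvm_measure E \<xi>. l \<in> {0..C}" for \<xi> by simp
  have "AE l in pvm_measure E \<xi>. l = f l" for \<xi>
    by (rule eventually_mono[OF AE]) (auto simp: f_def)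
  then have fp: "has_pvm_integral E UNIV f p" by (intro has_pvm_integral_cong_AE[OF E]) auto
  have gm: "(\<lambda>l. sqrt (f l)) \<in> borel_measurable borel" by measurable
  have gb: "\<bar>sqrt (f l)\<bar> \<le> sqrt C" for l using f by simp
  obtain q where q: "has_pvm_integral E UNIV (\<lambda>l. sqrt (f l)) q"
    using has_pvm_integral_bounded_ex[OF E(1) gm gb] by blast
  have "has_pvm_integral E UNIV (\<lambda>l. sqrt (f l) * sqrt (f l)) (\<lambda>\<xi>. q (q \<xi>))"
    by (rule has_pvm_integral_mult[OF E(1) q gm gb q gm gb refl])
  then have "(\<lambda>\<xi>. q (q \<xi>)) = p" using f has_pvm_integral_unique[OF _ fp] by simp
  moreover have "positive_op q"
    unfolding positive_op_iff Re_cinner has_pvm_integral_inner[OF q]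
    using has_pvm_integral_selfadjoint[OF q] f by simp
  ultimately show thesis by (intro that[of q]) (auto simp: o_def)
qed

section \<open>Trace class operators\<close>

text \<open>Series and integrals are estimated below by sums of squares. Rescaling to unit vectors
  turns such an estimate into a product bound with twice the constant.\<close>

lemma bounded_sesquilinear_operator':
  fixes B :: "'h::complex_hilbert \<Rightarrow> 'h \<Rightarrow> complex"
  assumes add_left: "\<And>x y z. B (x + y) z = B x z + B y z"
    and add_right: "\<And>x y z. B x (y + z) = B x y + B x z"
    and scale_left: "\<And>c x y. B (c *\<^sub>C x) y = c * B x y"
    and scale_right: "\<And>c x y. B x (c *\<^sub>C y) = cnj c * B x y"
    and bound: "\<And>x y. cmod (B x y) \<le> K * ((norm x)\<^sup>2 + (norm y)\<^sup>2)"
  obtains a where "bounded_clinear a" "\<And>x y. cinner (a x) y = B x y"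
proof (rule bounded_sesquilinear_operator[of B "2 * K", OF add_left add_right scale_left scale_right])
  fix x y
  have "B 0 y = 0" "B x 0 = 0" using scale_left[of 0 0 y] scale_right[of x 0 0] by simp_all
  then show "cmod (B x y) \<le> 2 * K * norm x * norm y"
  proof (cases "x = 0 \<or> y = 0")
    case False
    define u where "u = (1 / norm x) *\<^sub>R x"
    define v where "v = (1 / norm y) *\<^sub>R y"
    have n: "norm u = 1" "norm v = 1" using False by (auto simp: u_def v_def)
    have "x = complex_of_real (norm x) *\<^sub>C u" "y = complex_of_real (norm y) *\<^sub>C v"
      using False by (auto simp: u_def v_def scaleC_of_real)
    then have "B x y = of_real (norm x) * (of_real (norm y) * B u v)"
      by (metis scale_left scale_right complex_cnj_complex_of_real)
    then have "cmod (B x y) = norm x * norm y * cmod (B u v)" by (simp add: norm_mult)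
    also have "\<dots> \<le> norm x * norm y * (2 * K)"
      using bound[of u v] n by (intro mult_left_mono) auto
    finally show ?thesis by (simp add: mult_ac)
  qed auto
qed (use that in blast)

section \<open>Orthonormal bases and the Parseval identity\<close>

definition orthonormal :: "'h::complex_hilbert set \<Rightarrow> bool" where
  "orthonormal B \<longleftrightarrow> (\<forall>e\<in>B. norm e = 1) \<and> (\<forall>e\<in>B. \<forall>e'\<in>B. e
      \<noteq> e' \<longrightarrow> cinner e e' = 0)"

lemma orthonormal_basis_exists: "\<exists>B :: 'h::complex_hilbert set. orthonormal_basis B"
proof -
  have "\<exists>U\<in>Collect orthonormal. \<forall>X\<in>C. X \<subseteq> U" if C: "subset.chain (Collect
      orthonormal) C" for C :: "'h set set"
  proof (intro bexI ballI)
    show "\<Union>C \<in> Collect orthonormal"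
      unfolding mem_Collect_eq orthonormal_def
    proof (intro conjI ballI impI)
      show "norm e = 1" if "e \<in> \<Union>C" for e
        using that C by (auto simp: subset.chain_def orthonormal_def)
      fix e e' assume "e \<in> \<Union>C" "e' \<in> \<Union>C" "e \<noteq> e'"
      moreover from this obtain X Y where XY: "X \<in> C" "Y \<in> C" "e \<in> X" "e' \<in> Y" by blast
      moreover have "X \<subseteq> Y \<or> Y \<subseteq> X" using C XY by (auto simp: subset.chain_def)
      moreover have "orthonormal X" "orthonormal Y" using C XY by (auto simp: subset.chain_def)
      ultimately show "cinner e e' = 0" unfolding orthonormal_def by blast
    qed
  qed auto
  from subset_Zorn[OF this] obtain M :: "'h set" where
    M: "orthonormal M" "\<And>X. orthonormal X \<Longrightarrow> M \<subseteq> X \<Longrightarrow> X = M" by auto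
  have "\<xi> = 0" if \<xi>: "\<forall>e\<in>M. cinner \<xi> e = 0" for \<xi>
  proof (rule ccontr)
    assume nz: "\<xi> \<noteq> 0"
    define u where "u = (1 / norm \<xi>) *\<^sub>R \<xi>"
    have u: "norm u = 1" "\<And>e. e \<in> M \<Longrightarrow> cinner u e = 0"
      using nz \<xi> by (auto simp: u_def cinner_algebra)
    have "cinner e u = 0" if "e \<in> M" for e using u(2)[OF that] cinner_commute[of e u] by simp
    then have "orthonormal (insert u M)" using M(1) u by (auto simp: orthonormal_def)
    then have "u \<in> M" using M(2) by blast
    then have "cinner u u = 0" using u(2) by blast
    then show False using u(1) by (simp add: cinner_self)
  qed
  then show ?thesis using M(1) by (auto simp: orthonormal_basis_def orthonormal_def)
qed

lemma some_onb: "orthonormal_basis some_onb"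
  unfolding some_onb_def by (rule someI_ex[OF orthonormal_basis_exists])

lemma some_onb_norm: "e \<in> some_onb \<Longrightarrow> norm e = 1"
  using some_onb by (auto simp: orthonormal_basis_def)

lemma some_onb_inner: "e \<in> some_onb \<Longrightarrow> f \<in> some_onb \<Longrightarrow> cinner e f = (if e = f
    then 1 else 0)"
  using some_onb by (auto simp: orthonormal_basis_def cinner_self)

lemma some_onb_eqI: "(\<And>e. e \<in> some_onb \<Longrightarrow> cinner \<xi> e = cinner \<eta> e) \<Longrightarrow>
    \<xi> = \<eta>"
  using some_onb unfolding orthonormal_basis_def
  by (metis cinner_diff_left right_minus_eq)

text \<open>Distinct basis vectors are at distance sqrt 2, so points of a dense set within 1/2 of
  each are distinct. Countability is what makes traces of measurable fields measurable.\<close>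

lemma countable_some_onb:
  assumes "separable_space (euclidean :: 'h topology)"
  shows "countable (some_onb :: 'h::complex_hilbert set)"
proof -
  obtain C :: "'h set" where C: "countable C" "closure C = UNIV"
    using assms by (auto simp: separable_space_def)
  have "\<exists>c\<in>C. dist c e < 1/2" for e :: 'h
    using C(2) closure_approachable[of e C] by (metis UNIV_I half_gt_zero_iff zero_less_one)
  then obtain c where c: "\<And>e :: 'h. c e \<in> C" "\<And>e. dist (c e) e < 1/2" by metis
  have "inj_on c (some_onb :: 'h set)"
  proof (rule inj_onI, rule ccontr)
    fix e f :: 'h assume ef: "e \<in> some_onb" "f \<in> some_onb" "c e = c f" "e \<noteq> f"
    have "dist e f < 1"
      using dist_triangle_half_r[of "c e" e 1 f] c(2)[of e] c(2)[of f] ef(3) by simp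
    moreover have "e \<bullet> f = 0" using some_onb_inner[OF ef(1,2)] ef(4) by (simp add: Re_cinner[symmetric])
    then have "(dist e f)\<^sup>2 = 2"
      using some_onb_norm[OF ef(1)] some_onb_norm[OF ef(2)]
      by (simp add: dist_norm power2_norm_eq_inner inner_diff_left inner_diff_right inner_commute norm_eq_1)
    ultimately show False
      by (smt (verit) one_power2 power_mono zero_le_dist)
  qed
  moreover have "countable (c ` (some_onb :: 'h set))"
    by (rule countable_subset[OF _ C(1)]) (use c(1) in blast)
  ultimately show ?thesis using countable_image_inj_on by blast
qed

lemma bessel_inequality:
  assumes F: "finite F" "F \<subseteq> some_onb"
  shows "(\<Sum>e\<in>F. (cmod (cinner \<xi> e))\<^sup>2) \<le> (norm (\<xi> :: 'h::complex_hilbert))\<^sup>2"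
proof -
  define s where "s = (\<Sum>e\<in>F. cinner \<xi> e *\<^sub>C e)"
  define b where "b = (\<Sum>e\<in>F. (cmod (cinner \<xi> e))\<^sup>2)"
  have xs: "cinner \<xi> s = of_real b"
    by (simp add: s_def b_def cinner_sum_right cinner_scaleC_right complex_norm_square[unfolded of_real_power] mult.commute)
  have "cinner s s = (\<Sum>e\<in>F. \<Sum>f\<in>F. cinner \<xi> f * (cnj (cinner \<xi> e) * cinner f e))"
    by (simp add: s_def cinner_sum_right cinner_sum_left cinner_scaleC_right cinner_scaleC_left sum_distrib_left mult_ac)
  also have "\<dots> = (\<Sum>e\<in>F. \<Sum>f\<in>F. if e = f then cinner \<xi> e * cnj (cinner \<xi> e) else 0)"
    using F(2) by (intro sum.cong) (auto simp: some_onb_inner subset_iff)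
  also have "\<dots> = of_real b"
    using F(1) by (simp add: b_def complex_norm_square[unfolded of_real_power])
  finally have ss: "cinner s s = of_real b" .
  have "0 \<le> (norm (\<xi> - s))\<^sup>2" by simp
  also have "\<dots> = (norm \<xi>)\<^sup>2 - 2 * (\<xi> \<bullet> s) + s \<bullet> s"
    by (simp add: power2_norm_eq_inner inner_diff_left inner_diff_right inner_commute)
  also have "\<dots> = (norm \<xi>)\<^sup>2 - b" using xs ss by (simp add: Re_cinner[symmetric])
  finally show ?thesis by (simp add: b_def)
qed

lemma
  shows summable_on_onb_square: "(\<lambda>e. (cmod (cinner \<xi> e))\<^sup>2) summable_on some_onb"
    and infsum_onb_square_le: "(\<Sum>\<^sub>\<infinity>e\<in>some_onb. (cmod (cinner \<xi> e))\<^sup>2) \<le> (norm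
        (\<xi> :: 'h::complex_hilbert))\<^sup>2"
proof -
  show "(\<lambda>e. (cmod (cinner \<xi> e))\<^sup>2) summable_on some_onb"
    by (rule nonneg_bdd_above_summable_on) (auto intro!: bdd_aboveI2 bessel_inequality)
  then show "(\<Sum>\<^sub>\<infinity>e\<in>some_onb. (cmod (cinner \<xi> e))\<^sup>2) \<le> (norm \<xi>)\<^sup>2"
    by (intro infsum_le_finite_sums) (auto intro: bessel_inequality)
qed

lemma norm_product_summable_on:
  fixes a b :: "'e \<Rightarrow> complex"
  assumes "(\<lambda>e. (cmod (a e))\<^sup>2) summable_on A" "(\<lambda>e. (cmod (b e))\<^sup>2) summable_on A"
  shows "(\<lambda>e. cmod (a e * b e)) summable_on A"
    and "(\<Sum>\<^sub>\<infinity>e\<in>A. cmod (a e * b e)) \<le> (\<Sum>\<^sub>\<infinity>e\<in>A. (cmod (a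
        e))\<^sup>2) + (\<Sum>\<^sub>\<infinity>e\<in>A. (cmod (b e))\<^sup>2)"
proof -
  have le: "cmod (a e * b e) \<le> (cmod (a e))\<^sup>2 + (cmod (b e))\<^sup>2" for e
  proof -
    have "2 * (cmod (a e) * cmod (b e)) \<le> (cmod (a e))\<^sup>2 + (cmod (b e))\<^sup>2"
      using sum_squares_bound[of "cmod (a e)" "cmod (b e)"] by (simp add: mult.assoc)
    moreover have "0 \<le> cmod (a e) * cmod (b e)" by simp
    ultimately show ?thesis unfolding norm_mult by linarith
  qed
  have s: "(\<lambda>e. (cmod (a e))\<^sup>2 + (cmod (b e))\<^sup>2) summable_on A" by (rule summable_on_add[OF assms])
  show ab: "(\<lambda>e. cmod (a e * b e)) summable_on A"
    by (rule summable_on_comparison_test[OF s le]) auto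
  show "(\<Sum>\<^sub>\<infinity>e\<in>A. cmod (a e * b e)) \<le> (\<Sum>\<^sub>\<infinity>e\<in>A. (cmod (a
      e))\<^sup>2) + (\<Sum>\<^sub>\<infinity>e\<in>A. (cmod (b e))\<^sup>2)"
    unfolding infsum_add[OF assms, symmetric] by (rule infsum_mono[OF ab s le])
qed

text \<open>The form on the left defines an operator by the Riesz theorem, and this operator agrees with
  the identity on the basis.\<close>

lemma parseval:
  fixes \<xi> \<eta> :: "'h::complex_hilbert"
  shows "(\<lambda>e. cmod (cinner \<xi> e * cinner e \<eta>)) summable_on some_onb"
    and "(\<Sum>\<^sub>\<infinity>e\<in>some_onb. cinner \<xi> e * cinner e \<eta>) = cinner \<xi> \<eta>"
proof -
  have sq: "(\<lambda>e. (cmod (cinner e \<eta>))\<^sup>2) summable_on some_onb"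
    "(\<Sum>\<^sub>\<infinity>e\<in>some_onb. (cmod (cinner e \<eta>))\<^sup>2) \<le> (norm \<eta>)\<^sup>2" for \<eta> :: 'h
    using summable_on_onb_square[of \<eta>] infsum_onb_square_le[of \<eta>]
    by (metis (no_types, lifting) cinner_commute complex_mod_cnj infsum_cong summable_on_cong)+
  show abs: "(\<lambda>e. cmod (cinner \<xi> e * cinner e \<eta>)) summable_on some_onb" for \<xi> \<eta> :: 'h
    by (rule norm_product_summable_on(1)[OF summable_on_onb_square sq(1)])
  define P where "P \<xi> \<eta> = (\<Sum>\<^sub>\<infinity>e\<in>some_onb. cinner \<xi> e * cinner e \<eta>)" for
      \<xi> \<eta> :: 'h
  note sm = abs_summable_summable[OF abs]
  have "cmod (P \<xi> \<eta>) \<le> 1 * ((norm \<xi>)\<^sup>2 + (norm \<eta>)\<^sup>2)" for \<xi> \<eta>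
  proof -
    have "cmod (P \<xi> \<eta>) \<le> (\<Sum>\<^sub>\<infinity>e\<in>some_onb. cmod (cinner \<xi> e * cinner e \<eta>))"
      unfolding P_def by (rule norm_infsum_bound[OF abs])
    also have "\<dots> \<le> (norm \<xi>)\<^sup>2 + (norm \<eta>)\<^sup>2"
      using norm_product_summable_on(2)[OF summable_on_onb_square[of \<xi>] sq(1)[of \<eta>]]
        infsum_onb_square_le[of \<xi>] sq(2)[of \<eta>] by linarith
    finally show ?thesis by simp
  qed
  moreover have "P (x + y) z = P x z + P y z" "P z (x + y) = P z x + P z y" for x y z
    unfolding P_def by (simp_all add: cinner_algebra distrib_left distrib_right infsum_add[OF sm sm])
  moreover have "P (c *\<^sub>C x) y = c * P x y" "P x (c *\<^sub>C y) = cnj c * P x y" for c x y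
    unfolding P_def by (simp_all add: cinner_algebra mult.assoc mult.left_commute[of _ "cnj c"] infsum_cmult_right')
  ultimately obtain a where a: "\<And>\<xi> \<eta>. cinner (a \<xi>) \<eta> = P \<xi> \<eta>"
    using bounded_sesquilinear_operator'[of P 1] by metis
  have "a \<xi> = \<xi>" for \<xi>
  proof (rule some_onb_eqI)
    fix f :: 'h assume f: "f \<in> some_onb"
    have "P \<xi> f = (\<Sum>\<^sub>\<infinity>e\<in>{f}. cinner \<xi> e * cinner e f)"
      unfolding P_def by (rule infsum_cong_neutral) (use f in \<open>auto simp: some_onb_inner\<close>)
    then show "cinner (a \<xi>) f = cinner \<xi> f" using f by (simp add: a some_onb_inner)
  qed
  then show "(\<Sum>\<^sub>\<infinity>e\<in>some_onb. cinner \<xi> e * cinner e \<eta>) = cinner \<xi> \<eta>"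
    using a[of \<xi> \<eta>] by (simp add: P_def)
qed

lemma parseval_norm: "((\<lambda>e. (cmod (cinner \<xi> e))\<^sup>2) has_sum (norm (\<xi> ::
    'h::complex_hilbert))\<^sup>2) some_onb"
proof -
  have eq: "cinner \<xi> e * cinner e \<xi> = of_real ((cmod (cinner \<xi> e))\<^sup>2)" for e
    by (metis cinner_commute complex_norm_square)
  have "((\<lambda>e. of_real ((cmod (cinner \<xi> e))\<^sup>2)) has_sum complex_of_real ((norm \<xi>)\<^sup>2)) some_onb"
    using has_sum_infsum[OF abs_summable_summable[OF parseval(1)[of \<xi> \<xi>]], unfolded parseval(2)]
    unfolding eq cinner_self .
  then show ?thesis by (simp only: has_sum_of_real_iff)
qed

section \<open>Hilbert-Schmidt operators and traces\<close>

definition hilbert_schmidt :: "('h::complex_hilbert \<Rightarrow> 'h) \<Rightarrow> bool" where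
  "hilbert_schmidt x \<longleftrightarrow> bounded_clinear x \<and> (\<lambda>e. (norm (x e))\<^sup>2) summable_on some_onb"

lemma hilbert_schmidt_matrix:
  assumes "hilbert_schmidt x"
  shows "(\<lambda>(e, f). (cmod (cinner (x e) f))\<^sup>2) summable_on some_onb \<times> some_onb"
proof (rule summable_on_SigmaI[where g="\<lambda>e. (norm (x e))\<^sup>2"])
  show "((\<lambda>f. case (e, f) of (e, f) \<Rightarrow> (cmod (cinner (x e) f))\<^sup>2) has_sum (norm (x
      e))\<^sup>2) some_onb" for e
    using parseval_norm by simp
qed (use assms in \<open>auto simp: hilbert_schmidt_def\<close>)

text \<open>Passing to the adjoint transposes and conjugates the matrix, which leaves the double sum
  of squares unchanged.\<close>

lemma hilbert_schmidt_cadjoint: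
  fixes x :: "'h::complex_hilbert \<Rightarrow> 'h"
  assumes x: "hilbert_schmidt x"
  shows "hilbert_schmidt (cadjoint x)"
proof -
  have bc: "bounded_clinear x" using x by (simp add: hilbert_schmidt_def)
  have "(\<lambda>(f, e). (cmod (cinner (cadjoint x f) e))\<^sup>2) summable_on some_onb \<times> some_onb"
  proof -
    have "(\<lambda>(e, f). (cmod (cinner (x e) f))\<^sup>2) \<circ> prod.swap = (\<lambda>(f, e). (cmod (cinner
        (cadjoint x f) e))\<^sup>2)"
      by (auto simp: fun_eq_iff cinner_cadjoint_left[OF bc]) (metis cinner_commute complex_mod_cnj)
    moreover have "prod.swap ` (some_onb \<times> some_onb) = (some_onb \<times> some_onb :: ('h \<times> 'h) set)"
      by (rule product_swap)
    moreover have "inj_on prod.swap (some_onb \<times> some_onb :: ('h \<times> 'h) set)" by simp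
    ultimately show ?thesis
      using hilbert_schmidt_matrix[OF x] summable_on_reindex[of prod.swap "some_onb \<times> some_onb :: ('h \<times>
          'h) set"
        "\<lambda>(e, f). (cmod (cinner (x e) f))\<^sup>2"] by metis
  qed
  from summable_on_Sigma_banach[OF this]
  have "(\<lambda>f. (norm (cadjoint x f))\<^sup>2) summable_on some_onb" by (simp only: infsumI[OF parseval_norm] prod.case)
  then show ?thesis using bounded_clinear_cadjoint[OF bc] by (simp add: hilbert_schmidt_def)
qed

lemma hilbert_schmidt_trace_swap:
  fixes x y :: "'h::complex_hilbert \<Rightarrow> 'h"
  assumes x: "hilbert_schmidt x" and y: "hilbert_schmidt y"
  shows "(\<Sum>\<^sub>\<infinity>e\<in>some_onb. cinner (x e) (y e)) =
    (\<Sum>\<^sub>\<infinity>f\<in>some_onb. cinner (cadjoint y f) (cadjoint x f))"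
proof -
  have bx: "bounded_clinear x" and yc: "bounded_clinear y" using x y by (auto simp: hilbert_schmidt_def)
  have "(\<lambda>p. cmod (cinner (x (fst p)) (snd p) * cinner (snd p) (y (fst p)))) summable_on some_onb \<times> some_onb"
  proof (rule norm_product_summable_on)
    show "(\<lambda>p. (cmod (cinner (x (fst p)) (snd p)))\<^sup>2) summable_on some_onb \<times> some_onb"
      using hilbert_schmidt_matrix[OF x] unfolding case_prod_unfold .
    have "cmod (cinner f e) = cmod (cinner e f)" for e f :: 'h by (metis cinner_commute complex_mod_cnj)
    then show "(\<lambda>p. (cmod (cinner (snd p) (y (fst p))))\<^sup>2) summable_on some_onb \<times> some_onb"
      using hilbert_schmidt_matrix[OF y] unfolding case_prod_unfold by simp
  qed
  from abs_summable_summable[OF this]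
  have sm: "(\<lambda>(e, f). cinner (x e) f * cinner f (y e)) summable_on some_onb \<times> some_onb"
    unfolding case_prod_unfold .
  have "(\<Sum>\<^sub>\<infinity>e\<in>some_onb. cinner (x e) (y e)) = (\<Sum>\<^sub>\<infinity>e\<in>some_onb.
      \<Sum>\<^sub>\<infinity>f\<in>some_onb. cinner (x e) f * cinner f (y e))"
    by (simp add: parseval(2))
  also have "\<dots> = (\<Sum>\<^sub>\<infinity>f\<in>some_onb. \<Sum>\<^sub>\<infinity>e\<in>some_onb. cinner (x e) f
      * cinner f (y e))"
    by (rule infsum_swap_banach[OF sm])
  also have "\<dots> = (\<Sum>\<^sub>\<infinity>f\<in>some_onb. \<Sum>\<^sub>\<infinity>e\<in>some_onb. cinner
      (cadjoint y f) e * cinner e (cadjoint x f))"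
    by (simp add: cinner_cadjoint_left[OF yc] cinner_cadjoint_right[OF bx] mult.commute)
  finally show ?thesis by (simp add: parseval(2))
qed

text \<open>Cyclicity of the trace for the Hilbert-Schmidt pair \<open>u \<circ> q\<close> and
  \<open>q \<circ> c\<close>. The result evaluates \<open>c\<close> only between vectors that do not
  depend on \<open>c\<close>, with square-summable norms, so it can be integrated over a
  field.\<close>

lemma trace_factorization:
  assumes q: "positive_op q" and hs: "hilbert_schmidt q" and u: "bounded_clinear u" and c: "bounded_clinear c"
  shows "op_trace ((u \<circ> q \<circ> q) \<circ> c) = (\<Sum>\<^sub>\<infinity>f\<in>some_onb. cinner (c (u (q f))) (q f))"
proof -
  have qc: "bounded_clinear q" and qa: "cadjoint q = q" using q by (auto simp: positive_op_iff selfadjoint_op_def)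
  have hs_left: "hilbert_schmidt (b \<circ> q)" if b: "bounded_clinear b" for b
  proof -
    obtain K where K: "K > 0" "\<And>h. norm (b h) \<le> K * norm h" using bounded_clinear_bound[OF b] by metis
    have le: "(norm (b (q e)))\<^sup>2 \<le> K\<^sup>2 * (norm (q e))\<^sup>2" for e
      using power_mono[OF K(2)[of "q e"], of 2] by (simp add: power_mult_distrib)
    have sm: "(\<lambda>e. K\<^sup>2 * (norm (q e))\<^sup>2) summable_on some_onb"
      using hs by (intro summable_on_cmult_right) (simp add: hilbert_schmidt_def)
    have "(\<lambda>e. (norm (b (q e)))\<^sup>2) summable_on some_onb"
      by (rule summable_on_comparison_test[OF sm le]) simp
    then show ?thesis using b qc by (auto simp: hilbert_schmidt_def)
  qed
  have qs: "cinner x (q y) = cinner (q x) y" for x y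
    using selfadjoint_opD(2)[of q x y] q by (simp add: positive_op_iff)
  note ua = bounded_clinear_cadjoint[OF u] and ca = bounded_clinear_cadjoint[OF c]
  have X: "cadjoint (cadjoint c \<circ> q) = q \<circ> c"
    by (simp add: cadjoint_comp[OF ca qc] cadjoint_cadjoint[OF c] qa)
  have X': "cadjoint (q \<circ> c) = cadjoint c \<circ> q" by (simp add: cadjoint_comp[OF qc c] qa)
  have Y: "cadjoint (u \<circ> q) = q \<circ> cadjoint u" by (simp add: cadjoint_comp[OF u qc] qa)
  have Y': "cadjoint (q \<circ> cadjoint u) = u \<circ> q"
    by (simp add: cadjoint_comp[OF qc ua] cadjoint_cadjoint[OF u] qa)
  have hsx: "hilbert_schmidt (q \<circ> c)" using hilbert_schmidt_cadjoint[OF hs_left[OF ca]] unfolding X .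
  have hsy: "hilbert_schmidt (q \<circ> cadjoint u)" using hilbert_schmidt_cadjoint[OF hs_left[OF u]] unfolding Y .
  have "op_trace ((u \<circ> q \<circ> q) \<circ> c) = (\<Sum>\<^sub>\<infinity>e\<in>some_onb. cinner ((q \<circ> c)
      e) ((q \<circ> cadjoint u) e))"
    unfolding op_trace_def comp_apply qs cinner_cadjoint_right[OF u] ..
  also have "\<dots> = (\<Sum>\<^sub>\<infinity>f\<in>some_onb. cinner ((u \<circ> q) f) ((cadjoint c \<circ> q) f))"
    using hilbert_schmidt_trace_swap[OF hsx hsy] unfolding X' Y' .
  finally show ?thesis by (simp add: cinner_cadjoint_right[OF c])
qed

text \<open>The factor \<open>u\<close> is the adjoint of a map \<open>v\<close>. Since \<rho> and
  \<open>p\<close> have equal norms on every vector, each functional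
  \<open>\<lambda>h. \<rho> h \<bullet> k\<close> factors through \<open>p\<close>, and
  \<open>v k\<close> represents it inside the closure of the range of \<open>p\<close>.\<close>

lemma polar_factorization:
  fixes \<rho> p :: "'h::complex_hilbert \<Rightarrow> 'h"
  assumes \<rho>: "bounded_clinear \<rho>" and p: "positive_op p" and eq: "p \<circ> p = cadjoint \<rho> \<circ> \<rho>"
  obtains u where "bounded_clinear u" "\<And>h. norm (u h) \<le> norm h" "\<rho> = u \<circ> p"
proof -
  have ps: "selfadjoint_op p" using p by (simp add: positive_op_iff)
  note pc = selfadjoint_opD(1)[OF ps]
  have norm_eq: "norm (p h) = norm (\<rho> h)" for h
  proof -
    have "cinner (p h) (p h) = cinner (\<rho> h) (\<rho> h)"
      using selfadjoint_opD(2)[OF ps, of h "p h"] fun_cong[OF eq, of h] cinner_cadjoint_right[OF \<rho>, of h "\<rho>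
          h"] by simp
    then show ?thesis by (simp add: cinner_self del: of_real_power)
  qed
  have "\<exists>g. g \<in> closure (range p) \<and> (\<forall>h. \<rho> h \<bullet> k = p h \<bullet> g) \<and> norm g
      \<le> norm k" for k
  proof (rule riesz_factorization[of p "\<lambda>h. \<rho> h \<bullet> k" "norm k"])
    show "linear p" using bounded_clinearD(1)[OF pc] by (rule bounded_linear.linear)
    show "linear (\<lambda>h. \<rho> h \<bullet> k)"
      by (rule linearI) (simp_all add: bounded_clinearD[OF \<rho>] inner_add_left)
    show "\<bar>\<rho> h \<bullet> k\<bar> \<le> norm k * norm (p h)" for h
      using Cauchy_Schwarz_ineq2[of "\<rho> h" k] by (simp add: norm_eq mult.commute)
  qed auto
  then obtain v where v: "\<And>k. v k \<in> closure (range p)" "\<And>k h. \<rho> h \<bullet> k = p h \<bullet> v k"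
      "\<And>k. norm (v k) \<le> norm k"
    by metis
  have cv: "cinner (\<rho> h) k = cinner (p h) (v k)" for h k
  proof (rule complex_eqI)
    show "Re (cinner (\<rho> h) k) = Re (cinner (p h) (v k))" by (simp add: Re_cinner v(2))
    have "(\<i> *\<^sub>C \<rho> h) \<bullet> k = (\<i> *\<^sub>C p h) \<bullet> v k"
      using v(2)[of "\<i> *\<^sub>C h" k] by (simp add: bounded_clinearD[OF \<rho>] bounded_clinearD[OF pc])
    then show "Im (cinner (\<rho> h) k) = Im (cinner (p h) (v k))" by (simp add: inner_scaleC_ii)
  qed
  \<comment> \<open>Uniqueness of the representing vector within the closure of the range; linearity
    of \<open>v\<close> is deduced from it.\<close>
  have zero: "d = 0" if d: "d \<in> closure (range p)" "\<And>h. cinner (p h) d = 0" for d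
  proof -
    obtain s where s: "\<And>n. s n \<in> range p" "s \<longlonglongrightarrow> d" using d(1) by (auto simp:
        closure_sequential)
    have "(\<lambda>n. cinner (s n) d) \<longlonglongrightarrow> cinner d d" by (intro tendsto_intros s)
    moreover have "cinner (s n) d = 0" for n using s(1)[of n] d(2) by auto
    ultimately have "cinner d d = 0" by (simp add: LIMSEQ_const_iff)
    then show ?thesis by (simp add: cinner_self)
  qed
  have cl_add: "g + g' \<in> closure (range p)" if gg: "g \<in> closure (range p)" "g' \<in> closure (range p)" for g g'
  proof -
    obtain s where s: "\<And>n. s n \<in> range p" "s \<longlonglongrightarrow> g" using gg(1) by (auto simp:
        closure_sequential)
    obtain s' where s': "\<And>n. s' n \<in> range p" "s' \<longlonglongrightarrow> g'" using gg(2) by (auto simp: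
        closure_sequential)
    have "s n + s' n \<in> range p" for n
    proof -
      obtain h h' where "s n = p h" "s' n = p h'" using s(1)[of n] s'(1)[of n] by blast
      then have "s n + s' n = p (h + h')" by (simp add: bounded_clinearD[OF pc])
      then show ?thesis by simp
    qed
    then show ?thesis
      unfolding closure_sequential using tendsto_add[OF s(2) s'(2)] by (intro exI[of _ "\<lambda>n. s n + s' n"]) auto
  qed
  have cl_scale: "c *\<^sub>C g \<in> closure (range p)" if gg: "g \<in> closure (range p)" for c g
  proof -
    obtain s where s: "\<And>n. s n \<in> range p" "s \<longlonglongrightarrow> g" using gg by (auto simp:
        closure_sequential)
    have "c *\<^sub>C s n \<in> range p" for n
    proof -
      obtain h where "s n = p h" using s(1)[of n] by blast
      then have "c *\<^sub>C s n = p (c *\<^sub>C h)" by (simp add: bounded_clinearD[OF pc])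
      then show ?thesis by simp
    qed
    then show ?thesis
      unfolding closure_sequential using tendsto_scaleC[OF s(2)] by (intro exI[of _ "\<lambda>n. c *\<^sub>C s n"]) auto
  qed
  have cl_diff: "g - g' \<in> closure (range p)" if "g \<in> closure (range p)" "g' \<in> closure (range p)" for g g'
    using cl_add[OF that(1) cl_scale[OF that(2), of "complex_of_real (- 1)"]] by (simp add: scaleC_of_real del:
        of_real_minus)
  have "bounded_clinear v"
  proof (rule bounded_clinearI[of _ 1])
    fix k k' c
    have "v (k + k') - (v k + v k') = 0"
      by (rule zero) (auto intro!: cl_diff cl_add v simp: cinner_diff_right cinner_add_right cv[symmetric])
    then show "v (k + k') = v k + v k'" by simp
    have "v (c *\<^sub>C k) - c *\<^sub>C v k = 0"
      by (rule zero) (auto intro!: cl_diff cl_scale v simp: cinner_diff_right cinner_scaleC_right cv[symmetric])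
    then show "v (c *\<^sub>C k) = c *\<^sub>C v k" by simp
  qed (use v in auto)
  note u = bounded_clinear_cadjoint[OF this] cinner_cadjoint_left[OF this]
  show thesis
  proof (rule that[OF u(1)])
    show "norm (cadjoint v h) \<le> norm h" for h
    proof (cases "cadjoint v h = 0")
      case False
      have "(norm (cadjoint v h))\<^sup>2 = cmod (cinner h (v (cadjoint v h)))"
        by (simp add: u(2)[symmetric] cinner_self norm_power)
      also have "\<dots> \<le> norm h * norm (v (cadjoint v h))" by (rule cmod_cinner_le)
      also have "\<dots> \<le> norm h * norm (cadjoint v h)" by (intro mult_left_mono v) auto
      finally show ?thesis using False by (simp add: power2_eq_square)
    qed simp
    show "\<rho> = cadjoint v \<circ> p"
    proof
      fix h show "\<rho> h = (cadjoint v \<circ> p) h"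
        by (rule cinner_eqI) (simp add: u(2) cv)
    qed
  qed
qed

lemma sqrt_hilbert_schmidt:
  assumes p: "positive_op p" and sm: "(\<lambda>e. cinner (p e) e) summable_on some_onb"
  obtains q where "positive_op q" "q \<circ> q = p" "hilbert_schmidt q" "\<And>e. cinner (p e) e = of_real ((norm (q
      e))\<^sup>2)"
proof -
  obtain q where q: "positive_op q" "q \<circ> q = p" using positive_op_sqrt[OF p] by blast
  have eq: "cinner (p e) e = of_real ((norm (q e))\<^sup>2)" for e
    using q selfadjoint_opD(2)[of q "q e" e] by (auto simp: positive_op_iff cinner_self simp del: of_real_power)
  have "(\<lambda>e. (norm (q e))\<^sup>2) summable_on some_onb"
    using summable_on_Re[OF sm] unfolding eq by simp
  then have "hilbert_schmidt q" using q(1) by (simp add: hilbert_schmidt_def positive_op_def)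
  then show thesis using q eq by (intro that[of q])
qed

text \<open>With \<open>q\<close> a square root of the absolute value and \<open>u\<close> the polar
  factor, the vectors are \<open>u (q f)\<close> and \<open>q f\<close>. Functionals of trace class
  become sums of vector functionals.\<close>

lemma trace_class_factorization:
  fixes \<rho> :: "'h::complex_hilbert \<Rightarrow> 'h"
  assumes "trace_class \<rho>"
  obtains \<alpha> \<beta> :: "'h \<Rightarrow> 'h" where "\<And>f. norm (\<alpha> f) \<le> norm (\<beta> f)"
      "(\<lambda>f. (norm (\<beta> f))\<^sup>2) summable_on some_onb"
    "\<And>c. bounded_clinear c \<Longrightarrow> op_trace (\<rho> \<circ> c) =
        (\<Sum>\<^sub>\<infinity>f\<in>some_onb. cinner (c (\<alpha> f)) (\<beta> f))"
proof -
  obtain p where p: "positive_op p" "p \<circ> p = cadjoint \<rho> \<circ> \<rho>" "(\<lambda>e. cinner (p e) e)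
      summable_on some_onb"
    and \<rho>: "bounded_clinear \<rho>" using assms by (auto simp: trace_class_def)
  obtain q where q: "positive_op q" "q \<circ> q = p" "hilbert_schmidt q" using sqrt_hilbert_schmidt[OF p(1,3)] by metis
  obtain u where u: "bounded_clinear u" "\<And>h. norm (u h) \<le> norm h" "\<rho> = u \<circ> p"
    using polar_factorization[OF \<rho> p(1,2)] by metis
  show thesis
  proof (rule that[of "\<lambda>f. u (q f)" q])
    show "op_trace (\<rho> \<circ> c) = (\<Sum>\<^sub>\<infinity>f\<in>some_onb. cinner (c (u (q f))) (q f))" if
        "bounded_clinear c" for c
      using trace_factorization[OF q(1,3) u(1) that] by (simp add: u(3) q(2)[symmetric] comp_assoc)
  qed (use q u in \<open>auto simp: hilbert_schmidt_def\<close>)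
qed

lemma density_op_factorization:
  fixes \<rho> :: "'h::complex_hilbert \<Rightarrow> 'h"
  assumes "density_op \<rho>"
  obtains \<beta> :: "'h \<Rightarrow> 'h" where "((\<lambda>f. (norm (\<beta> f))\<^sup>2) has_sum 1) some_onb"
    "\<And>c. bounded_clinear c \<Longrightarrow> op_trace (\<rho> \<circ> c) =
        (\<Sum>\<^sub>\<infinity>f\<in>some_onb. cinner (c (\<beta> f)) (\<beta> f))"
proof -
  have \<rho>: "positive_op \<rho>" "op_trace \<rho> = 1" using assms by (auto simp: density_op_def)
  \<comment> \<open>Summability is read off from the value of the trace: an infinite sum that does
    not exist has the value 0 and not 1.\<close>
  have sm: "(\<lambda>e. cinner (\<rho> e) e) summable_on some_onb"
    using \<rho>(2) infsum_not_exists unfolding op_trace_def by fastforce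
  obtain q where q: "positive_op q" "q \<circ> q = \<rho>" "hilbert_schmidt q"
    and eq: "\<And>e. cinner (\<rho> e) e = of_real ((norm (q e))\<^sup>2)" using sqrt_hilbert_schmidt[OF \<rho>(1) sm]
        by metis
  have "((\<lambda>e. of_real ((norm (q e))\<^sup>2)) has_sum complex_of_real 1) some_onb"
    using has_sum_infsum[OF sm] \<rho>(2) unfolding op_trace_def eq by simp
  then have "((\<lambda>e. (norm (q e))\<^sup>2) has_sum 1) some_onb" by (simp only: has_sum_of_real_iff)
  moreover have "op_trace (\<rho> \<circ> c) = (\<Sum>\<^sub>\<infinity>f\<in>some_onb. cinner (c (q f)) (q f))" if
      "bounded_clinear c" for c
    using trace_factorization[OF q(1,3) bounded_clinear_id(1) that] q(2) by simp
  ultimately show thesis by (rule that)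
qed

text \<open>Vector states are among the states in the definition of integrability, which connects
  traces with inner products.\<close>

lemma
  fixes \<eta> :: "'h::complex_hilbert"
  defines "\<rho> \<equiv> \<lambda>\<zeta>. cinner \<zeta> \<eta> *\<^sub>C \<eta>"
  assumes \<eta>: "norm \<eta> = 1"
  shows density_op_rank_one: "density_op \<rho>"
    and op_trace_rank_one: "bounded_clinear c \<Longrightarrow> op_trace (\<rho> \<circ> c) = cinner (c \<eta>) \<eta>"
proof -
  have tr: "op_trace (\<rho> \<circ> c) = cinner (c \<eta>) \<eta>" if c: "bounded_clinear c" for c
  proof -
    have "op_trace (\<rho> \<circ> c) = (\<Sum>\<^sub>\<infinity>e\<in>some_onb. cinner \<eta> e * cinner e (cadjoint c
        \<eta>))"
      unfolding op_trace_def
      by (intro infsum_cong) (simp add: \<rho>_def cinner_scaleC_left cinner_cadjoint_right[OF c])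
    then show ?thesis unfolding parseval(2) by (simp add: cinner_cadjoint_right[OF c])
  qed
  then show "bounded_clinear c \<Longrightarrow> op_trace (\<rho> \<circ> c) = cinner (c \<eta>) \<eta>" .
  have bc: "bounded_clinear \<rho>"
  proof (rule bounded_clinearI[of _ 1])
    show "norm (\<rho> x) \<le> 1 * norm x" for x using cmod_cinner_le[of x \<eta>] \<eta> by (simp add: \<rho>_def
        norm_scaleC)
  qed (simp_all add: \<rho>_def cinner_algebra scaleC_add_left scaleC_scaleC)
  have pd: "cinner (\<rho> x) x = of_real ((cmod (cinner x \<eta>))\<^sup>2)" for x
    by (simp add: \<rho>_def cinner_scaleC_left) (metis cinner_commute complex_norm_square of_real_power)
  have pos: "positive_op \<rho>" using bc by (simp add: positive_op_def pd complex_nonneg_Reals_iff del: of_real_power)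
  have "\<rho> \<circ> \<rho> = cadjoint \<rho> \<circ> \<rho>" using pos by (simp add: positive_op_iff selfadjoint_op_def)
  moreover have "(\<lambda>e. cinner (\<rho> e) e) summable_on some_onb"
    using abs_summable_summable[OF parseval(1)[of \<eta> \<eta>]] by (simp add: \<rho>_def cinner_scaleC_left mult.commute)
  ultimately have "trace_class \<rho>" using bc pos by (auto simp: trace_class_def)
  moreover have "op_trace \<rho> = 1" using tr[OF bounded_clinear_id(1)] \<eta> by (simp add: cinner_self)
  ultimately show "density_op \<rho>" using pos by (simp add: density_op_def)
qed

section \<open>Integrals of operator fields\<close>

text \<open>Transfers a sum over a countable set to a series, to which limit theorems for sequences
  apply. Positions outside the image of the enumeration, present when the set is finite, contribute
  0.\<close>

lemma countable_has_sum_sums: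
  fixes f :: "'e \<Rightarrow> complex"
  assumes A: "countable A" and f: "(f has_sum S) A"
  shows "(\<lambda>n. if n \<in> to_nat_on A ` A then f (from_nat_into A n) else 0) sums S"
proof -
  have inj: "inj_on (to_nat_on A) A" using A by (rule inj_on_to_nat_on)
  have "((\<lambda>n. f (from_nat_into A n)) \<circ> to_nat_on A has_sum S) A"
    using f by (subst has_sum_cong[where g=f]) (auto simp: A)
  then have "((\<lambda>n. f (from_nat_into A n)) has_sum S) (to_nat_on A ` A)"
    using has_sum_reindex[OF inj] by blast
  then have "((\<lambda>n. if n \<in> to_nat_on A ` A then f (from_nat_into A n) else 0) has_sum S) UNIV"
    by (rule has_sum_cong_neutral[THEN iffD1, rotated -1]) auto
  then show ?thesis by (rule has_sum_imp_sums)
qed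

lemma borel_measurable_infsum_countable:
  fixes f :: "'e \<Rightarrow> 't \<Rightarrow> complex"
  assumes A: "countable A" and f: "\<And>e. e \<in> A \<Longrightarrow> f e \<in> borel_measurable M"
    and sm: "\<And>t. (\<lambda>e. f e t) summable_on A"
  shows "(\<lambda>t. \<Sum>\<^sub>\<infinity>e\<in>A. f e t) \<in> borel_measurable M"
proof (rule borel_measurable_LIMSEQ_metric)
  define g where "g n t = (if n \<in> to_nat_on A ` A then f (from_nat_into A n) t else 0)" for n t
  have "g n \<in> borel_measurable M" for n
  proof (cases "n \<in> to_nat_on A ` A")
    case True
    then have "from_nat_into A n \<in> A" using A by auto
    then show ?thesis using True f by (simp add: g_def[abs_def])
  next
    case False
    then show ?thesis by (simp add: g_def[abs_def])
  qed
  then show "(\<lambda>t. \<Sum>i<n. g i t) \<in> borel_measurable M" for n by (intro borel_measurable_sum) auto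
  show "(\<lambda>n. \<Sum>i<n. g i t) \<longlonglongrightarrow> (\<Sum>\<^sub>\<infinity>e\<in>A. f e t)" for t
    using countable_has_sum_sums[OF A has_sum_infsum[OF sm[of t]]] unfolding g_def sums_def .
qed

section \<open>Measurable and integrable fields\<close>

context
  fixes \<nu> :: "'t measure"
begin

lemma weak_star_measurableD:
  assumes "weak_star_measurable \<nu> a"
  shows "bounded_clinear (a t)" "(\<lambda>t. cinner (a t \<xi>) \<eta>) \<in> borel_measurable (completion \<nu>)"
  using assms by (auto simp: weak_star_measurable_def)

text \<open>Homogeneity and polarization reduce measurability to unit vectors, whose diagonal
  spectral measures have mass 1.\<close>

lemma weak_star_measurable_diagI:
  assumes a: "\<And>t. bounded_clinear (a t)"
    and m: "\<And>\<xi>. norm \<xi> = 1 \<Longrightarrow> (\<lambda>t. cinner (a t \<xi>) \<xi>) \<in> borel_measurable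
        (completion \<nu>)"
  shows "weak_star_measurable \<nu> a"
  unfolding weak_star_measurable_def
proof (intro conjI allI a)
  fix \<xi> \<eta>
  have diag: "(\<lambda>t. cinner (a t \<zeta>) \<zeta>) \<in> borel_measurable (completion \<nu>)" for \<zeta>
  proof (cases "\<zeta> = 0")
    case False
    define u where "u = (1 / norm \<zeta>) *\<^sub>R \<zeta>"
    have u: "norm u = 1" "\<zeta> = norm \<zeta> *\<^sub>R u" using False by (auto simp: u_def)
    have "cinner (a t \<zeta>) \<zeta> = of_real ((norm \<zeta>)\<^sup>2) * cinner (a t u) u" for t
      by (subst (1 2) u(2)) (simp add: bounded_clinearD[OF a] cinner_algebra power2_eq_square)
    then show ?thesis using m[OF u(1)] by simp
  qed simp
  have "(\<lambda>t. 1/4 * (4 * cinner (a t \<xi>) \<eta>)) \<in> borel_measurable (completion \<nu>)"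
    unfolding cinner_polarization[OF a]
    by (intro borel_measurable_times borel_measurable_add borel_measurable_diff diag borel_measurable_const)
  then show "(\<lambda>t. cinner (a t \<xi>) \<eta>) \<in> borel_measurable (completion \<nu>)" by simp
qed

lemma weak_star_measurable_cadjoint:
  assumes a: "weak_star_measurable \<nu> a"
  shows "weak_star_measurable \<nu> (\<lambda>t. cadjoint (a t))"
proof -
  have "cinner (cadjoint (a t) \<xi>) \<eta> = cnj (cinner (a t \<eta>) \<xi>)" for t \<xi> \<eta>
    by (metis cinner_cadjoint_left[OF weak_star_measurableD(1)[OF a]] cinner_commute)
  moreover have "(\<lambda>t. cnj (cinner (a t \<eta>) \<xi>)) \<in> borel_measurable (completion \<nu>)" for \<xi> \<eta>
    by (rule borel_measurable_continuous_on[OF _ weak_star_measurableD(2)[OF a]])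
      (intro continuous_intros)
  ultimately show ?thesis
    using bounded_clinear_cadjoint[OF weak_star_measurableD(1)[OF a]] by (simp add: weak_star_measurable_def)
qed

lemma weak_star_measurable_const: "bounded_clinear b \<Longrightarrow> weak_star_measurable \<nu> (\<lambda>_. b)"
  by (simp add: weak_star_measurable_def)

context
  assumes cnt: "countable (some_onb :: 'h::complex_hilbert set)"
begin

text \<open>Parseval's identity writes a matrix element of the composition as a sum of products of
  matrix elements over the countable basis.\<close>

lemma weak_star_measurable_comp:
  fixes a b :: "'t \<Rightarrow> 'h \<Rightarrow> 'h"
  assumes a: "weak_star_measurable \<nu> a" and b: "weak_star_measurable \<nu> b"
  shows "weak_star_measurable \<nu> (\<lambda>t. a t \<circ> b t)"
  unfolding weak_star_measurable_def
proof (intro conjI allI bounded_clinear_comp weak_star_measurableD(1)[OF a] weak_star_measurableD(1)[OF b])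
  fix \<xi> \<eta>
  have eq: "cinner ((a t \<circ> b t) \<xi>) \<eta> = (\<Sum>\<^sub>\<infinity>e\<in>some_onb. cinner (b t \<xi>) e *
      cinner (a t e) \<eta>)" for t
    using parseval(2)[of "b t \<xi>" "cadjoint (a t) \<eta>"]
    by (simp add: cinner_cadjoint_right[OF weak_star_measurableD(1)[OF a]])
  have sm: "(\<lambda>e. cinner (b t \<xi>) e * cinner (a t e) \<eta>) summable_on some_onb" for t
    using abs_summable_summable[OF parseval(1)[of "b t \<xi>" "cadjoint (a t) \<eta>"]]
    by (simp add: cinner_cadjoint_right[OF weak_star_measurableD(1)[OF a]])
  show "(\<lambda>t. cinner ((a t \<circ> b t) \<xi>) \<eta>) \<in> borel_measurable (completion \<nu>)"
    unfolding eq
    by (intro borel_measurable_infsum_countable[OF cnt _ sm] borel_measurable_times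
        weak_star_measurableD(2)[OF a] weak_star_measurableD(2)[OF b])
qed

lemma weak_star_measurable_op_poly:
  fixes a :: "'t \<Rightarrow> 'h \<Rightarrow> 'h"
  assumes a: "weak_star_measurable \<nu> a"
  shows "weak_star_measurable \<nu> (\<lambda>t. op_poly (a t) p)"
proof (induction p)
  case (pCons c p)
  note ac = weak_star_measurableD(1)[OF a]
  have eq: "op_poly (a t) (pCons c p) \<xi> = c *\<^sub>R \<xi> + (a t \<circ> op_poly (a t) p) \<xi>" for t \<xi>
    by (simp add: op_poly_pCons bounded_clinearD[OF ac])
  note comp = weak_star_measurable_comp[OF a pCons.IH]
  show ?case
    unfolding weak_star_measurable_def
  proof (intro conjI allI bounded_clinear_op_poly ac)
    fix \<xi> \<eta> :: 'h
    show "(\<lambda>t. cinner (op_poly (a t) (pCons c p) \<xi>) \<eta>) \<in> borel_measurable (completion \<nu>)"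
      unfolding eq cinner_add_left by (intro borel_measurable_add weak_star_measurableD(2)[OF comp]) simp
  qed
qed (simp add: weak_star_measurable_const)

lemma trace_measurable:
  fixes c :: "'t \<Rightarrow> 'h \<Rightarrow> 'h" and \<alpha> \<beta> :: "'h \<Rightarrow> 'h"
  assumes c: "weak_star_measurable \<nu> c" and \<alpha>\<beta>: "\<And>f. norm (\<alpha> f) \<le> norm (\<beta> f)"
    and sm: "(\<lambda>f. (norm (\<beta> f))\<^sup>2) summable_on some_onb"
  shows "(\<lambda>f. cmod (cinner (c t (\<alpha> f)) (\<beta> f))) summable_on some_onb"
    and "(\<lambda>t. \<Sum>\<^sub>\<infinity>f\<in>some_onb. cinner (c t (\<alpha> f)) (\<beta> f)) \<in>
        borel_measurable (completion \<nu>)"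
proof -
  show abs: "(\<lambda>f. cmod (cinner (c t (\<alpha> f)) (\<beta> f))) summable_on some_onb" for t
  proof -
    obtain L where L: "L > 0" "\<And>h. norm (c t h) \<le> L * norm h"
      using bounded_clinear_bound[OF weak_star_measurableD(1)[OF c]] by metis
    have le: "cmod (cinner (c t (\<alpha> f)) (\<beta> f)) \<le> L * (norm (\<beta> f))\<^sup>2" for f
    proof -
      have "cmod (cinner (c t (\<alpha> f)) (\<beta> f)) \<le> norm (c t (\<alpha> f)) * norm (\<beta> f)" by (rule
          cmod_cinner_le)
      also have "\<dots> \<le> (L * norm (\<beta> f)) * norm (\<beta> f)"
        using L \<alpha>\<beta>[of f] by (intro mult_right_mono order_trans[OF L(2)] mult_left_mono) auto
      finally show ?thesis by (simp add: power2_eq_square)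
    qed
    have "(\<lambda>f. L * (norm (\<beta> f))\<^sup>2) summable_on some_onb" by (intro summable_on_cmult_right sm)
    from summable_on_comparison_test[OF this le] show ?thesis by simp
  qed
  show "(\<lambda>t. \<Sum>\<^sub>\<infinity>f\<in>some_onb. cinner (c t (\<alpha> f)) (\<beta> f)) \<in>
      borel_measurable (completion \<nu>)"
    by (rule borel_measurable_infsum_countable[OF cnt weak_star_measurableD(2)[OF c] abs_summable_summable[OF abs]])
qed

text \<open>Writing a state as a sum of vector functionals, each term of the trace with
  \<open>z t\<close> in the middle is at most \<open>C\<close> times the corresponding term without
  it, so the bound for the column field is inherited.\<close>

lemma op_integrable_sandwich:
  fixes a z :: "'t \<Rightarrow> 'h \<Rightarrow> 'h"
  assumes a: "weak_star_measurable \<nu> a" and aa: "op_integrable \<nu> (\<lambda>t. cadjoint (a t) \<circ> a t)"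
    and z: "weak_star_measurable \<nu> z" and C: "\<And>t h. cmod (cinner (z t h) h) \<le> C * (norm h)\<^sup>2" "C \<ge> 0"
  shows "op_integrable \<nu> (\<lambda>t. cadjoint (a t) \<circ> z t \<circ> a t)"
proof -
  note ac = weak_star_measurableD(1)[OF a]
  obtain K where K: "\<And>\<rho>. density_op \<rho> \<Longrightarrow> integrable (completion \<nu>) (\<lambda>t. cmod
      (op_trace (\<rho> \<circ> (cadjoint (a t) \<circ> a t))))"
    "\<And>\<rho>. density_op \<rho> \<Longrightarrow> (LINT t|completion \<nu>. cmod (op_trace (\<rho> \<circ>
        (cadjoint (a t) \<circ> a t)))) \<le> K"
    using aa unfolding op_integrable_def by blast
  have aam: "weak_star_measurable \<nu> (\<lambda>t. cadjoint (a t) \<circ> a t)" using aa by (simp add: op_integrable_def)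
  define c where "c t = cadjoint (a t) \<circ> z t \<circ> a t" for t
  have c: "weak_star_measurable \<nu> c"
    unfolding c_def by (intro weak_star_measurable_comp weak_star_measurable_cadjoint a z)
  have "integrable (completion \<nu>) (\<lambda>t. cmod (op_trace (\<rho> \<circ> c t))) \<and>
      (LINT t|completion \<nu>. cmod (op_trace (\<rho> \<circ> c t))) \<le> C * K" if \<rho>: "density_op \<rho>" for \<rho>
  proof -
    obtain \<beta> :: "'h \<Rightarrow> 'h" where \<beta>: "((\<lambda>f. (norm (\<beta> f))\<^sup>2) has_sum 1) some_onb"
      "\<And>c. bounded_clinear c \<Longrightarrow> op_trace (\<rho> \<circ> c) =
          (\<Sum>\<^sub>\<infinity>f\<in>some_onb. cinner (c (\<beta> f)) (\<beta> f))"
      using density_op_factorization[OF \<rho>] by blast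
    have sm: "(\<lambda>f. (norm (\<beta> f))\<^sup>2) summable_on some_onb" using \<beta>(1) by (rule has_sum_imp_summable)
    note tc = trace_measurable[OF c order_refl sm] and ta = trace_measurable[OF aam order_refl sm]
    have tr: "op_trace (\<rho> \<circ> c t) = (\<Sum>\<^sub>\<infinity>f\<in>some_onb. cinner (c t (\<beta> f))
        (\<beta> f))" for t
      by (rule \<beta>(2)[OF weak_star_measurableD(1)[OF c]])
    have tra: "op_trace (\<rho> \<circ> (cadjoint (a t) \<circ> a t)) = of_real
        (\<Sum>\<^sub>\<infinity>f\<in>some_onb. (norm (a t (\<beta> f)))\<^sup>2)"
      and sa: "(\<lambda>f. (norm (a t (\<beta> f)))\<^sup>2) summable_on some_onb" for t
    proof -
      have eq: "cinner ((cadjoint (a t) \<circ> a t) h) h = of_real ((norm (a t h))\<^sup>2)" for h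
        by (simp add: cinner_cadjoint_left[OF ac] cinner_self)
      show sa: "(\<lambda>f. (norm (a t (\<beta> f)))\<^sup>2) summable_on some_onb"
        using ta(1)[of t] unfolding eq norm_of_real by simp
      have "op_trace (\<rho> \<circ> (cadjoint (a t) \<circ> a t)) = (\<Sum>\<^sub>\<infinity>f\<in>some_onb.
          complex_of_real ((norm (a t (\<beta> f)))\<^sup>2))"
        unfolding \<beta>(2)[OF weak_star_measurableD(1)[OF aam]] eq ..
      also have "\<dots> = of_real (\<Sum>\<^sub>\<infinity>f\<in>some_onb. (norm (a t (\<beta> f)))\<^sup>2)"
        using has_sum_infsum[OF sa] has_sum_of_real_iff infsumI by blast
      finally show "op_trace (\<rho> \<circ> (cadjoint (a t) \<circ> a t)) = of_real
          (\<Sum>\<^sub>\<infinity>f\<in>some_onb. (norm (a t (\<beta> f)))\<^sup>2)" .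
    qed
    have le: "cmod (op_trace (\<rho> \<circ> c t)) \<le> C * cmod (op_trace (\<rho> \<circ> (cadjoint (a t) \<circ> a
        t)))" for t
    proof -
      have ce: "cinner (c t h) h = cinner (z t (a t h)) (a t h)" for h
        by (simp add: c_def cinner_cadjoint_left[OF ac])
      have "cmod (op_trace (\<rho> \<circ> c t)) \<le> (\<Sum>\<^sub>\<infinity>f\<in>some_onb. cmod (cinner (c t
          (\<beta> f)) (\<beta> f)))"
        unfolding tr by (rule norm_infsum_bound[OF tc(1)])
      also have "\<dots> \<le> (\<Sum>\<^sub>\<infinity>f\<in>some_onb. C * (norm (a t (\<beta> f)))\<^sup>2)"
        by (rule infsum_mono[OF tc(1) summable_on_cmult_right[OF sa]]) (simp add: ce C)
      also have "\<dots> = C * (\<Sum>\<^sub>\<infinity>f\<in>some_onb. (norm (a t (\<beta> f)))\<^sup>2)" by (rule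
          infsum_cmult_right')
      finally show ?thesis by (simp add: tra infsum_nonneg)
    qed
    have int: "integrable (completion \<nu>) (\<lambda>t. C * cmod (op_trace (\<rho> \<circ> (cadjoint (a t) \<circ> a t))))"
      using K(1)[OF \<rho>] by simp
    have meas: "(\<lambda>t. cmod (op_trace (\<rho> \<circ> c t))) \<in> borel_measurable (completion \<nu>)"
      unfolding tr by (rule measurable_compose[OF tc(2) borel_measurable_norm])
    have i: "integrable (completion \<nu>) (\<lambda>t. cmod (op_trace (\<rho> \<circ> c t)))"
      by (rule Bochner_Integration.integrable_bound[OF int meas])
        (use le C(2) in \<open>auto simp: abs_mult\<close>)
    have "(LINT t|completion \<nu>. cmod (op_trace (\<rho> \<circ> c t))) \<le>
        (LINT t|completion \<nu>. C * cmod (op_trace (\<rho> \<circ> (cadjoint (a t) \<circ> a t))))"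
      by (rule integral_mono[OF i int le])
    also have "\<dots> \<le> C * K" using mult_left_mono[OF K(2)[OF \<rho>] C(2)] by simp
    finally show ?thesis using i by blast
  qed
  then show ?thesis using c unfolding op_integrable_def c_def[symmetric] by blast
qed

text \<open>Rank-one states bound the diagonal on unit vectors. Polarization bounds the other
  elements by four diagonal terms, and two applications of the parallelogram law collect these into
  the two squared norms.\<close>

lemma op_integrable_cinner:
  fixes c :: "'t \<Rightarrow> 'h \<Rightarrow> 'h"
  assumes "op_integrable \<nu> c"
  obtains K where "\<And>\<xi> \<eta>. integrable (completion \<nu>) (\<lambda>t. cinner (c t \<xi>) \<eta>)"
    "\<And>\<xi> \<eta>. (LINT t|completion \<nu>. cmod (cinner (c t \<xi>) \<eta>)) \<le> K * ((norm \<xi>)\<^sup>2 +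
        (norm \<eta>)\<^sup>2)"
proof -
  obtain K where K: "\<And>\<rho>. density_op \<rho> \<Longrightarrow> integrable (completion \<nu>) (\<lambda>t. cmod
      (op_trace (\<rho> \<circ> c t)))"
    "\<And>\<rho>. density_op \<rho> \<Longrightarrow> (LINT t|completion \<nu>. cmod (op_trace (\<rho> \<circ> c t)))
        \<le> K"
    and c: "weak_star_measurable \<nu> c" using assms unfolding op_integrable_def by blast
  note cc = weak_star_measurableD(1)[OF c]
  have diag: "integrable (completion \<nu>) (\<lambda>t. cinner (c t \<zeta>) \<zeta>) \<and>
      (LINT t|completion \<nu>. cmod (cinner (c t \<zeta>) \<zeta>)) \<le> K * (norm \<zeta>)\<^sup>2" for \<zeta>
  proof (cases "\<zeta> = 0")
    case False
    define u where "u = (1 / norm \<zeta>) *\<^sub>R \<zeta>"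
    have u: "norm u = 1" "\<zeta> = norm \<zeta> *\<^sub>R u" using False by (auto simp: u_def)
    have eq: "cinner (c t \<zeta>) \<zeta> = of_real ((norm \<zeta>)\<^sup>2) * cinner (c t u) u" for t
      by (subst (1 2) u(2)) (simp add: bounded_clinearD[OF cc] cinner_algebra power2_eq_square)
    have n: "integrable (completion \<nu>) (\<lambda>t. cmod (cinner (c t u) u))" "(LINT t|completion \<nu>. cmod
        (cinner (c t u) u)) \<le> K"
      using K[OF density_op_rank_one[OF u(1)]] unfolding op_trace_rank_one[OF u(1) cc] by auto
    have "integrable (completion \<nu>) (\<lambda>t. cinner (c t u) u)"
      using n(1) weak_star_measurableD(2)[OF c] by (simp add: integrable_norm_iff)
    moreover have "(norm \<zeta>)\<^sup>2 * (LINT t|completion \<nu>. cmod (cinner (c t u) u)) \<le> (norm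
        \<zeta>)\<^sup>2 * K"
      by (intro mult_left_mono n) simp
    ultimately show ?thesis unfolding eq by (simp add: norm_mult norm_power mult.commute)
  qed (simp add: bounded_clinearD[OF cc])
  have int: "integrable (completion \<nu>) (\<lambda>t. cinner (c t \<xi>) \<eta>)" for \<xi> \<eta>
  proof -
    have "integrable (completion \<nu>) (\<lambda>t. 1/4 * (4 * cinner (c t \<xi>) \<eta>))"
      unfolding cinner_polarization[OF cc] using diag
      by (intro integrable_mult_right Bochner_Integration.integrable_add Bochner_Integration.integrable_diff) auto
    then show ?thesis by simp
  qed
  have "(LINT t|completion \<nu>. cmod (cinner (c t \<xi>) \<eta>)) \<le> K * ((norm \<xi>)\<^sup>2 + (norm
      \<eta>)\<^sup>2)" for \<xi> \<eta>
  proof -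
    define d where "d \<zeta> t = cmod (cinner (c t \<zeta>) \<zeta>)" for \<zeta> t
    have d: "integrable (completion \<nu>) (d \<zeta>)" "(LINT t|completion \<nu>. d \<zeta> t) \<le> K * (norm
        \<zeta>)\<^sup>2" for \<zeta>
      using diag unfolding d_def by auto
    have le: "cmod (cinner (c t \<xi>) \<eta>) \<le> 1/4 * (d (\<xi> + \<eta>) t + d (\<xi> - \<eta>) t + d (\<xi> +
        \<i> *\<^sub>C \<eta>) t + d (\<xi> - \<i> *\<^sub>C \<eta>) t)" for t
    proof -
      have "4 * cmod (cinner (c t \<xi>) \<eta>) = cmod (4 * cinner (c t \<xi>) \<eta>)" by (simp add: norm_mult)
      also have "\<dots> \<le> d (\<xi> + \<eta>) t + d (\<xi> - \<eta>) t + d (\<xi> + \<i> *\<^sub>C \<eta>) t + d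
          (\<xi> - \<i> *\<^sub>C \<eta>) t"
        unfolding cinner_polarization[OF cc] d_def
        by (intro order_trans[OF norm_triangle_ineq4] order_trans[OF norm_triangle_ineq] add_mono) (simp_all add: norm_mult)
      finally show ?thesis by simp
    qed
    have "(LINT t|completion \<nu>. cmod (cinner (c t \<xi>) \<eta>)) \<le>
      (LINT t|completion \<nu>. 1/4 * (d (\<xi> + \<eta>) t + d (\<xi> - \<eta>) t + d (\<xi> + \<i> *\<^sub>C \<eta>)
          t + d (\<xi> - \<i> *\<^sub>C \<eta>) t))"
      by (rule integral_mono) (use int le in \<open>auto intro!: Bochner_Integration.integrable_add d(1)\<close>)
    also have "\<dots> = 1/4 * ((LINT t|completion \<nu>. d (\<xi> + \<eta>) t) + (LINT t|completion \<nu>. d (\<xi> -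
        \<eta>) t) +
        (LINT t|completion \<nu>. d (\<xi> + \<i> *\<^sub>C \<eta>) t) + (LINT t|completion \<nu>. d (\<xi> - \<i>
            *\<^sub>C \<eta>) t))"
      using d(1) by simp
    also have "\<dots> \<le> 1/4 * (K * (norm (\<xi> + \<eta>))\<^sup>2 + K * (norm (\<xi> - \<eta>))\<^sup>2 + K *
        (norm (\<xi> + \<i> *\<^sub>C \<eta>))\<^sup>2 + K * (norm (\<xi> - \<i> *\<^sub>C \<eta>))\<^sup>2)"
      by (intro mult_left_mono add_mono d(2)) auto
    also have "\<dots> = 1/4 * K * (((norm (\<xi> + \<eta>))\<^sup>2 + (norm (\<xi> - \<eta>))\<^sup>2) + ((norm (\<xi>
        + \<i> *\<^sub>C \<eta>))\<^sup>2 + (norm (\<xi> - \<i> *\<^sub>C \<eta>))\<^sup>2))"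
      by (simp add: algebra_simps)
    also have "\<dots> = K * ((norm \<xi>)\<^sup>2 + (norm \<eta>)\<^sup>2)"
    proof -
      have par: "(norm (x + y))\<^sup>2 + (norm (x - y))\<^sup>2 = 2 * (norm x)\<^sup>2 + 2 * (norm y)\<^sup>2" for x y :: 'h
        by (simp add: power2_norm_eq_inner algebra_simps inner_commute)
      show ?thesis unfolding par by (simp add: norm_scaleC)
    qed
    finally show ?thesis .
  qed
  then show thesis using int that by blast
qed

text \<open>The integrated matrix elements form a bounded sesquilinear form, hence an operator
  \<open>b\<close>. Factoring a trace class operator and exchanging series and integral gives the
  required identity for every functional; vector states show that \<open>b\<close> is the only
  solution. The definite description thus exists and has the expected matrix elements.\<close>

theorem op_integral_props:
  fixes c :: "'t \<Rightarrow> 'h \<Rightarrow> 'h"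
  assumes c: "op_integrable \<nu> c"
  shows bounded_clinear_op_integral: "bounded_clinear (op_integral \<nu> c)"
    and integrable_cinner: "integrable (completion \<nu>) (\<lambda>t. cinner (c t \<xi>) \<eta>)"
    and cinner_op_integral: "cinner (op_integral \<nu> c \<xi>) \<eta> = (LINT t|completion \<nu>. cinner (c t \<xi>)
        \<eta>)"
proof -
  obtain K where int: "\<And>\<xi> \<eta>. integrable (completion \<nu>) (\<lambda>t. cinner (c t \<xi>) \<eta>)"
    and K: "\<And>\<xi> \<eta>. (LINT t|completion \<nu>. cmod (cinner (c t \<xi>) \<eta>)) \<le> K * ((norm
        \<xi>)\<^sup>2 + (norm \<eta>)\<^sup>2)"
    using op_integrable_cinner[OF c] by blast
  show "integrable (completion \<nu>) (\<lambda>t. cinner (c t \<xi>) \<eta>)" by (rule int)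
  have cm: "weak_star_measurable \<nu> c" using c by (simp add: op_integrable_def)
  note cc = weak_star_measurableD(1)[OF cm]
  have bound: "cmod (LINT t|completion \<nu>. cinner (c t x) y) \<le> K * ((norm x)\<^sup>2 + (norm y)\<^sup>2)" for x y
    using integral_norm_bound[of "completion \<nu>" "\<lambda>t. cinner (c t x) y"] K[of x y] by linarith
  obtain b where b: "bounded_clinear b" "\<And>\<xi> \<eta>. cinner (b \<xi>) \<eta> = (LINT t|completion \<nu>. cinner
      (c t \<xi>) \<eta>)"
    by (rule bounded_sesquilinear_operator'[of "\<lambda>\<xi> \<eta>. LINT t|completion \<nu>. cinner (c t \<xi>)
        \<eta>" K, OF _ _ _ _ bound])
      (simp_all add: bounded_clinearD[OF cc] cinner_algebra int)
  have trace: "op_trace (\<rho> \<circ> b) = (LINT t|completion \<nu>. op_trace (\<rho> \<circ> c t))" if \<rho>: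
      "trace_class \<rho>" for \<rho>
  proof -
    obtain \<alpha> \<beta> :: "'h \<Rightarrow> 'h" where \<alpha>\<beta>: "\<And>f. norm (\<alpha> f) \<le> norm
        (\<beta> f)"
      and sm: "(\<lambda>f. (norm (\<beta> f))\<^sup>2) summable_on some_onb"
      and tr: "\<And>c. bounded_clinear c \<Longrightarrow> op_trace (\<rho> \<circ> c) =
          (\<Sum>\<^sub>\<infinity>f\<in>some_onb. cinner (c (\<alpha> f)) (\<beta> f))"
      using trace_class_factorization[OF \<rho>] by blast
    define B where "B = (some_onb :: 'h set)"
    define N where "N = to_nat_on B ` B"
    define F where "F n = from_nat_into B n" for n
    define g where "g n t = (if n \<in> N then cinner (c t (\<alpha> (F n))) (\<beta> (F n)) else 0)" for n t
    have cB: "countable B" using cnt by (simp add: B_def)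
    have abs: "(\<lambda>f. cmod (cinner (a (\<alpha> f)) (\<beta> f))) summable_on B" if "bounded_clinear a" for a
      using trace_measurable(1)[OF weak_star_measurable_const[OF that] \<alpha>\<beta> sm] unfolding B_def .
    have sums_of: "(\<lambda>n. if n \<in> N then cinner (a (\<alpha> (F n))) (\<beta> (F n)) else 0) sums op_trace
        (\<rho> \<circ> a)"
      and sums_abs: "summable (\<lambda>n. cmod (if n \<in> N then cinner (a (\<alpha> (F n))) (\<beta> (F n)) else 0))"
      if a: "bounded_clinear a" for a
    proof -
      show "(\<lambda>n. if n \<in> N then cinner (a (\<alpha> (F n))) (\<beta> (F n)) else 0) sums op_trace (\<rho>
          \<circ> a)"
        using countable_has_sum_sums[OF cB has_sum_infsum[OF abs_summable_summable[OF abs[OF a]]]]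
        unfolding N_def F_def tr[OF a] B_def .
      have "(\<lambda>f. complex_of_real (cmod (cinner (a (\<alpha> f)) (\<beta> f)))) summable_on B"
        by (rule summable_on_of_real[OF abs[OF a]])
      from sums_summable[OF countable_has_sum_sums[OF cB has_sum_infsum[OF this]]]
      have "summable (\<lambda>n. complex_of_real (cmod (if n \<in> N then cinner (a (\<alpha> (F n))) (\<beta> (F n))
          else 0)))"
        unfolding N_def F_def by (rule back_subst[where P=summable]) auto
      then show "summable (\<lambda>n. cmod (if n \<in> N then cinner (a (\<alpha> (F n))) (\<beta> (F n)) else 0))"
        by (simp only: summable_complex_of_real)
    qed
    have sumsc: "(\<lambda>n. g n t) sums op_trace (\<rho> \<circ> c t)" for t unfolding g_def by (rule sums_of[OF cc])
    have gi: "integrable (completion \<nu>) (g n)" for n using int by (cases "n \<in> N") (simp_all add: g_def[abs_def])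
    \<comment> \<open>Since \<open>norm (\<alpha> f) \<le> norm (\<beta> f)\<close>, the bound by
      \<open>K\<close> times the two squared norms is at most \<open>2 * \<bar>K\<bar>\<close> times
      a summable term; this dominates the integrals of the series.\<close>
    have "summable (\<lambda>n. if n \<in> N then (2 * \<bar>K\<bar>) * (norm (\<beta> (F n)))\<^sup>2 else 0)"
    proof -
      have "(\<lambda>f. complex_of_real ((2 * \<bar>K\<bar>) * (norm (\<beta> f))\<^sup>2)) summable_on B"
        unfolding B_def by (intro summable_on_of_real summable_on_cmult_right sm)
      from sums_summable[OF countable_has_sum_sums[OF cB has_sum_infsum[OF this]]]
      have "summable (\<lambda>n. complex_of_real (if n \<in> N then (2 * \<bar>K\<bar>) * (norm (\<beta> (F
          n)))\<^sup>2 else 0))"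
        unfolding N_def F_def by (rule back_subst[where P=summable]) auto
      then show ?thesis by (simp only: summable_complex_of_real)
    qed
    then have gs: "summable (\<lambda>n. LINT t|completion \<nu>. cmod (g n t))"
    proof (rule summable_comparison_test'[of _ 0])
      fix n
      show "norm (LINT t|completion \<nu>. cmod (g n t)) \<le> (if n \<in> N then (2 * \<bar>K\<bar>) * (norm (\<beta>
          (F n)))\<^sup>2 else 0)"
      proof (cases "n \<in> N")
        case True
        have "0 \<le> (LINT t|completion \<nu>. cmod (g n t))" by (rule Bochner_Integration.integral_nonneg) simp
        moreover have "(LINT t|completion \<nu>. cmod (g n t)) \<le> K * ((norm (\<alpha> (F n)))\<^sup>2 + (norm
            (\<beta> (F n)))\<^sup>2)"
          using K True by (simp add: g_def)
        moreover have "K * ((norm (\<alpha> (F n)))\<^sup>2 + (norm (\<beta> (F n)))\<^sup>2) \<le> \<bar>K\<bar> *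
            ((norm (\<beta> (F n)))\<^sup>2 + (norm (\<beta> (F n)))\<^sup>2)"
          using \<alpha>\<beta>[of "F n"] by (intro mult_mono add_mono power_mono) auto
        ultimately show ?thesis using True by simp
      qed (simp add: g_def)
    qed
    have "(\<lambda>n. LINT t|completion \<nu>. g n t) sums (LINT t|completion \<nu>. (\<Sum>n. g n t))"
      by (rule sums_integral[OF gi _ gs]) (auto simp: g_def intro!: AE_I2 sums_abs cc)
    also have "(\<lambda>t. \<Sum>n. g n t) = (\<lambda>t. op_trace (\<rho> \<circ> c t))" using sumsc by (auto simp:
        sums_iff)
    also have "(\<lambda>n. LINT t|completion \<nu>. g n t) = (\<lambda>n. if n \<in> N then cinner (b (\<alpha> (F
        n))) (\<beta> (F n)) else 0)"
      by (auto simp: g_def b(2))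
    finally show ?thesis using sums_of[OF b(1)] sums_unique2 by blast
  qed
  have "op_integral \<nu> c = b"
    unfolding op_integral_def
  proof (rule the_equality)
    show "op_integrable \<nu> c \<and> bounded_clinear b \<and>
      (\<forall>\<rho>. trace_class \<rho> \<longrightarrow> op_trace (\<rho> \<circ> b) = (LINT t|completion \<nu>.
          op_trace (\<rho> \<circ> c t)))"
      using c b(1) trace by blast
    fix b' assume b': "op_integrable \<nu> c \<and> bounded_clinear b' \<and>
      (\<forall>\<rho>. trace_class \<rho> \<longrightarrow> op_trace (\<rho> \<circ> b') = (LINT t|completion \<nu>.
          op_trace (\<rho> \<circ> c t)))"
    \<comment> \<open>The rank-one functional at \<open>u\<close> recovers the diagonal value, and
      the diagonal determines the operator.\<close>
    have unit: "cinner (b' u) u = cinner (b u) u" if u: "norm u = 1" for u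
    proof -
      define \<rho> where "\<rho> = (\<lambda>\<zeta>. cinner \<zeta> u *\<^sub>C u)"
      have "trace_class \<rho>" using density_op_rank_one[OF u] by (simp add: density_op_def \<rho>_def)
      then have "op_trace (\<rho> \<circ> b') = op_trace (\<rho> \<circ> b)" using b' trace by metis
      then show ?thesis using b' b(1) by (simp add: \<rho>_def op_trace_rank_one[OF u])
    qed
    have "cinner (b' \<zeta>) \<zeta> = cinner (b \<zeta>) \<zeta>" for \<zeta>
    proof (cases "\<zeta> = 0")
      case False
      define u where "u = (1 / norm \<zeta>) *\<^sub>R \<zeta>"
      have u: "norm u = 1" "\<zeta> = norm \<zeta> *\<^sub>R u" using False by (auto simp: u_def)
      have eq: "cinner (a \<zeta>) \<zeta> = of_real ((norm \<zeta>)\<^sup>2) * cinner (a u) u" if "bounded_clinear a" for a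
        by (subst (1 2) u(2)) (simp add: bounded_clinearD[OF that] cinner_algebra power2_eq_square)
      show ?thesis using eq[of b'] eq[of b] b' b(1) unit[OF u(1)] by simp
    qed simp
    then show "b' = b" using b' b(1) by (intro clinear_eqI) auto
  qed
  then show "bounded_clinear (op_integral \<nu> c)"
    "cinner (op_integral \<nu> c \<xi>) \<eta> = (LINT t|completion \<nu>. cinner (c t \<xi>) \<eta>)" using b by auto
qed

section \<open>Measurability of spectral measures and of the functional calculus along a
  field\<close>

context
  fixes x :: "'t \<Rightarrow> 'n::finite \<Rightarrow> 'h \<Rightarrow> 'h" and C :: real
  assumes xm: "\<And>i. weak_star_measurable \<nu> (\<lambda>t. x t i)" and sa: "\<And>t i. selfadjoint_op (x t i)"
    and ab: "\<And>t. abelian_tuple (x t)"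
    and bound: "\<And>t i h. \<bar>x t i h \<bullet> h\<bar> \<le> C * (norm h)\<^sup>2" and C: "C \<ge> 0"
begin

text \<open>A pointwise limit of polynomials in \<open>x t i\<close>. It is a limit of measurable
  functions because one sequence of polynomials serves all \<open>t\<close>, by the common bound
  \<open>C\<close>.\<close>

lemma weak_star_measurable_spectral_measure:
  "weak_star_measurable \<nu> (\<lambda>t. spectral_measure (x t i) {..s})"
proof (rule weak_star_measurable_diagI)
  note E = pvm_spectral_measure[OF sa ab] has_pvm_integral_spectral_measure[OF sa ab]
  have P: "projection_op (spectral_measure (x t i) {..s})" for t by (rule pvmD(1)[OF E(1)]) simp
  show "bounded_clinear (spectral_measure (x t i) {..s})" for t by (rule projection_opD(1)[OF P])
  fix \<xi> :: 'h
  have eq: "cinner (spectral_measure (x t i) {..s} \<xi>) \<xi> = of_real (measure (pvm_measure (spectral_measure (x t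
      i)) \<xi>) {..s})" for t
    by (simp add: projection_opD(3)[OF P] measure_pvm_measure[OF E(1)])
  have "(\<lambda>t. measure (pvm_measure (spectral_measure (x t i)) \<xi>) {..s}) \<in> borel_measurable (completion \<nu>)"
  proof (rule spectral_atMost_limit[OF C, where 'h='h and s=s])
    fix p :: "nat \<Rightarrow> real poly"
    assume p: "\<And>(E :: real set \<Rightarrow> 'h \<Rightarrow> 'h) x \<xi>. pvm E \<Longrightarrow>
        has_pvm_integral E UNIV (\<lambda>l. l) x \<Longrightarrow>
      (\<And>h. \<bar>x h \<bullet> h\<bar> \<le> C * (norm h)\<^sup>2) \<Longrightarrow>
      (\<lambda>k. op_poly x (p k) \<xi> \<bullet> \<xi>) \<longlonglongrightarrow> measure (pvm_measure E \<xi>) {..s}"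
    show ?thesis
    proof (rule borel_measurable_LIMSEQ_metric)
      show "(\<lambda>t. op_poly (x t i) (p k) \<xi> \<bullet> \<xi>) \<in> borel_measurable (completion \<nu>)" for k
        unfolding Re_cinner[symmetric]
        using weak_star_measurableD(2)[OF weak_star_measurable_op_poly[OF xm]]
        by (simp add: borel_measurable_complex_iff)
      show "(\<lambda>k. op_poly (x t i) (p k) \<xi> \<bullet> \<xi>) \<longlonglongrightarrow> measure (pvm_measure
          (spectral_measure (x t i)) \<xi>) {..s}" for t
        by (rule p[OF E(1) E(2)]) (rule bound)
    qed
  qed
  then show "(\<lambda>t. cinner (spectral_measure (x t i) {..s} \<xi>) \<xi>) \<in> borel_measurable (completion \<nu>)"
    unfolding eq by (simp add: borel_measurable_complex_iff)
qed

text \<open>On an orthant the joint projection is a product of one-variable spectral projections,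
  and compositions of measurable fields are measurable. Dynkin induction covers the remaining Borel
  sets.\<close>

lemma measurable_joint_spectral_measure:
  assumes S: "S \<in> sets borel"
  shows "(\<lambda>t. measure (pvm_measure (joint_spectral_measure (x t)) \<xi>) S) \<in> borel_measurable (completion
      \<nu>)"
  using S
proof (induction rule: borel_induct_orthants)
  case (orthant s)
  obtain idx :: "'n list" where idx: "distinct idx" "set idx = UNIV"
    using finite_distinct_list[of "UNIV :: 'n set"] by auto
  have "weak_star_measurable \<nu> (\<lambda>t. foldr (\<lambda>i b. spectral_measure (x t i) {..s $ i} \<circ> b) js
      id)" for js
  proof (induction js)
    case (Cons j js)
    show ?case
      using weak_star_measurable_comp[OF weak_star_measurable_spectral_measure[of j "s $ j"] Cons]
      by (simp add: comp_def)
  qed (simp add: weak_star_measurable_const)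
  from this[of idx] have m: "weak_star_measurable \<nu> (\<lambda>t. joint_spectral_measure (x t) {..s})"
    using joint_spectral_measure_atMost[OF sa ab idx] by simp
  have "measure (pvm_measure (joint_spectral_measure (x t)) \<xi>) {..s} = Re (cinner (joint_spectral_measure (x t)
      {..s} \<xi>) \<xi>)" for t
    using projection_opD(3)[OF pvmD(1)[OF pvm_joint_spectral_measure[OF sa ab]], of "{..s}" t \<xi>]
    by (simp add: measure_pvm_measure[OF pvm_joint_spectral_measure[OF sa ab]])
  then show ?case using weak_star_measurableD(2)[OF m] by (simp add: borel_measurable_complex_iff)
next
  case (compl A)
  have "measure (pvm_measure (joint_spectral_measure (x t)) \<xi>) (- A) =
      (norm \<xi>)\<^sup>2 - measure (pvm_measure (joint_spectral_measure (x t)) \<xi>) A" for t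
    using finite_measure.finite_measure_compl[OF finite_measure_pvm_measure[OF pvm_joint_spectral_measure[OF sa ab]],
        of A t \<xi>] compl(1)
    by (simp add: Compl_eq_Diff_UNIV space_pvm_measure[OF pvm_joint_spectral_measure[OF sa ab]]
        sets_pvm_measure[OF pvm_joint_spectral_measure[OF sa ab]] measure_pvm_measure_UNIV[OF
            pvm_joint_spectral_measure[OF sa ab]])
  then show ?case using compl(2) by simp
next
  case (union A)
  show ?case
  proof (rule borel_measurable_LIMSEQ_metric)
    show "(\<lambda>t. \<Sum>k<n. measure (pvm_measure (joint_spectral_measure (x t)) \<xi>) (A k)) \<in>
        borel_measurable (completion \<nu>)" for n
      using union(3) by (intro borel_measurable_sum) auto
    show "(\<lambda>n. \<Sum>k<n. measure (pvm_measure (joint_spectral_measure (x t)) \<xi>) (A k)) \<longlonglongrightarrow>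
        measure (pvm_measure (joint_spectral_measure (x t)) \<xi>) (\<Union>k. A k)" for t
      using finite_measure.finite_measure_UNION[OF finite_measure_pvm_measure[OF pvm_joint_spectral_measure[OF sa ab]],
          of A t \<xi>] union(1,2)
      by (simp add: sums_def sets_pvm_measure[OF pvm_joint_spectral_measure[OF sa ab]])
  qed
qed simp

text \<open>For a unit vector the diagonal measures form a measurable kernel of probability
  measures, and integrating a fixed Borel function against a kernel is measurable.\<close>

lemma weak_star_measurable_functional_calculus:
  assumes J: "\<And>i. is_interval (J i)" and I: "I = {l. \<forall>i. l $ i \<in> J i}" and f: "continuous_on I f"
    and spec: "\<And>t i. op_spectrum (x t i) \<subseteq> complex_of_real ` J i" and u: "(u::'h) \<noteq> 0"
  shows "weak_star_measurable \<nu> (\<lambda>t. functional_calculus I f (x t))"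
proof (rule weak_star_measurable_diagI)
  note fc = has_pvm_integral_functional_calculus[OF sa ab J I f spec u]
  note E = pvm_joint_spectral_measure[OF sa ab]
  show "bounded_clinear (functional_calculus I f (x t))" for t using fc[of t] by (simp add: has_pvm_integral_def)
  fix \<xi> :: 'h assume \<xi>: "norm \<xi> = 1"
  have fI: "(\<lambda>l. indicator I l *\<^sub>R f l) \<in> borel_measurable borel"
    unfolding I using J by (intro borel_measurable_continuous_on_indicator f[unfolded I] cart_box_borel)
  have "(\<lambda>t. pvm_measure (joint_spectral_measure (x t)) \<xi>) \<in> measurable (completion \<nu>)
      (subprob_algebra borel)"
  proof (rule measurable_subprob_algebra)
    show "subprob_space (pvm_measure (joint_spectral_measure (x t)) \<xi>)" for t
      by (rule subprob_spaceI) (simp_all add: space_pvm_measure[OF E] emeasure_pvm_measure[OF E] pvmD(3)[OF E] \<xi>)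
    show "sets (pvm_measure (joint_spectral_measure (x t)) \<xi>) = sets borel" for t by (rule sets_pvm_measure[OF E])
    fix S :: "(real^'n) set" assume "S \<in> sets borel"
    from measurable_joint_spectral_measure[OF this]
    show "(\<lambda>t. emeasure (pvm_measure (joint_spectral_measure (x t)) \<xi>) S) \<in> borel_measurable
        (completion \<nu>)"
      by (simp add: finite_measure.emeasure_eq_measure[OF finite_measure_pvm_measure[OF E]])
  qed
  from measurable_compose[OF this integral_measurable_subprob_algebra[OF fI]]
  have "(\<lambda>t. \<integral>l. indicator I l *\<^sub>R f l \<partial>pvm_measure (joint_spectral_measure (x t))
      \<xi>) \<in> borel_measurable (completion \<nu>)" .
  moreover have "cinner (functional_calculus I f (x t) \<xi>) \<xi> =
      of_real (\<integral>l. indicator I l *\<^sub>R f l \<partial>pvm_measure (joint_spectral_measure (x t)) \<xi>)" for t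
    using fc[of t] by (simp add: has_pvm_integral_def set_lebesgue_integral_def)
  ultimately show "(\<lambda>t. cinner (functional_calculus I f (x t) \<xi>) \<xi>) \<in> borel_measurable (completion
      \<nu>)"
    by (simp add: borel_measurable_complex_iff)
qed

end

end

end

section \<open>The convexity inequality\<close>

text \<open>The point at depth \<open>e\<close> below the graph is strictly separated from the
  closure of the epigraph. The positive depth is what excludes a vertical hyperplane, which at a
  boundary point can be the only one through the graph itself.\<close>

lemma convex_affine_minorant:
  fixes f :: "'a::euclidean_space \<Rightarrow> real"
  assumes conv: "convex_on I f" and cont: "continuous_on I f" and c: "c \<in> I" and e: "e > 0"
  obtains \<alpha> v where "\<And>l. l \<in> I \<Longrightarrow> \<alpha> + v \<bullet> l \<le> f l" "f c - e \<le>
      \<alpha> + v \<bullet> c"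
proof -
  define S where "S = epigraph I f"
  have "convex S" unfolding S_def using conv by (simp add: convex_epigraph convex_on_imp_convex)
  have "(c, f c - e) \<notin> closure S"
  proof
    assume "(c, f c - e) \<in> closure S"
    obtain d where d: "d > 0" "\<And>l. l \<in> I \<Longrightarrow> dist l c < d \<Longrightarrow> dist (f l) (f c) < e / 2"
      using cont c e unfolding continuous_on_iff by (metis half_gt_zero)
    have "min d (e / 2) > 0" using d e by simp
    then obtain y where y: "y \<in> S" "dist y (c, f c - e) < min d (e / 2)"
      using \<open>(c, f c - e) \<in> closure S\<close> closure_approachable by blast
    have "dist (fst y) c < d" "dist (snd y) (f c - e) < e / 2"
      using y(2) dist_fst_le[of y "(c, f c - e)"] dist_snd_le[of y "(c, f c - e)"] by auto
    moreover have "fst y \<in> I" "f (fst y) \<le> snd y" using y(1) by (auto simp: S_def epigraph_def)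
    moreover have "dist (f (fst y)) (f c) < e / 2" by (rule d(2)) fact+
    ultimately show False unfolding dist_real_def by linarith
  qed
  then obtain a b where ab: "a \<bullet> (c, f c - e) < b" "\<And>x. x \<in> closure S \<Longrightarrow> b < a \<bullet> x"
    using separating_hyperplane_closed_point[OF convex_closure[OF \<open>convex S\<close>] closed_closure] by blast
  define w s where "w = fst a" and "s = snd a"
  have above: "b < w \<bullet> l + s * f l" if "l \<in> I" for l
  proof -
    have "(l, f l) \<in> closure S" using that closure_subset by (force simp: S_def epigraph_def)
    from ab(2)[OF this] show ?thesis by (simp add: w_def s_def inner_prod_def)
  qed
  have below: "w \<bullet> c + s * (f c - e) < b" using ab(1) by (simp add: w_def s_def inner_prod_def)
  \<comment> \<open>Comparing the two sides over \<open>c\<close> gives \<open>s * e > 0\<close>, so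
    the hyperplane is the graph of an affine function.\<close>
  have "0 < s * e" using above[OF c] below by (simp add: algebra_simps)
  then have s: "s > 0" using e by (simp add: zero_less_mult_iff)
  show thesis
  proof (rule that[of "b / s" "- (1 / s) *\<^sub>R w"])
    fix l assume "l \<in> I"
    from above[OF this] show "b / s + (- (1 / s) *\<^sub>R w) \<bullet> l \<le> f l" using s by (simp add: field_simps)
  next
    show "f c - e \<le> b / s + (- (1 / s) *\<^sub>R w) \<bullet> c" using below s by (simp add: field_simps)
  qed
qed

text \<open>The affine function integrates to the corresponding combination of the components, and
  the joint measure is carried by \<open>I\<close>, where the scalar inequality holds.\<close>

lemma functional_calculus_ge_affine:
  fixes x :: "'n::finite \<Rightarrow> 'h::complex_hilbert \<Rightarrow> 'h" and J :: "'n \<Rightarrow> real set"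
  assumes sa: "\<And>i. selfadjoint_op (x i)" and comm: "abelian_tuple x"
    and J: "\<And>i. is_interval (J i)" and I: "I = {l. \<forall>i. l $ i \<in> J i}" and f: "continuous_on I f"
    and spec: "\<And>i. op_spectrum (x i) \<subseteq> complex_of_real ` J i" and u: "(u::'h) \<noteq> 0"
    and minorant: "\<And>l. l \<in> I \<Longrightarrow> \<alpha> + v \<bullet> l \<le> f l"
  shows "\<alpha> * (norm h)\<^sup>2 + (\<Sum>i\<in>UNIV. v $ i * (x i h \<bullet> h)) \<le> functional_calculus I f x
      h \<bullet> h"
proof -
  note E = pvm_joint_spectral_measure[OF sa comm]
  have aff: "has_pvm_integral (joint_spectral_measure x) UNIV (\<lambda>l. \<alpha> + (\<Sum>i\<in>UNIV. v $ i * l $ i))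
      (\<lambda>h. \<alpha> *\<^sub>R h + (\<Sum>i\<in>UNIV. v $ i *\<^sub>R x i h))"
    by (intro has_pvm_integral_add[OF E] has_pvm_integral_const[OF E] has_pvm_integral_sum[OF E]
        has_pvm_integral_scale[OF E] has_pvm_integral_joint_component[OF sa comm]) simp
  have fc: "integrable (pvm_measure (joint_spectral_measure x) h) (\<lambda>l. indicator I l *\<^sub>R f l)"
    "functional_calculus I f x h \<bullet> h = (\<integral>l. indicator I l *\<^sub>R f l \<partial>pvm_measure
        (joint_spectral_measure x) h)"
    using has_pvm_integral_functional_calculus[OF sa comm J I f spec u]
    unfolding has_pvm_integral_def set_integrable_def set_lebesgue_integral_def
    by (auto simp: Re_cinner[symmetric])
  have "\<alpha> * (norm h)\<^sup>2 + (\<Sum>i\<in>UNIV. v $ i * (x i h \<bullet> h)) = (\<alpha> *\<^sub>R h +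
      (\<Sum>i\<in>UNIV. v $ i *\<^sub>R x i h)) \<bullet> h"
    by (simp add: inner_add_left inner_sum_left dot_square_norm)
  also have "\<dots> = (\<integral>l. \<alpha> + (\<Sum>i\<in>UNIV. v $ i * l $ i) \<partial>pvm_measure
      (joint_spectral_measure x) h)"
    by (rule has_pvm_integral_inner[OF aff])
  also have "\<dots> \<le> (\<integral>l. indicator I l *\<^sub>R f l \<partial>pvm_measure (joint_spectral_measure x) h)"
  proof (rule integral_mono_AE[OF _ fc(1)])
    show "integrable (pvm_measure (joint_spectral_measure x) h) (\<lambda>l. \<alpha> + (\<Sum>i\<in>UNIV. v $ i * l $ i))"
      using aff unfolding has_pvm_integral_UNIV_iff by blast
    show "AE l in pvm_measure (joint_spectral_measure x) h. \<alpha> + (\<Sum>i\<in>UNIV. v $ i * l $ i) \<le>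
        indicator I l *\<^sub>R f l"
      using AE_joint_spectral_measure[OF sa comm J I f spec u, of h]
      by (rule eventually_mono) (use minorant in \<open>simp add: inner_vec_def\<close>)
  qed
  finally show ?thesis using fc(2) by simp
qed

text \<open>The bound depends only on \<open>f\<close>, the cube and \<open>C\<close>. Applied to
  all members of a field with a common \<open>C\<close> it is uniform in \<open>t\<close>.\<close>

lemma functional_calculus_bounded:
  fixes x :: "'n::finite \<Rightarrow> 'h::complex_hilbert \<Rightarrow> 'h" and J :: "'n \<Rightarrow> real set"
  assumes sa: "\<And>i. selfadjoint_op (x i)" and comm: "abelian_tuple x"
    and J: "\<And>i. is_interval (J i)" and I: "I = {l. \<forall>i. l $ i \<in> J i}" and f: "continuous_on I f"
    and spec: "\<And>i. op_spectrum (x i) \<subseteq> complex_of_real ` J i" and u: "(u::'h) \<noteq> 0"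
    and C: "\<And>i h. \<bar>x i h \<bullet> h\<bar> \<le> C * (norm h)\<^sup>2"
    and B: "\<And>l. l \<in> I \<Longrightarrow> (\<forall>i. \<bar>l $ i\<bar> \<le> C) \<Longrightarrow> \<bar>f
        l\<bar> \<le> B"
  shows "cmod (cinner (functional_calculus I f x h) h) \<le> B * (norm h)\<^sup>2"
proof -
  note E = pvm_joint_spectral_measure[OF sa comm]
  have low: "- C * (norm h)\<^sup>2 \<le> x i h \<bullet> h" and up: "x i h \<bullet> h \<le> C * (norm h)\<^sup>2" for i h
    using C[of i h] by linarith+
  have "AE l in pvm_measure (joint_spectral_measure x) h. l $ i \<in> {- C..C}" for i
    by (rule AE_pvm_bounds[OF E has_pvm_integral_joint_component[OF sa comm] _ low up])
      (intro borel_measurable_continuous_onI continuous_intros)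
  then have "AE l in pvm_measure (joint_spectral_measure x) h. \<forall>i\<in>UNIV. l $ i \<in> {- C..C}"
    by (intro AE_finite_allI) auto
  then have AE: "AE l in pvm_measure (joint_spectral_measure x) h. \<bar>indicator I l *\<^sub>R f l\<bar> \<le> B"
    using AE_joint_spectral_measure[OF sa comm J I f spec u, of h]
  proof eventually_elim
    case (elim l)
    then have "\<bar>l $ i\<bar> \<le> C" for i by (auto simp: abs_le_iff minus_le_iff)
    then show ?case using B[of l] elim by simp
  qed
  have fI: "(\<lambda>l. indicator I l *\<^sub>R f l) \<in> borel_measurable borel"
    unfolding I using J by (intro borel_measurable_continuous_on_indicator f[unfolded I] cart_box_borel)
  have "cinner (functional_calculus I f x h) h =
      of_real (\<integral>l. indicator I l *\<^sub>R f l \<partial>pvm_measure (joint_spectral_measure x) h)"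
    using has_pvm_integral_functional_calculus[OF sa comm J I f spec u]
    unfolding has_pvm_integral_def set_lebesgue_integral_def by blast
  then show ?thesis using integrable_pvm_measure_bounded(2)[OF E fI AE] by (simp only: norm_of_real)
qed

text \<open>Otherwise the interval lies strictly on one side of the mean, and by the spectral bounds so do
  all quadratic forms that are averaged.\<close>

lemma mean_in_interval:
  fixes x :: "'t \<Rightarrow> 'h::complex_hilbert \<Rightarrow> 'h" and w :: "'t \<Rightarrow> 'h"
  assumes J: "is_interval J" and sa: "\<And>t. selfadjoint_op (x t)"
    and spec: "\<And>t. op_spectrum (x t) \<subseteq> complex_of_real ` J" and u: "(u::'h) \<noteq> 0"
    and int: "integrable M (\<lambda>t. (norm (w t))\<^sup>2)" "(LINT t|M. (norm (w t))\<^sup>2) = 1"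
    and intx: "integrable M (\<lambda>t. x t (w t) \<bullet> w t)"
  shows "(LINT t|M. x t (w t) \<bullet> w t) \<in> J"
proof (rule ccontr)
  define c where "c = (LINT t|M. x t (w t) \<bullet> w t)"
  assume "(LINT t|M. x t (w t) \<bullet> w t) \<notin> J"
  then have c: "c \<notin> J" by (simp add: c_def)
  \<comment> \<open>The sign \<sigma> is 1 if the interval lies above \<open>c\<close> and -1 if it
    lies below. In both cases a nonnegative function with integral 0 vanishes almost everywhere, and
    strictness makes \<open>w\<close> vanish with it, against the total mass 1.\<close>
  have contradiction: False if \<sigma>: "\<And>t. (\<sigma> :: real) * (c * (norm (w t))\<^sup>2) \<le> \<sigma> * (x
      t (w t) \<bullet> w t)"
    "\<And>t. \<sigma> * (c * (norm (w t))\<^sup>2) = \<sigma> * (x t (w t) \<bullet> w t) \<Longrightarrow> w t = 0"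
        for \<sigma>
  proof -
    define d where "d t = \<sigma> * (x t (w t) \<bullet> w t) - \<sigma> * (c * (norm (w t))\<^sup>2)" for t
    have di: "integrable M d" unfolding d_def using int intx by auto
    have d0: "AE t in M. 0 \<le> d t" using \<sigma>(1) by (simp add: d_def)
    have "(LINT t|M. d t) = \<sigma> * c - \<sigma> * (c * 1)"
      unfolding d_def using int intx by (simp add: c_def)
    then have "(LINT t|M. d t) = 0" by simp
    then have "AE t in M. d t = 0" using integral_nonneg_eq_0_iff_AE[OF di d0] by simp
    then have "AE t in M. (norm (w t))\<^sup>2 = 0" by (rule eventually_mono) (use \<sigma>(2) in \<open>auto simp:
        d_def\<close>)
    then have "(LINT t|M. (norm (w t))\<^sup>2) = 0" by (rule integral_eq_zero_AE)
    then show False using int(2) by simp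
  qed
  have side: "(\<forall>j\<in>J. c < j) \<or> (\<forall>j\<in>J. j < c)"
  proof (rule ccontr)
    assume "\<not> ?thesis"
    then obtain j k where "j \<in> J" "j \<le> c" "k \<in> J" "c \<le> k" by (auto simp: not_less)
    then show False using mem_is_interval_1_I[OF J, of j k c] c by blast
  qed
  then show False
  proof
    assume less: "\<forall>j\<in>J. c < j"
    show False
    proof (rule contradiction[of 1])
      fix t
      obtain m where m: "m \<in> J" "\<And>h. m * (norm h)\<^sup>2 \<le> x t h \<bullet> h" by (rule
          spectrum_lower_bound[OF sa spec u]) blast
      have cm: "c < m" using less m(1) by blast
      then show "1 * (c * (norm (w t))\<^sup>2) \<le> 1 * (x t (w t) \<bullet> w t)"
        using m(2)[of "w t"] mult_right_mono[of c m "(norm (w t))\<^sup>2"] by simp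
      show "w t = 0" if "1 * (c * (norm (w t))\<^sup>2) = 1 * (x t (w t) \<bullet> w t)"
      proof (rule ccontr)
        assume "w t \<noteq> 0"
        then have "c * (norm (w t))\<^sup>2 < m * (norm (w t))\<^sup>2" using cm by (intro mult_strict_right_mono) auto
        then show False using that m(2)[of "w t"] by simp
      qed
    qed
  next
    assume less: "\<forall>j\<in>J. j < c"
    show False
    proof (rule contradiction[of "- 1"])
      fix t
      obtain m where m: "m \<in> J" "\<And>h. x t h \<bullet> h \<le> m * (norm h)\<^sup>2" by (rule
          spectrum_upper_bound[OF sa spec u]) blast
      have cm: "m < c" using less m(1) by blast
      then show "- 1 * (c * (norm (w t))\<^sup>2) \<le> - 1 * (x t (w t) \<bullet> w t)"
        using m(2)[of "w t"] mult_right_mono[of m c "(norm (w t))\<^sup>2"] by simp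
      show "w t = 0" if "- 1 * (c * (norm (w t))\<^sup>2) = - 1 * (x t (w t) \<bullet> w t)"
      proof (rule ccontr)
        assume "w t \<noteq> 0"
        then have "m * (norm (w t))\<^sup>2 < c * (norm (w t))\<^sup>2" using cm by (intro mult_strict_right_mono) auto
        then show False using that m(2)[of "w t"] by simp
      qed
    qed
  qed
qed

theorem corollary3p2:
  fixes J :: "'n::finite \<Rightarrow> real set"
    and I :: "(real^'n) set"
    and f :: "real^'n \<Rightarrow> real"
    and \<nu> :: "'t::t2_space measure"
    and a :: "'t \<Rightarrow> 'h::complex_hilbert \<Rightarrow> 'h"
    and x :: "'t \<Rightarrow> 'n \<Rightarrow> 'h \<Rightarrow> 'h"
    and y :: "'n \<Rightarrow> 'h \<Rightarrow> 'h"
    and \<xi> :: 'h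
  assumes separable: "separable_space (euclidean :: 'h topology)"
    and intervals: "\<And>i. is_interval (J i)"
    and I_eq: "I = {l. \<forall>i. l $ i \<in> J i}"
    and f_cont: "continuous_on I f"
    and f_convex: "convex_on I f"
    and T_loc_compact: "locally_compact_space (euclidean :: 't topology)"
    and radon: "radon_measure \<nu>"
    and unital: "unital_column_field \<nu> a"
    and x_measurable: "\<And>i. weak_star_measurable \<nu> (\<lambda>t. x t i)"
    and x_bounded: "\<exists>C. \<forall>t i. onorm (x t i) \<le> C"
    and x_selfadjoint: "\<And>t i. selfadjoint_op (x t i)"
    and x_abelian: "\<And>t. abelian_tuple (x t)"
    and x_domain: "\<And>t i. op_spectrum (x t i) \<subseteq> complex_of_real ` J i"
    and y_eq: "\<And>i. y i = op_integral \<nu> (\<lambda>t. cadjoint (a t) \<circ> x t i \<circ> a t)"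
    and rhs_defined: "closed I \<or>
      op_integrable \<nu> (\<lambda>t. cadjoint (a t) \<circ> functional_calculus I f (x t) \<circ> a t)"
    and unit: "norm \<xi> = 1"
  shows "f (\<chi> i. Re (cinner (y i \<xi>) \<xi>)) \<le>
    Re (cinner (op_integral \<nu> (\<lambda>t. cadjoint (a t) \<circ> functional_calculus I f (x t) \<circ> a t) \<xi>)
        \<xi>)"
proof -
  have cnt: "countable (some_onb :: 'h set)" by (rule countable_some_onb[OF separable])
  have u: "\<xi> \<noteq> 0" using unit by auto
  have am: "weak_star_measurable \<nu> a" and aai: "op_integrable \<nu> (\<lambda>t. cadjoint (a t) \<circ> a t)"
    and aa1: "op_integral \<nu> (\<lambda>t. cadjoint (a t) \<circ> a t) = id"
    using unital by (auto simp: unital_column_field_def)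
  note ac = weak_star_measurableD(1)[OF am]
  obtain C0 where C0: "\<And>t i. onorm (x t i) \<le> C0" using x_bounded by blast
  define C where "C = max C0 0"
  have C: "C \<ge> 0" by (simp add: C_def)
  note xc = selfadjoint_opD(1)[OF x_selfadjoint]
  have xn: "norm (x t i h) \<le> C * norm h" for t i h
  proof -
    have "norm (x t i h) \<le> onorm (x t i) * norm h" by (rule onorm[OF bounded_clinearD(1)[OF xc]])
    also have "\<dots> \<le> C * norm h" using C0[of t i] by (intro mult_right_mono) (auto simp: C_def)
    finally show ?thesis .
  qed
  have xb: "cmod (cinner (x t i h) h) \<le> C * (norm h)\<^sup>2" for t i h
    using cmod_cinner_le[of "x t i h" h] mult_right_mono[OF xn[of t i h], of "norm h"]
    by (simp add: power2_eq_square)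
  have xq: "\<bar>x t i h \<bullet> h\<bar> \<le> C * (norm h)\<^sup>2" for t i h
    using abs_Re_le_cmod[of "cinner (x t i h) h"] xb[of t i h] by (simp add: Re_cinner)
  define F where "F t = functional_calculus I f (x t)" for t
  have Fm: "weak_star_measurable \<nu> F"
    unfolding F_def
    by (rule weak_star_measurable_functional_calculus[OF cnt, where C=C and J=J])
      (rule x_measurable x_selfadjoint x_abelian xq C intervals I_eq f_cont x_domain u)+
  have yi: "op_integrable \<nu> (\<lambda>t. cadjoint (a t) \<circ> x t i \<circ> a t)" for i
    by (rule op_integrable_sandwich[OF cnt am aai x_measurable xb C])
  \<comment> \<open>On a closed cube, \<open>f\<close> is bounded on the compact part of it within
    the coordinate bounds by \<open>C\<close>, which carries all joint measures. On other cubes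
    \<open>f\<close> may be unbounded near a missing face, and integrability is the
    assumption.\<close>
  have Fi: "op_integrable \<nu> (\<lambda>t. cadjoint (a t) \<circ> F t \<circ> a t)"
    using rhs_defined
  proof
    assume closed: "closed I"
    define K where "K = I \<inter> cbox (\<chi> i. - C) (\<chi> i. C)"
    have "compact (f ` K)"
      using closed continuous_on_subset[OF f_cont, of K]
      by (intro compact_continuous_image) (auto simp: K_def intro: closed_Int_compact)
    then obtain B where B: "\<And>l. l \<in> K \<Longrightarrow> \<bar>f l\<bar> \<le> B"
      unfolding compact_eq_bounded_closed bounded_iff by auto
    have "\<bar>f l\<bar> \<le> max B 0" if "l \<in> I" "\<forall>i. \<bar>l $ i\<bar> \<le> C" for l
    proof -
      have "l \<in> K" using that by (auto simp: K_def mem_box_cart abs_le_iff minus_le_iff)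
      then show ?thesis using B by fastforce
    qed
    then have Fb: "cmod (cinner (F t h) h) \<le> max B 0 * (norm h)\<^sup>2" for t h
      unfolding F_def
      by (intro functional_calculus_bounded[OF x_selfadjoint x_abelian intervals I_eq f_cont x_domain u xq])
    show ?thesis by (rule op_integrable_sandwich[OF cnt am aai Fm Fb]) simp
  qed (simp add: F_def)
  define w where "w t = a t \<xi>" for t
  have sandwich: "integrable (completion \<nu>) (\<lambda>t. z t (w t) \<bullet> w t) \<and>
      Re (cinner (op_integral \<nu> (\<lambda>t. cadjoint (a t) \<circ> z t \<circ> a t) \<xi>) \<xi>) = (LINT
          t|completion \<nu>. z t (w t) \<bullet> w t)"
    if z: "op_integrable \<nu> (\<lambda>t. cadjoint (a t) \<circ> z t \<circ> a t)" for z
  proof -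
    have eq: "cinner ((cadjoint (a t) \<circ> z t \<circ> a t) \<xi>) \<xi> = cinner (z t (w t)) (w t)" for t
      by (simp add: cinner_cadjoint_left[OF ac] w_def)
    have i: "integrable (completion \<nu>) (\<lambda>t. cinner (z t (w t)) (w t))"
      using integrable_cinner[OF cnt z, of \<xi> \<xi>] unfolding eq .
    have "integrable (completion \<nu>) (\<lambda>t. Re (cinner (z t (w t)) (w t)))" using i by (rule integrable_Re)
    moreover have "Re (LINT t|completion \<nu>. cinner (z t (w t)) (w t)) = (LINT t|completion \<nu>. Re (cinner (z t
        (w t)) (w t)))"
      using integral_Re[OF i] by simp
    ultimately show ?thesis using cinner_op_integral[OF cnt z, of \<xi> \<xi>] unfolding eq by (simp add: Re_cinner)
  qed
  \<comment> \<open>The choice \<open>z = id\<close>: the unital condition says that the weight has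
    total mass 1.\<close>
  have N: "integrable (completion \<nu>) (\<lambda>t. (norm (w t))\<^sup>2)" "(LINT t|completion \<nu>. (norm (w
      t))\<^sup>2) = 1"
    using sandwich[of "\<lambda>_. id"] aai aa1 unit
    by (simp_all add: dot_square_norm Re_cinner)
  define c where "c = (\<chi> i. Re (cinner (y i \<xi>) \<xi>))"
  have c: "c $ i = (LINT t|completion \<nu>. x t i (w t) \<bullet> w t)" "integrable (completion \<nu>) (\<lambda>t. x
      t i (w t) \<bullet> w t)" for i
    using sandwich[OF yi[of i]] by (auto simp: c_def y_eq)
  have "c $ i \<in> J i" for i
    unfolding c(1) by (rule mean_in_interval[OF intervals x_selfadjoint x_domain u N c(2)])
  then have cI: "c \<in> I" by (simp add: I_eq)
  define R where "R = (LINT t|completion \<nu>. F t (w t) \<bullet> w t)"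
  have R: "Re (cinner (op_integral \<nu> (\<lambda>t. cadjoint (a t) \<circ> functional_calculus I f (x t) \<circ> a t)
      \<xi>) \<xi>) = R"
    "integrable (completion \<nu>) (\<lambda>t. F t (w t) \<bullet> w t)"
    using sandwich[OF Fi] by (auto simp: R_def F_def)
  have "f c \<le> R"
  proof (rule field_le_epsilon)
    fix e :: real assume e: "e > 0"
    obtain \<alpha> v where v: "\<And>l. l \<in> I \<Longrightarrow> \<alpha> + v \<bullet> l \<le> f l" "f c - e \<le>
        \<alpha> + v \<bullet> c"
      using convex_affine_minorant[OF f_convex f_cont cI e] by blast
    \<comment> \<open>Total mass 1 allows the constant to be written as the integral of \<alpha>
      times the weight, which matches the pointwise operator inequality.\<close>
    have "\<alpha> + v \<bullet> c = (LINT t|completion \<nu>. \<alpha> * (norm (w t))\<^sup>2 + (\<Sum>i\<in>UNIV. v $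
        i * (x t i (w t) \<bullet> w t)))"
      using N c(2) by (simp add: inner_vec_def c(1))
    also have "\<dots> \<le> R"
      unfolding R_def
    proof (rule integral_mono[OF _ R(2)])
      show "integrable (completion \<nu>) (\<lambda>t. \<alpha> * (norm (w t))\<^sup>2 + (\<Sum>i\<in>UNIV. v $ i * (x
          t i (w t) \<bullet> w t)))"
        using N(1) c(2) by auto
      show "\<alpha> * (norm (w t))\<^sup>2 + (\<Sum>i\<in>UNIV. v $ i * (x t i (w t) \<bullet> w t)) \<le> F t (w t)
          \<bullet> w t" for t
        unfolding F_def
        by (rule functional_calculus_ge_affine[OF x_selfadjoint x_abelian intervals I_eq f_cont x_domain u v(1)])
    qed
    finally show "f c \<le> R + e" using v(2) by linarith
  qed
  then show ?thesis unfolding R(1) c_def .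
qed

end
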